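(* Let $(E,\tau,M,\rho)$ be a Lie algebroid on a smooth manifold $M$. For each smooth section $V\in A^1(M,E)$ of the vector bundle $(E,\tau,M)$, there exists a unique $\mathbb{R}$-linear graded endomorphism of degree $0$ of the graded algebra of multivectors $A(M,E)$, called the Lie derivative with respect to $V$ and denoted by $\mathcal{L}_\rho(V)$, which satisfies the following properties: (i) For a smooth function $f\in A^0(M,E)=C^\infty(M,\mathbb{R})$, $$\mathcal{L}_\rho(V)f=i(\rho\circ V)df=\mathcal{L}(\rho\circ V)f,$$ where $\mathcal{L}(\rho\circ V)$ denotes the usual Lie derivative with respect to the vector field $\rho\circ V$. (ii) For an integer $p\geq1$ and a multivector $P\in A^p(M,E)$, $\mathcal{L}_\rho(V)P$ is the unique element in $A^p(M,E)$ such that, for all $\eta\in\Omega^p(M,E)$, $$\bigl\langle\eta,\mathcal{L}_\rho(V)P\bigr\rangle=\mathcal{L}_\rho(V)\bigl(\langle\eta,P\rangle\bigr)-\bigl\langle\mathcal{L}_\rho(V)\eta,P\bigr\rangle,$$ where $\mathcal{L}_\rho(V)\eta$ is the Lie derivative of the form $\eta$.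
   Context: A Lie algebroid $(E,\tau,M,\rho)$ is a smooth real vector bundle $(E,\tau,M)$ of finite rank over a smooth manifold $M$ (with projection $\tau:E\to M$), equipped with a Lie algebra bracket $(s_1,s_2)\mapsto\{s_1,s_2\}$ on the space of smooth sections of $\tau$ and a smooth vector bundle map $\rho:E\to TM$ (the anchor), such that $s\mapsto\rho\circ s$ is a Lie algebra homomorphism into the Lie algebra of smooth vector fields on $M$, and $\{s_1,fs_2\}=f\{s_1,s_2\}+\langle df,\rho\circ s_1\rangle s_2$ for all smooth sections $s_1,s_2$ and all $f\in C^\infty(M,\mathbb{R})$. For a vector field $X$ on $M$, $i(X)df=\langle df,X\rangle$. For $p\in\mathbb{Z}$, $A^p(M,E)$ is the space of smooth sections of $\bigwedge^pE$ (multivectors) and $\Omega^p(M,E)$ the space of smooth sections of $\bigwedge^pE^*$ (forms), with degree-$0$ parts equal to $C^\infty(M,\mathbb{R})$ and zero for $p<0$; $A(M,E)=\oplus_pA^p(M,E)$, $\Omega(M,E)=\oplus_p\Omega^p(M,E)$. An element of $\Omega^p(M,E)$ is identified with a skew-symmetric $C^\infty(M,\mathbb{R})$-multilinear map $A^1(M,E)^p\to C^\infty(M,\mathbb{R})$. The pairing $\Omega(M,E)\times A(M,E)\to C^\infty(M,\mathbb{R})$ is the $C^\infty(M,\mathbb{R})$-bilinear map with $\langle\eta,P\rangle=0$ if $\eta,P$ are homogeneous of different degrees, $\langle\eta,P\rangle=\eta P$ in degree $0$, and $\langle\eta_1\wedge\cdots\wedge\eta_p,v_1\wedge\cdots\wedge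 v_p\rangle=\det(\langle\eta_i,v_j\rangle)$; thus $\langle\eta,v_1\wedge\cdots\wedge v_p\rangle=\eta(v_1,\ldots,v_p)$. On forms, $\mathcal{L}_\rho(V):\Omega(M,E)\to\Omega(M,E)$ is the $\mathbb{R}$-linear, degree $0$ map with $\mathcal{L}_\rho(V)f=\langle df,\rho\circ V\rangle$ for functions $f$, and, for $\eta\in\Omega^p(M,E)$ with $p>0$, $(\mathcal{L}_\rho(V)\eta)(V_1,\ldots,V_p)=\mathcal{L}_\rho(V)(\eta(V_1,\ldots,V_p))-\sum_{i=1}^p\eta(V_1,\ldots,\{V,V_i\},\ldots,V_p)$. *)

theory Defs
  imports "HOL-Analysis.Analysis" "HOL-Combinatorics.Permutations"
begin

section \<open>Smooth maps between Euclidean spaces\<close>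

text \<open>
  Model spaces are finite-dimensional real inner product spaces. In contrast to the class
  \<^class>\<open>euclidean_space\<close>, the orthonormal basis may be empty, so that manifolds of dimension 0
  and vector bundles of rank 0 are included.
\<close>

definition euclidean_model :: "'b::real_inner itself \<Rightarrow> bool" where
  "euclidean_model _ \<longleftrightarrow>
     (\<exists>B::'b set. finite B \<and> (\<forall>u\<in>B. \<forall>v\<in>B. u \<bullet> v = (if u = v then 1 else 0)) \<and> span B = UNIV)"

text \<open>
  Used for open \<open>S\<close> only. As the domain is finite-dimensional, continuity of \<open>x \<mapsto> Df(x)\<close> is the
  same as continuity of \<open>x \<mapsto> Df(x) v\<close> for every \<open>v\<close>.
\<close>

primrec Ck_on :: "nat \<Rightarrow> 'b::real_inner set \<Rightarrow> ('b \<Rightarrow> 'c::real_normed_vector) \<Rightarrow> bool" where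
  "Ck_on 0 S f \<longleftrightarrow> continuous_on S f"
| "Ck_on (Suc k) S f \<longleftrightarrow>
     (\<forall>x\<in>S. f differentiable (at x)) \<and> (\<forall>v. Ck_on k S (\<lambda>x. frechet_derivative f (at x) v))"

definition smooth_on :: "'b::real_inner set \<Rightarrow> ('b \<Rightarrow> 'c::real_normed_vector) \<Rightarrow> bool" where
  "smooth_on S f \<longleftrightarrow> (\<forall>k. Ck_on k S f)"


section \<open>Smooth manifolds\<close>

text \<open>A chart is its domain together with its coordinate map; an atlas need not be maximal.\<close>

type_synonym ('m, 'b) chart = "'m set \<times> ('m \<Rightarrow> 'b)"

definition chart_inv :: "('m, 'b) chart \<Rightarrow> 'b \<Rightarrow> 'm" where
  "chart_inv \<kappa> = inv_into (fst \<kappa>) (snd \<kappa>)"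

definition smooth_manifold ::
  "('m::{t2_space, second_countable_topology}, 'b::real_inner) chart set \<Rightarrow> bool" where
  "smooth_manifold \<A> \<longleftrightarrow>
     euclidean_model TYPE('b) \<and>
     (\<Union>\<kappa>\<in>\<A>. fst \<kappa>) = UNIV \<and>
     (\<forall>\<kappa>\<in>\<A>. open (fst \<kappa>) \<and> open (snd \<kappa> ` fst \<kappa>) \<and>
        homeomorphism (fst \<kappa>) (snd \<kappa> ` fst \<kappa>) (snd \<kappa>) (chart_inv \<kappa>)) \<and>
     (\<forall>\<kappa>\<in>\<A>. \<forall>\<kappa>'\<in>\<A>. smooth_on (snd \<kappa> ` (fst \<kappa> \<inter> fst \<kappa>')) (snd \<kappa>' \<circ> chart_inv \<kappa>))"

text \<open>Smoothness on an open set \<open>W\<close> of a map from the manifold to a vector space:\<close>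

definition smooth_map_on ::
  "('m, 'b::real_inner) chart set \<Rightarrow> 'm set \<Rightarrow> ('m \<Rightarrow> 'c::real_normed_vector) \<Rightarrow> bool" where
  "smooth_map_on \<A> W f \<longleftrightarrow> (\<forall>\<kappa>\<in>\<A>. smooth_on (snd \<kappa> ` (fst \<kappa> \<inter> W)) (f \<circ> chart_inv \<kappa>))"

definition smooth_functions :: "('m, 'b::real_inner) chart set \<Rightarrow> ('m \<Rightarrow> real) set" where
  "smooth_functions \<A> = {f. smooth_map_on \<A> UNIV f}"


section \<open>Smooth vector bundles\<close>

text \<open>
  A vector bundle consists of the total space, the projection, the vector space operations of the
  fibres, and a set of local trivialisations \<open>(U, c)\<close>: \<open>c\<close> maps each fibre over a point of \<open>U\<close>
  isomorphically onto the typical fibre \<open>'f\<close>, so \<open>e \<mapsto> (\<tau> e, c e)\<close> is the usual trivialisation onto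
  \<open>U \<times> 'f\<close>. The topology and smooth structure of the total space are those determined by
  the trivialisations.
\<close>

record ('m, 'e, 'f) vbundle =
  tot :: "'e set"
  bproj :: "'e \<Rightarrow> 'm"
  vzero :: "'m \<Rightarrow> 'e"
  vadd :: "'e \<Rightarrow> 'e \<Rightarrow> 'e"
  vscale :: "real \<Rightarrow> 'e \<Rightarrow> 'e"
  trivs :: "('m set \<times> ('e \<Rightarrow> 'f)) set"

definition fibre :: "('m, 'e, 'f) vbundle \<Rightarrow> 'm \<Rightarrow> 'e set" where
  "fibre E x = {e \<in> tot E. bproj E e = x}"

text \<open>
  The fibres are vector spaces because the operations correspond to those of \<open>'f\<close> under a bijection.
  The last clause says that the transition functions are smooth maps into the
  linear automorphisms of \<open>'f\<close>.
\<close>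

definition vector_bundle ::
  "('m::{t2_space, second_countable_topology}, 'b::real_inner) chart set
     \<Rightarrow> ('m, 'e, 'f::real_inner) vbundle \<Rightarrow> bool" where
  "vector_bundle \<A> E \<longleftrightarrow>
     euclidean_model TYPE('f) \<and>
     (\<forall>x. vzero E x \<in> fibre E x \<and>
          (\<forall>e\<in>fibre E x. \<forall>e'\<in>fibre E x. vadd E e e' \<in> fibre E x) \<and>
          (\<forall>a. \<forall>e\<in>fibre E x. vscale E a e \<in> fibre E x)) \<and>
     (\<Union>t\<in>trivs E. fst t) = UNIV \<and>
     (\<forall>(U, c)\<in>trivs E. open U \<and>
        (\<forall>x\<in>U. bij_betw c (fibre E x) UNIV \<and>
               c (vzero E x) = 0 \<and>
               (\<forall>e\<in>fibre E x. \<forall>e'\<in>fibre E x. c (vadd E e e') = c e + c e') \<and>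
               (\<forall>a. \<forall>e\<in>fibre E x. c (vscale E a e) = a *\<^sub>R c e))) \<and>
     (\<forall>(U, c)\<in>trivs E. \<forall>(U', c')\<in>trivs E. \<forall>w.
        smooth_map_on \<A> (U \<inter> U') (\<lambda>x. c' (inv_into (fibre E x) c w)))"

definition smooth_sections ::
  "('m, 'b::real_inner) chart set \<Rightarrow> ('m, 'e, 'f::real_inner) vbundle \<Rightarrow> ('m \<Rightarrow> 'e) set" where
  "smooth_sections \<A> E =
     {s. (\<forall>x. s x \<in> fibre E x) \<and> (\<forall>(U, c)\<in>trivs E. smooth_map_on \<A> U (\<lambda>x. c (s x)))}"

definition sec_add ::
  "('m, 'e, 'f) vbundle \<Rightarrow> ('m \<Rightarrow> 'e) \<Rightarrow> ('m \<Rightarrow> 'e) \<Rightarrow> 'm \<Rightarrow> 'e" where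
  "sec_add E s t = (\<lambda>x. vadd E (s x) (t x))"

definition sec_scale ::
  "('m, 'e, 'f) vbundle \<Rightarrow> ('m \<Rightarrow> real) \<Rightarrow> ('m \<Rightarrow> 'e) \<Rightarrow> 'm \<Rightarrow> 'e" where
  "sec_scale E f s = (\<lambda>x. vscale E (f x) (s x))"

text \<open>Smooth vector bundle maps over the identity of the base:\<close>

definition bundle_map ::
  "('m, 'b::real_inner) chart set \<Rightarrow> ('m, 'e, 'f::real_inner) vbundle
     \<Rightarrow> ('m, 'e', 'f'::real_inner) vbundle \<Rightarrow> ('e \<Rightarrow> 'e') \<Rightarrow> bool" where
  "bundle_map \<A> E E' \<rho> \<longleftrightarrow>
     (\<forall>x. \<forall>e\<in>fibre E x.
        \<rho> e \<in> fibre E' x \<and>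
        (\<forall>e'\<in>fibre E x. \<rho> (vadd E e e') = vadd E' (\<rho> e) (\<rho> e')) \<and>
        (\<forall>a. \<rho> (vscale E a e) = vscale E' a (\<rho> e))) \<and>
     (\<forall>(U, c)\<in>trivs E. \<forall>(U', c')\<in>trivs E'. \<forall>w.
        smooth_map_on \<A> (U \<inter> U') (\<lambda>x. c' (\<rho> (inv_into (fibre E x) c w))))"


section \<open>The tangent bundle\<close>

text \<open>
  A tangent vector at \<open>x\<close> is a family of coordinate vectors, one for each chart around \<open>x\<close>, that
  transforms by the derivatives of the coordinate changes (and is 0 at the irrelevant charts).
\<close>

definition tangent_space ::
  "('m, 'b::real_inner) chart set \<Rightarrow> 'm \<Rightarrow> (('m, 'b) chart \<Rightarrow> 'b) set" where
  "tangent_space \<A> x =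
     {v. (\<forall>\<kappa>. \<not> (\<kappa> \<in> \<A> \<and> x \<in> fst \<kappa>) \<longrightarrow> v \<kappa> = 0) \<and>
         (\<forall>\<kappa>\<in>\<A>. \<forall>\<kappa>'\<in>\<A>. x \<in> fst \<kappa> \<inter> fst \<kappa>' \<longrightarrow>
            v \<kappa>' = frechet_derivative (snd \<kappa>' \<circ> chart_inv \<kappa>) (at (snd \<kappa> x)) (v \<kappa>))}"

type_synonym ('m, 'b) tvector = "'m \<times> (('m, 'b) chart \<Rightarrow> 'b)"

definition tangent_bundle ::
  "('m, 'b::real_inner) chart set \<Rightarrow> ('m, ('m, 'b) tvector, 'b) vbundle" where
  "tangent_bundle \<A> =
     \<lparr> tot = {(x, v). v \<in> tangent_space \<A> x},
       bproj = fst,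
       vzero = (\<lambda>x. (x, \<lambda>_. 0)),
       vadd = (\<lambda>(x, v) (_, w). (x, \<lambda>\<kappa>. v \<kappa> + w \<kappa>)),
       vscale = (\<lambda>a (x, v). (x, \<lambda>\<kappa>. a *\<^sub>R v \<kappa>)),
       trivs = (\<lambda>\<kappa>. (fst \<kappa>, \<lambda>(x, v). v \<kappa>)) ` \<A> \<rparr>"

text \<open>\<open>differential \<A> f\<close> is \<open>df\<close> as a function on the tangent bundle; it is
  independent of the chart for smooth \<open>f\<close>.\<close>

definition differential ::
  "('m, 'b::real_inner) chart set \<Rightarrow> ('m \<Rightarrow> real) \<Rightarrow> ('m, 'b) tvector \<Rightarrow> real" where
  "differential \<A> f = (\<lambda>(x, v). THE d. \<forall>\<kappa>\<in>\<A>. x \<in> fst \<kappa> \<longrightarrow>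
     d = frechet_derivative (f \<circ> chart_inv \<kappa>) (at (snd \<kappa> x)) (v \<kappa>))"

definition lie_deriv_fun ::
  "('m, 'b::real_inner) chart set \<Rightarrow> ('m \<Rightarrow> ('m, 'b) tvector) \<Rightarrow> ('m \<Rightarrow> real) \<Rightarrow> 'm \<Rightarrow> real" where
  "lie_deriv_fun \<A> X f = (\<lambda>x. differential \<A> f (X x))"

definition vf_bracket ::
  "('m, 'b::real_inner) chart set \<Rightarrow> ('m \<Rightarrow> ('m, 'b) tvector) \<Rightarrow> ('m \<Rightarrow> ('m, 'b) tvector)
     \<Rightarrow> 'm \<Rightarrow> ('m, 'b) tvector" where
  "vf_bracket \<A> X Y = (THE Z. Z \<in> smooth_sections \<A> (tangent_bundle \<A>) \<and>
     (\<forall>f\<in>smooth_functions \<A>. \<forall>x.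
        lie_deriv_fun \<A> Z f x =
          lie_deriv_fun \<A> X (lie_deriv_fun \<A> Y f) x - lie_deriv_fun \<A> Y (lie_deriv_fun \<A> X f) x))"


section \<open>Lie algebroids\<close>

definition lie_algebroid ::
  "('m::{t2_space, second_countable_topology}, 'b::real_inner) chart set
     \<Rightarrow> ('m, 'e, 'f::real_inner) vbundle
     \<Rightarrow> (('m \<Rightarrow> 'e) \<Rightarrow> ('m \<Rightarrow> 'e) \<Rightarrow> 'm \<Rightarrow> 'e) \<Rightarrow> ('e \<Rightarrow> ('m, 'b) tvector) \<Rightarrow> bool" where
  "lie_algebroid \<A> E br \<rho> \<longleftrightarrow>
     smooth_manifold \<A> \<and> vector_bundle \<A> E \<and> bundle_map \<A> E (tangent_bundle \<A>) \<rho> \<and>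
     (let \<Gamma> = smooth_sections \<A> E in
       (\<forall>s\<in>\<Gamma>. \<forall>t\<in>\<Gamma>. br s t \<in> \<Gamma>) \<and>
       (\<forall>s\<in>\<Gamma>. \<forall>t\<in>\<Gamma>. \<forall>u\<in>\<Gamma>.
          br (sec_add E s t) u = sec_add E (br s u) (br t u) \<and>
          br u (sec_add E s t) = sec_add E (br u s) (br u t)) \<and>
       (\<forall>a. \<forall>s\<in>\<Gamma>. \<forall>t\<in>\<Gamma>.
          br (sec_scale E (\<lambda>_. a) s) t = sec_scale E (\<lambda>_. a) (br s t) \<and>
          br s (sec_scale E (\<lambda>_. a) t) = sec_scale E (\<lambda>_. a) (br s t)) \<and>
       (\<forall>s\<in>\<Gamma>. br s s = vzero E) \<and>
       (\<forall>s\<in>\<Gamma>. \<forall>t\<in>\<Gamma>. \<forall>u\<in>\<Gamma>.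
          sec_add E (sec_add E (br s (br t u)) (br t (br u s))) (br u (br s t)) = vzero E) \<and>
       (\<forall>s\<in>\<Gamma>. \<forall>t\<in>\<Gamma>. \<rho> \<circ> br s t = vf_bracket \<A> (\<rho> \<circ> s) (\<rho> \<circ> t)) \<and>
       (\<forall>s\<in>\<Gamma>. \<forall>t\<in>\<Gamma>. \<forall>f\<in>smooth_functions \<A>.
          br s (sec_scale E f t) =
            sec_add E (sec_scale E f (br s t)) (sec_scale E (lie_deriv_fun \<A> (\<rho> \<circ> s) f) t)))"


section \<open>Forms and multivectors\<close>

text \<open>
  Elements of degree \<open>p\<close> of the exterior algebra of the dual of the fibre \<open>E\<^sub>x\<close>, as
  skew-symmetric \<open>p\<close>-linear maps on \<open>E\<^sub>x\<close>; maps of \<open>p\<close> arguments are encoded as maps on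
  lists, with value 0 on lists that are not lists of \<open>p\<close> elements of \<open>E\<^sub>x\<close>.
\<close>

definition alt_forms :: "('m, 'e, 'f) vbundle \<Rightarrow> 'm \<Rightarrow> nat \<Rightarrow> ('e list \<Rightarrow> real) set" where
  "alt_forms E x p = {\<eta>.
     (\<forall>es. \<not> (length es = p \<and> set es \<subseteq> fibre E x) \<longrightarrow> \<eta> es = 0) \<and>
     (\<forall>es i. length es = p \<and> set es \<subseteq> fibre E x \<and> i < p \<longrightarrow>
        (\<forall>e\<in>fibre E x. \<forall>e'\<in>fibre E x. \<eta> (es[i := vadd E e e']) = \<eta> (es[i := e]) + \<eta> (es[i := e'])) \<and>
        (\<forall>a. \<forall>e\<in>fibre E x. \<eta> (es[i := vscale E a e]) = a * \<eta> (es[i := e]))) \<and>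
     (\<forall>es i j. length es = p \<and> set es \<subseteq> fibre E x \<and> i < p \<and> j < p \<and> i \<noteq> j \<longrightarrow>
        \<eta> (es[i := es ! j, j := es ! i]) = - \<eta> es)}"

text \<open>Smoothness means that the coefficients in every local trivialisation are smooth.\<close>

definition forms ::
  "('m, 'b::real_inner) chart set \<Rightarrow> ('m, 'e, 'f::real_inner) vbundle \<Rightarrow> nat
     \<Rightarrow> ('m \<Rightarrow> 'e list \<Rightarrow> real) set" where
  "forms \<A> E p = {\<eta>. (\<forall>x. \<eta> x \<in> alt_forms E x p) \<and>
     (\<forall>(U, c)\<in>trivs E. \<forall>ws. length ws = p \<longrightarrow>
        smooth_map_on \<A> U (\<lambda>x. \<eta> x (map (inv_into (fibre E x) c) ws)))}"

definition form_apply :: "('m \<Rightarrow> 'e list \<Rightarrow> real) \<Rightarrow> ('m \<Rightarrow> 'e) list \<Rightarrow> 'm \<Rightarrow> real" where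
  "form_apply \<eta> Vs = (\<lambda>x. \<eta> x (map (\<lambda>V. V x) Vs))"

text \<open>Covectors are linear functionals on a fibre, extended by 0. The trivialisations
  of the dual bundle identify the dual of \<open>'f\<close> with \<open>'f\<close> by means of the inner product.\<close>

definition dual_space :: "('m, 'e, 'f) vbundle \<Rightarrow> 'm \<Rightarrow> ('e \<Rightarrow> real) set" where
  "dual_space E x = {\<xi>.
     (\<forall>e. e \<notin> fibre E x \<longrightarrow> \<xi> e = 0) \<and>
     (\<forall>e\<in>fibre E x. \<forall>e'\<in>fibre E x. \<xi> (vadd E e e') = \<xi> e + \<xi> e') \<and>
     (\<forall>a. \<forall>e\<in>fibre E x. \<xi> (vscale E a e) = a * \<xi> e)}"

type_synonym ('m, 'e) covector = "'m \<times> ('e \<Rightarrow> real)"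

definition dual_bundle ::
  "('m, 'e, 'f::real_inner) vbundle \<Rightarrow> ('m, ('m, 'e) covector, 'f) vbundle" where
  "dual_bundle E =
     \<lparr> tot = {(x, \<xi>). \<xi> \<in> dual_space E x},
       bproj = fst,
       vzero = (\<lambda>x. (x, \<lambda>_. 0)),
       vadd = (\<lambda>(x, \<xi>) (_, \<zeta>). (x, \<lambda>e. \<xi> e + \<zeta> e)),
       vscale = (\<lambda>a (x, \<xi>). (x, \<lambda>e. a * \<xi> e)),
       trivs = (\<lambda>(U, c). (U, \<lambda>(x, \<xi>). THE w. \<forall>e\<in>fibre E x. \<xi> e = w \<bullet> c e)) ` trivs E \<rparr>"

text \<open>
  The exterior powers of the finite-dimensional space \<open>E\<^sub>x\<close> are realised as spaces of skew-symmetric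
  multilinear maps on its dual, with \<open>v\<^sub>1 \<and> \<dots> \<and> v\<^sub>p\<close> given by
  \<open>(\<xi>\<^sub>1, \<dots>, \<xi>\<^sub>p) \<mapsto> det (\<xi>\<^sub>i (v\<^sub>j))\<close>; so multivectors on \<open>E\<close> are forms on the dual bundle.
\<close>

definition multivectors ::
  "('m, 'b::real_inner) chart set \<Rightarrow> ('m, 'e, 'f::real_inner) vbundle \<Rightarrow> nat
     \<Rightarrow> ('m \<Rightarrow> ('m, 'e) covector list \<Rightarrow> real) set" where
  "multivectors \<A> E p = forms \<A> (dual_bundle E) p"

definition det_pairing :: "('m, 'e) covector list \<Rightarrow> 'e list \<Rightarrow> real" where
  "det_pairing \<xi>s vs = (\<Sum>\<sigma> | \<sigma> permutes {..<length vs}.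
     of_int (sign \<sigma>) * (\<Prod>i<length vs. snd (\<xi>s ! i) (vs ! \<sigma> i)))"

definition wedge_covectors ::
  "('m, 'e, 'f::real_inner) vbundle \<Rightarrow> 'm \<Rightarrow> ('m, 'e) covector list \<Rightarrow> 'e list \<Rightarrow> real" where
  "wedge_covectors E x \<xi>s = (\<lambda>vs.
     if length vs = length \<xi>s \<and> set vs \<subseteq> fibre E x then det_pairing \<xi>s vs else 0)"

definition wedge_vectors ::
  "('m, 'e, 'f::real_inner) vbundle \<Rightarrow> 'm \<Rightarrow> 'e list \<Rightarrow> ('m, 'e) covector list \<Rightarrow> real" where
  "wedge_vectors E x vs = (\<lambda>\<xi>s.
     if length \<xi>s = length vs \<and> set \<xi>s \<subseteq> fibre (dual_bundle E) x then det_pairing \<xi>s vs else 0)"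

definition is_pairing ::
  "('m, 'e, 'f::real_inner) vbundle \<Rightarrow> 'm \<Rightarrow> nat
     \<Rightarrow> (('e list \<Rightarrow> real) \<Rightarrow> (('m, 'e) covector list \<Rightarrow> real) \<Rightarrow> real) \<Rightarrow> bool" where
  "is_pairing E x p B \<longleftrightarrow>
     (\<forall>\<eta>\<in>alt_forms E x p. \<forall>\<eta>'\<in>alt_forms E x p. \<forall>P\<in>alt_forms (dual_bundle E) x p. \<forall>a a'.
        B (\<lambda>vs. a * \<eta> vs + a' * \<eta>' vs) P = a * B \<eta> P + a' * B \<eta>' P) \<and>
     (\<forall>\<eta>\<in>alt_forms E x p. \<forall>P\<in>alt_forms (dual_bundle E) x p. \<forall>P'\<in>alt_forms (dual_bundle E) x p. \<forall>a a'.
        B \<eta> (\<lambda>\<xi>s. a * P \<xi>s + a' * P' \<xi>s) = a * B \<eta> P + a' * B \<eta> P') \<and>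
     (\<forall>\<xi>s vs. length \<xi>s = p \<and> length vs = p \<and>
        set \<xi>s \<subseteq> fibre (dual_bundle E) x \<and> set vs \<subseteq> fibre E x \<longrightarrow>
        B (wedge_covectors E x \<xi>s) (wedge_vectors E x vs) = det_pairing \<xi>s vs)"

text \<open>The pairing of a form and a multivector, both of degree \<open>p\<close>. Any two maps satisfying
  \<^const>\<open>is_pairing\<close> agree on elements of degree \<open>p\<close>, because these are sums of
  decomposable ones; for \<open>p = 0\<close> it is the product of functions.\<close>

definition pairing ::
  "('m, 'e, 'f::real_inner) vbundle \<Rightarrow> nat \<Rightarrow> ('m \<Rightarrow> 'e list \<Rightarrow> real)
     \<Rightarrow> ('m \<Rightarrow> ('m, 'e) covector list \<Rightarrow> real) \<Rightarrow> 'm \<Rightarrow> real" where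
  "pairing E p \<eta> P = (\<lambda>x. (SOME B. is_pairing E x p B) (\<eta> x) (P x))"

text \<open>A function as a form or multivector of degree 0:\<close>

definition scalar_field :: "('m \<Rightarrow> real) \<Rightarrow> 'm \<Rightarrow> 'a list \<Rightarrow> real" where
  "scalar_field f = (\<lambda>x es. if es = [] then f x else 0)"


section \<open>Lie derivatives of forms\<close>

text \<open>The Lie derivative of a form of degree \<open>p\<close> with respect to the section \<open>V\<close>; for \<open>p > 0\<close> a form is
  identified with the multilinear map it induces on smooth sections.\<close>

definition lie_deriv_form ::
  "('m, 'b::real_inner) chart set \<Rightarrow> ('m, 'e, 'f::real_inner) vbundle
     \<Rightarrow> (('m \<Rightarrow> 'e) \<Rightarrow> ('m \<Rightarrow> 'e) \<Rightarrow> 'm \<Rightarrow> 'e) \<Rightarrow> ('e \<Rightarrow> ('m, 'b) tvector)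
     \<Rightarrow> ('m \<Rightarrow> 'e) \<Rightarrow> nat \<Rightarrow> ('m \<Rightarrow> 'e list \<Rightarrow> real) \<Rightarrow> 'm \<Rightarrow> 'e list \<Rightarrow> real" where
  "lie_deriv_form \<A> E br \<rho> V p \<eta> =
     (if p = 0 then scalar_field (lie_deriv_fun \<A> (\<rho> \<circ> V) (\<lambda>x. \<eta> x []))
      else THE \<theta>. \<theta> \<in> forms \<A> E p \<and>
        (\<forall>Vs. length Vs = p \<and> set Vs \<subseteq> smooth_sections \<A> E \<longrightarrow>
           (\<forall>x. form_apply \<theta> Vs x = lie_deriv_fun \<A> (\<rho> \<circ> V) (form_apply \<eta> Vs) x
                  - (\<Sum>i<p. form_apply \<eta> (Vs[i := br V (Vs ! i)]) x))))"


section \<open>The graded space of multivectors\<close>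

text \<open>An element of the direct sum is the family of its homogeneous components; there are no
  components of negative degree.\<close>

type_synonym ('m, 'e) multivector_family = "nat \<Rightarrow> 'm \<Rightarrow> ('m, 'e) covector list \<Rightarrow> real"

definition graded_multivectors ::
  "('m, 'b::real_inner) chart set \<Rightarrow> ('m, 'e, 'f::real_inner) vbundle
     \<Rightarrow> ('m, 'e) multivector_family set" where
  "graded_multivectors \<A> E =
     {P. (\<forall>p. P p \<in> multivectors \<A> E p) \<and> finite {p. P p \<noteq> (\<lambda>_ _. 0)}}"

definition homog ::
  "nat \<Rightarrow> ('m \<Rightarrow> ('m, 'e) covector list \<Rightarrow> real) \<Rightarrow> ('m, 'e) multivector_family" where
  "homog p P = (\<lambda>q. if q = p then P else (\<lambda>_ _. 0))"

definition graded_endomorphism_deg0 ::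
  "('m, 'b::real_inner) chart set \<Rightarrow> ('m, 'e, 'f::real_inner) vbundle
     \<Rightarrow> (('m, 'e) multivector_family \<Rightarrow> ('m, 'e) multivector_family) \<Rightarrow> bool" where
  "graded_endomorphism_deg0 \<A> E L \<longleftrightarrow>
     (\<forall>P\<in>graded_multivectors \<A> E. L P \<in> graded_multivectors \<A> E) \<and>
     (\<forall>P\<in>graded_multivectors \<A> E. \<forall>Q\<in>graded_multivectors \<A> E. \<forall>a b.
        L (\<lambda>p x \<xi>s. a * P p x \<xi>s + b * Q p x \<xi>s) = (\<lambda>p x \<xi>s. a * L P p x \<xi>s + b * L Q p x \<xi>s)) \<and>
     (\<forall>p. L ` homog p ` multivectors \<A> E p \<subseteq> homog p ` multivectors \<A> E p)"

end

theory Submission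
  imports Defs
begin

text \<open>
  Let \<open>X\<close> be a derivation of the smooth functions and \<open>D\<close> an additive operator on the sections of a
  vector bundle with \<open>D (f s) = f D s + (X f) s\<close>. For a \<open>p\<close>-form \<open>\<eta>\<close> the expression
  \<open>X (\<eta> (s\<^sub>1, \<dots>, s\<^sub>p)) - (\<Sum>i. \<eta> (s\<^sub>1, \<dots>, D s\<^sub>i, \<dots>, s\<^sub>p))\<close> is linear over the smooth functions, hence
  defines a \<open>p\<close>-form. With \<open>D = br V\<close> this is the Lie derivative of forms. For \<open>p = 1\<close> it gives an operator
  \<open>D'\<close> of the same kind on sections of the dual bundle; as multivectors are forms on the dual bundle, the
  construction for \<open>D'\<close> gives the Lie derivative of multivectors. Its compatibility with the pairing is
  checked in local dual frames, where the matrices of \<open>D\<close> and \<open>D'\<close> cancel. Uniqueness follows from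
  \<open>\<langle>\<alpha>\<^sub>1 \<and> \<dots> \<and> \<alpha>\<^sub>p, Q\<rangle> = Q (\<alpha>\<^sub>1, \<dots>, \<alpha>\<^sub>p)\<close>.
\<close>

section \<open>Calculus in Euclidean model spaces\<close>

text \<open>The bracket and the anchor act on global sections, whereas forms, multivectors and the
  pairing are defined fibre by fibre. Cutoff functions link the two: they extend a local frame to
  global sections, and they show that an operator linear over the smooth functions depends at each
  point only on the value of the section there. This is what bump functions, compact balls and the
  Hausdorff property are for. The model spaces are only \<open>real_inner\<close> with a finite
  orthonormal basis, and \<open>Ck_on\<close> speaks of derivatives in fixed directions, so a
  derivative in a varying direction is always expanded in that basis. \<open>pairing\<close> is an
  arbitrary choice among the maps with \<open>is_pairing\<close>; it becomes computable because each
  frame gives an explicit map of this kind and all of them agree on alternating forms. The factors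
  \<open>fact p\<close> arise because sums run over all p-tuples of basis vectors, not only over the
  increasing ones.\<close>

lemma has_derivative_cong_open:
  assumes "open W" "x \<in> W" "\<And>y. y \<in> W \<Longrightarrow> f y = g y"
  shows "(f has_derivative D) (at x) \<longleftrightarrow> (g has_derivative D) (at x)"
  using assms has_derivative_transform_within_open[of f D x UNIV W g]
    has_derivative_transform_within_open[of g D x UNIV W f] by auto

lemma frechet_derivative_cong_open:
  assumes "open W" "x \<in> W" "\<And>y. y \<in> W \<Longrightarrow> f y = g y"
  shows "frechet_derivative f (at x) = frechet_derivative g (at x)"
  unfolding frechet_derivative_def using has_derivative_cong_open[OF assms] by simp

lemma has_derivative_frechet:
  "(f has_derivative D) (at x) \<Longrightarrow> frechet_derivative f (at x) = D"
  by (metis differentiableI frechet_derivative_works has_derivative_unique)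

section \<open>Closure properties of functions of class C^k\<close>

lemma Ck_on_cong:
  assumes "open S" "Ck_on k S f" "\<And>x. x \<in> S \<Longrightarrow> f x = g x"
  shows "Ck_on k S g"
  using assms(2,3)
proof (induction k arbitrary: f g)
  case 0
  then show ?case by (simp cong: continuous_on_cong)
next
  case (Suc k)
  have "g differentiable (at x)" if x: "x \<in> S" for x
  proof -
    obtain D where "(f has_derivative D) (at x)"
      using Suc.prems(1) x by (auto simp: differentiable_def)
    then have "(g has_derivative D) (at x)"
      using has_derivative_cong_open[OF assms(1) x, of f g] Suc.prems(2) by simp
    then show ?thesis by (auto simp: differentiable_def)
  qed
  moreover have "frechet_derivative f (at x) = frechet_derivative g (at x)" if "x \<in> S" for x
    using frechet_derivative_cong_open[OF assms(1) that, of f g] Suc.prems(2) by simp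
  ultimately show ?case
    using Suc.prems(1) Suc.IH[of "\<lambda>x. frechet_derivative f (at x) v"
        "\<lambda>x. frechet_derivative g (at x) v" for v]
    by simp
qed

text \<open>Any formula for the derivative that is valid on the open set S may replace
  \<open>frechet_derivative\<close> in the recursion; all inductions below enter through this
  form.\<close>

lemma Ck_on_SucI:
  assumes "open S" "\<And>x. x \<in> S \<Longrightarrow> (f has_derivative f' x) (at x)"
    and "\<And>v. Ck_on k S (\<lambda>x. f' x v)"
  shows "Ck_on (Suc k) S f"
  using assms has_derivative_frechet[OF assms(2)]
  by (auto simp: differentiable_def intro!: Ck_on_cong[OF assms(1) assms(3)])

lemma Ck_on_Suc_has_derivative:
  assumes "Ck_on (Suc k) S f" "x \<in> S"
  shows "(f has_derivative frechet_derivative f (at x)) (at x)"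
  using assms frechet_derivative_works by auto

lemma Ck_on_Suc_le: "Ck_on (Suc k) S f \<Longrightarrow> Ck_on k S f"
proof (induction k arbitrary: f)
  case 0
  then show ?case
    by (auto intro!: continuous_at_imp_continuous_on differentiable_imp_continuous_within)
qed simp

lemma Ck_on_subset: "Ck_on k S f \<Longrightarrow> T \<subseteq> S \<Longrightarrow> Ck_on k T f"
  by (induction k arbitrary: f) (auto intro: continuous_on_subset)

lemma Ck_on_local:
  assumes "\<And>x. x \<in> S \<Longrightarrow> \<exists>T. open T \<and> x \<in> T \<and> Ck_on k T f"
  shows "Ck_on k S f"
  using assms
proof (induction k arbitrary: f)
  case 0
  have "continuous (at x within S) f" if x: "x \<in> S" for x
  proof -
    obtain T where "open T" "x \<in> T" "continuous_on T f" using 0 x by auto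
    then have "isCont f x" by (simp add: continuous_on_eq_continuous_at)
    then show ?thesis by (rule continuous_at_imp_continuous_at_within)
  qed
  then show ?case by (simp add: continuous_on_eq_continuous_within)
next
  case (Suc k)
  have "f differentiable (at x)" if "x \<in> S" for x
    using Suc.prems[OF that] by auto
  moreover have "Ck_on k S (\<lambda>x. frechet_derivative f (at x) v)" for v
    by (rule Suc.IH) (use Suc.prems in fastforce)
  ultimately show ?case by simp
qed

lemma Ck_on_const [simp]: "Ck_on k S (\<lambda>x. c)"
proof (induction k arbitrary: c)
  case (Suc k)
  have "frechet_derivative (\<lambda>x. c) (at x) = (\<lambda>_. 0)" for x :: 'a
    by (rule has_derivative_frechet) simp
  then show ?case using Suc by simp
qed simp

lemma Ck_on_bounded_linear:
  assumes "bounded_linear L" "open S" "Ck_on k S f"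
  shows "Ck_on k S (\<lambda>x. L (f x))"
  using assms(3)
proof (induction k arbitrary: f)
  case 0
  then show ?case by (simp add: bounded_linear.continuous_on[OF assms(1)])
next
  case (Suc k)
  show ?case
  proof (rule Ck_on_SucI[OF assms(2)])
    show "((\<lambda>x. L (f x)) has_derivative (\<lambda>v. L (frechet_derivative f (at x) v))) (at x)"
      if "x \<in> S" for x
      using bounded_linear.has_derivative[OF assms(1) Ck_on_Suc_has_derivative[OF Suc.prems that]] .
    show "Ck_on k S (\<lambda>x. L (frechet_derivative f (at x) v))" for v
      by (rule Suc.IH) (use Suc.prems in simp)
  qed
qed

lemma Ck_on_add:
  assumes "open S" "Ck_on k S f" "Ck_on k S g"
  shows "Ck_on k S (\<lambda>x. f x + g x)"
  using assms(2,3)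
proof (induction k arbitrary: f g)
  case 0
  then show ?case by (simp add: continuous_on_add)
next
  case (Suc k)
  show ?case
  proof (rule Ck_on_SucI[OF assms(1)])
    show "((\<lambda>x. f x + g x) has_derivative
        (\<lambda>v. frechet_derivative f (at x) v + frechet_derivative g (at x) v)) (at x)"
      if "x \<in> S" for x
      using Ck_on_Suc_has_derivative[OF Suc.prems(1) that]
        Ck_on_Suc_has_derivative[OF Suc.prems(2) that] by (rule has_derivative_add)
    show "Ck_on k S (\<lambda>x. frechet_derivative f (at x) v + frechet_derivative g (at x) v)" for v
      by (rule Suc.IH) (use Suc.prems in simp_all)
  qed
qed

lemma Ck_on_sum:
  assumes "open S" "\<And>i. i \<in> I \<Longrightarrow> Ck_on k S (f i)"
  shows "Ck_on k S (\<lambda>x. \<Sum>i\<in>I. f i x)"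
  using assms(2)
  by (induction I rule: infinite_finite_induct) (auto intro: Ck_on_add[OF assms(1)])

text \<open>The product rule returns two terms of the same bilinear shape: one factor is a
  derivative, the other the undifferentiated function, which is also of class C^k by
  \<open>Ck_on_Suc_le\<close>. Hence the induction closes.\<close>

lemma Ck_on_bilinear:
  assumes "bounded_bilinear h" "open S" "Ck_on k S f" "Ck_on k S g"
  shows "Ck_on k S (\<lambda>x. h (f x) (g x))"
  using assms(3,4)
proof (induction k arbitrary: f g)
  case 0
  then show ?case by (simp add: bounded_bilinear.continuous_on[OF assms(1)])
next
  case (Suc k)
  show ?case
  proof (rule Ck_on_SucI[OF assms(2)])
    show "((\<lambda>x. h (f x) (g x)) has_derivative
        (\<lambda>v. h (f x) (frechet_derivative g (at x) v) + h (frechet_derivative f (at x) v) (g x))) (at x)"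
      if "x \<in> S" for x
      using bounded_bilinear.FDERIV[OF assms(1) Ck_on_Suc_has_derivative[OF Suc.prems(1) that]
        Ck_on_Suc_has_derivative[OF Suc.prems(2) that]] .
    show "Ck_on k S (\<lambda>x. h (f x) (frechet_derivative g (at x) v)
        + h (frechet_derivative f (at x) v) (g x))" for v
      by (intro Ck_on_add[OF assms(2)] Suc.IH)
        (use Suc.prems Ck_on_Suc_le in simp_all)
  qed
qed

section \<open>Orthonormal bases of model spaces and the chain rule\<close>

definition orthonormal_basis :: "'b::real_inner set \<Rightarrow> bool" where
  "orthonormal_basis B \<longleftrightarrow>
     finite B \<and> (\<forall>u\<in>B. \<forall>v\<in>B. u \<bullet> v = (if u = v then 1 else 0)) \<and> span B = UNIV"

definition onb :: "'b::real_inner set" where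
  "onb = (SOME B. orthonormal_basis B)"

lemma orthonormal_basis_onb:
  "euclidean_model TYPE('b::real_inner) \<Longrightarrow> orthonormal_basis (onb :: 'b set)"
  unfolding euclidean_model_def onb_def orthonormal_basis_def by (rule someI_ex)

lemma finite_onb: "euclidean_model TYPE('b::real_inner) \<Longrightarrow> finite (onb :: 'b set)"
  using orthonormal_basis_onb orthonormal_basis_def by blast

lemma inner_onb:
  "euclidean_model TYPE('b::real_inner) \<Longrightarrow> u \<in> onb \<Longrightarrow> v \<in> onb \<Longrightarrow>
     u \<bullet> (v::'b) = (if u = v then 1 else 0)"
  using orthonormal_basis_onb orthonormal_basis_def by blast

text \<open>The vectors x with this property form a subspace, and orthonormality puts the basis into
  it.\<close>

lemma onb_expand:
  assumes "euclidean_model TYPE('b::real_inner)"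
  shows "(\<Sum>b\<in>onb. (x \<bullet> b) *\<^sub>R b) = (x::'b)"
proof -
  have "x \<in> span onb"
    using orthonormal_basis_onb[OF assms] by (auto simp: orthonormal_basis_def)
  then show ?thesis
  proof (induction rule: span_induct)
    case base
    show ?case
      by (auto simp: subspace_def inner_add_left scaleR_add_left sum.distrib
          simp flip: scaleR_scaleR scaleR_sum_right)
  next
    case (step a)
    have "(\<Sum>b\<in>onb. (a \<bullet> b) *\<^sub>R b) = (\<Sum>b\<in>onb. if a = b then b else 0)"
      using inner_onb[OF assms step] by (intro sum.cong) auto
    then show ?case using step finite_onb[OF assms] by simp
  qed
qed

lemma euclidean_model_real: "euclidean_model TYPE(real)"
  unfolding euclidean_model_def
proof (intro exI[of _ "{1}"] conjI)
  show "span {1} = (UNIV :: real set)"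
    by (auto simp: span_singleton)
qed auto

text \<open>In the chain rule the derivative of g is applied to a direction that moves with x, but
  \<open>Ck_on\<close> only controls derivatives of g in fixed directions. Expanding the moving
  direction in \<open>onb\<close> gives a finite sum of products of C^k functions, to which the
  induction hypothesis applies.\<close>

lemma Ck_on_compose:
  fixes f :: "'a::real_inner \<Rightarrow> 'b::real_inner"
  assumes "euclidean_model TYPE('b)" "open S" "open T" "f ` S \<subseteq> T"
    and "Ck_on k S f" "Ck_on k T g"
  shows "Ck_on k S (\<lambda>x. g (f x))"
  using assms(5,6)
proof (induction k arbitrary: g)
  case 0
  then show ?case
    using continuous_on_compose2[of T g S f] assms(4) by simp
next
  case (Suc k)
  let ?Df = "\<lambda>x. frechet_derivative f (at x)" and ?Dg = "\<lambda>x. frechet_derivative g (at x)"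
  show ?case
  proof (rule Ck_on_SucI[OF assms(2)])
    show "((\<lambda>x. g (f x)) has_derivative (\<lambda>v. \<Sum>b\<in>onb. (?Df x v \<bullet> b) *\<^sub>R ?Dg (f x) b)) (at x)"
      if x: "x \<in> S" for x
    proof -
      have f: "(f has_derivative ?Df x) (at x)"
        by (rule Ck_on_Suc_has_derivative[OF Suc.prems(1) x])
      have g: "(g has_derivative ?Dg (f x)) (at (f x))"
        by (rule Ck_on_Suc_has_derivative[OF Suc.prems(2)]) (use assms(4) x in auto)
      have lin: "linear (?Dg (f x))" by (rule has_derivative_linear[OF g])
      have "?Dg (f x) w = (\<Sum>b\<in>onb. (w \<bullet> b) *\<^sub>R ?Dg (f x) b)" for w
      proof -
        have "?Dg (f x) w = ?Dg (f x) (\<Sum>b\<in>onb. (w \<bullet> b) *\<^sub>R b)"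
          by (simp only: onb_expand[OF assms(1)])
        then show ?thesis by (simp add: linear_sum[OF lin] linear_scale[OF lin])
      qed
      then have "(\<lambda>v. ?Dg (f x) (?Df x v)) = (\<lambda>v. \<Sum>b\<in>onb. (?Df x v \<bullet> b) *\<^sub>R ?Dg (f x) b)"
        by blast
      then show ?thesis using diff_chain_at[OF f g] by (simp add: o_def)
    qed
    show "Ck_on k S (\<lambda>x. \<Sum>b\<in>onb. (?Df x v \<bullet> b) *\<^sub>R ?Dg (f x) b)" for v
    proof (intro Ck_on_sum[OF assms(2)] Ck_on_bilinear[OF bounded_bilinear_scaleR assms(2)])
      fix b :: 'b
      show "Ck_on k S (\<lambda>x. ?Df x v \<bullet> b)"
        using Suc.prems(1) by (intro Ck_on_bounded_linear[OF bounded_linear_inner_left assms(2)]) simp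
      show "Ck_on k S (\<lambda>x. ?Dg (f x) b)"
        using Suc.prems Ck_on_Suc_le by (intro Suc.IH) simp_all
    qed
  qed
qed

lemma Ck_on_ident: "Ck_on k S (\<lambda>x. x)"
proof (cases k)
  case (Suc n)
  have "frechet_derivative (\<lambda>x. x) (at x) = (\<lambda>v. v)" for x :: 'a
    by (rule has_derivative_frechet) (rule has_derivative_ident)
  then show ?thesis using Suc by simp
qed (simp add: continuous_on_id)

lemma smooth_on_compose:
  fixes f :: "'a::real_inner \<Rightarrow> 'b::real_inner"
  assumes "euclidean_model TYPE('b)" "open S" "open T" "f ` S \<subseteq> T" "smooth_on S f" "smooth_on T g"
  shows "smooth_on S (\<lambda>x. g (f x))"
  using assms(5,6) Ck_on_compose[OF assms(1-4)] unfolding smooth_on_def by blast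

section \<open>Flat functions, plateau functions and compact balls in model spaces\<close>

definition flat_poly :: "real poly \<Rightarrow> real \<Rightarrow> real" where
  "flat_poly q t = (if t \<le> 0 then 0 else poly q (1 / t) * exp (- (1 / t)))"

lemma poly_times_exp_neg_tendsto_0: "((\<lambda>u. poly q u * exp (- u)) \<longlongrightarrow> (0::real)) at_top"
proof -
  have "((\<lambda>u. \<Sum>i\<le>degree q. coeff q i * (u ^ i / exp u)) \<longlongrightarrow> (\<Sum>i\<le>degree q. coeff q i * 0)) at_top"
    by (intro tendsto_intros tendsto_power_div_exp_0)
  moreover have "poly q u * exp (- u) = (\<Sum>i\<le>degree q. coeff q i * (u ^ i / exp u))" for u
    by (simp add: poly_altdef exp_minus sum_distrib_right divide_inverse mult.assoc)
  ultimately show ?thesis by simp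
qed

lemma flat_poly_tendsto_0: "(flat_poly q \<longlongrightarrow> 0) (at 0)"
proof -
  have "((\<lambda>t. poly q (inverse t) * exp (- inverse t)) \<longlongrightarrow> 0) (at_right (0::real))"
    by (rule filterlim_compose[OF poly_times_exp_neg_tendsto_0 filterlim_inverse_at_top_right])
  then have "(flat_poly q \<longlongrightarrow> 0) (at_right 0)"
    by (rule Lim_transform_eventually)
      (auto simp: flat_poly_def eventually_at_filter field_simps)
  moreover have "(flat_poly q \<longlongrightarrow> 0) (at_left 0)"
    by (rule Lim_transform_eventually[OF tendsto_const])
      (auto simp: flat_poly_def eventually_at_filter)
  ultimately show ?thesis by (simp add: filterlim_split_at)
qed

text \<open>With u = 1/t one has du/dt = -u^2, so q(u) exp(-u) has derivative u^2 (q(u) - q'(u))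
  exp(-u). The polynomial parameter makes the family closed under differentiation, so smoothness of
  exp(-1/t) extended by 0 is an induction over all q at once.\<close>

lemma flat_poly_has_derivative:
  "(flat_poly q has_field_derivative flat_poly ([:0, 0, 1:] * (q - pderiv q)) t) (at t)"
proof (cases t "0::real" rule: linorder_cases)
  case less
  have "((\<lambda>_. 0) has_field_derivative 0) (at t)" by simp
  then have "(flat_poly q has_field_derivative 0) (at t)"
    by (rule has_field_derivative_transform_within_open[of _ _ _ "{..<0}"])
      (use less in \<open>auto simp: flat_poly_def\<close>)
  then show ?thesis using less by (simp add: flat_poly_def)
next
  case equal
  have "(\<lambda>h. (flat_poly q (0 + h) - flat_poly q 0) / h) \<midarrow>0\<rightarrow> 0"
  \<comment> \<open>Dividing by h multiplies the polynomial in 1/h by one more power of its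
    variable, so the difference quotient at 0 is again a \<open>flat_poly\<close>.\<close>
  proof (rule Lim_transform_eventually[OF flat_poly_tendsto_0[of "[:0, 1:] * q"]])
    show "\<forall>\<^sub>F h in at 0. flat_poly ([:0, 1:] * q) h = (flat_poly q (0 + h) - flat_poly q 0) / h"
      by (auto simp: flat_poly_def eventually_at_filter)
  qed
  then show ?thesis using equal by (simp add: DERIV_def flat_poly_def)
next
  case greater
  have "((\<lambda>t. poly q (1 / t) * exp (- (1 / t))) has_field_derivative
      flat_poly ([:0, 0, 1:] * (q - pderiv q)) t) (at t)"
    using greater
    by (auto intro!: derivative_eq_intros poly_DERIV[THEN DERIV_chain2]
        simp: flat_poly_def field_simps power2_eq_square)
  then show ?thesis
    by (rule has_field_derivative_transform_within_open[of _ _ _ "{0<..}"])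
      (use greater in \<open>auto simp: flat_poly_def\<close>)
qed

lemma Ck_on_flat_poly: "Ck_on k UNIV (flat_poly q)"
proof (induction k arbitrary: q)
  case 0
  show ?case using DERIV_isCont[OF flat_poly_has_derivative]
    by (auto simp: continuous_on_eq_continuous_at)
next
  case (Suc k)
  show ?case
  proof (rule Ck_on_SucI)
    show "(flat_poly q has_derivative (\<lambda>v. v * flat_poly ([:0, 0, 1:] * (q - pderiv q)) x)) (at x)" for x
      using flat_poly_has_derivative[of q x] by (simp add: has_field_derivative_def mult_commute_abs)
    show "Ck_on k UNIV (\<lambda>x. v * flat_poly ([:0, 0, 1:] * (q - pderiv q)) x)" for v
      by (intro Ck_on_bounded_linear[OF bounded_linear_mult_right] Suc.IH) simp
  qed simp
qed

lemma smooth_plateau: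
  fixes y :: "'b::real_inner"
  assumes "r > 0"
  obtains \<phi> :: "'b \<Rightarrow> real" and \<delta> where "smooth_on UNIV \<phi>" "\<delta> > 0" "\<delta> \<le> r"
    "\<And>z. dist y z < \<delta> \<Longrightarrow> \<phi> z = 1" "\<And>z. dist y z \<ge> r \<Longrightarrow> \<phi> z = 0"
proof -
  define k where "k = flat_poly 1"
  have k_mono: "k s \<le> k t" if "s \<le> t" for s t
  proof (cases "s \<le> 0")
    case True
    then show ?thesis by (simp add: k_def flat_poly_def)
  next
    case False
    then show ?thesis using that by (simp add: k_def flat_poly_def frac_le)
  qed
  have k_pos: "k t > 0" if "t > 0" for t
    using that by (simp add: k_def flat_poly_def)
  have k_0: "k t = 0" if "t \<le> 0" for t
    using that by (simp add: k_def flat_poly_def)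
  \<comment> \<open>At distance d < r/2 from y one has r^2 - d^2 \<ge> r^2/2, so the inner
    \<open>k\<close> below is at least c and the outer one vanishes. At distance d \<ge> r the inner
    one is 0 and the quotient equals 1.\<close>
  define c where "c = k (r\<^sup>2 / 2)"
  have c: "c > 0" unfolding c_def by (rule k_pos) (use assms in simp)
  \<comment> \<open>\<open>k\<close> vanishes on \<open>t \<le> 0\<close>, so composing it twice flattens the bump to a plateau without dividing functions.\<close>
  define \<phi> where "\<phi> = (\<lambda>z. 1 - k (c - k (r\<^sup>2 - (z - y) \<bullet> (z - y))) / k c)"
  have k_smooth: "smooth_on UNIV k"
    using Ck_on_flat_poly by (simp add: smooth_on_def k_def)
  have diff: "Ck_on n UNIV (\<lambda>z. a - f z)" if "Ck_on n UNIV f" for n a and f :: "'b \<Rightarrow> real"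
    using Ck_on_add[OF open_UNIV Ck_on_const[of n UNIV a]
        Ck_on_bounded_linear[OF bounded_linear_minus[OF bounded_linear_ident] open_UNIV that]]
    by simp
  have sq: "(z - y) \<bullet> (z - y) = (dist y z)\<^sup>2" for z
    by (metis dist_commute dist_norm power2_norm_eq_inner)
  have ksm: "smooth_on UNIV (\<lambda>z. k (f z))" if "smooth_on UNIV f" for f :: "'b \<Rightarrow> real"
    by (rule smooth_on_compose[OF euclidean_model_real open_UNIV open_UNIV _ that k_smooth]) simp
  have sub: "Ck_on n UNIV (\<lambda>z. z - y)" for n
    using Ck_on_add[OF open_UNIV Ck_on_ident[of n UNIV] Ck_on_const[of n UNIV "- y"]] by simp
  have "smooth_on UNIV (\<lambda>z. r\<^sup>2 - (z - y) \<bullet> (z - y))"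
    unfolding smooth_on_def
    by (intro allI diff Ck_on_bilinear[OF bounded_bilinear_inner open_UNIV] sub)
  then have "smooth_on UNIV (\<lambda>z. c - k (r\<^sup>2 - (z - y) \<bullet> (z - y)))"
    using ksm diff by (simp add: smooth_on_def)
  then have "smooth_on UNIV (\<lambda>z. k (c - k (r\<^sup>2 - (z - y) \<bullet> (z - y))))"
    by (rule ksm)
  then have "smooth_on UNIV \<phi>"
    unfolding smooth_on_def \<phi>_def
    by (intro allI diff Ck_on_bounded_linear[OF bounded_linear_divide open_UNIV]) simp
  moreover have "\<phi> z = 1" if "dist y z < r / 2" for z
  proof -
    have "(dist y z)\<^sup>2 \<le> (r / 2)\<^sup>2"
      using that by (intro power_mono) auto
    also have "\<dots> \<le> r\<^sup>2 / 2" by (simp add: power_divide)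
    finally have "r\<^sup>2 / 2 \<le> r\<^sup>2 - (z - y) \<bullet> (z - y)"
      by (simp add: sq)
    then have "c \<le> k (r\<^sup>2 - (z - y) \<bullet> (z - y))" unfolding c_def by (rule k_mono)
    then show ?thesis by (simp add: \<phi>_def k_0)
  qed
  moreover have "\<phi> z = 0" if "dist y z \<ge> r" for z
  proof -
    have "r\<^sup>2 \<le> (dist y z)\<^sup>2" using that assms by (intro power_mono) auto
    then have "r\<^sup>2 - (z - y) \<bullet> (z - y) \<le> 0"
      by (simp add: sq)
    then show ?thesis using k_pos[OF c] by (simp add: \<phi>_def k_0)
  qed
  ultimately show ?thesis using that[of \<phi> "r / 2"] assms by simp
qed

text \<open>For a \<open>real_inner\<close> type compactness has to come from the finite basis. The
  box K of vectors with coefficients bounded by r is, by induction on the basis, a continuous image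
  of a product of intervals; by Cauchy-Schwarz the ball is a closed subset of a translate of
  K.\<close>

lemma compact_cball_euclidean_model:
  assumes "euclidean_model TYPE('b::real_inner)"
  shows "compact (cball (y::'b) r)"
proof -
  define K where "K B = {\<Sum>b\<in>B. c b *\<^sub>R b | c. \<forall>b\<in>B. \<bar>c b\<bar> \<le> r}" for B :: "'b set"
  have "compact (K B)" if "finite B" for B
    using that
  proof (induction B)
    case empty
    then show ?case by (simp add: K_def)
  next
    case (insert b B)
    have "K (insert b B) = (\<lambda>(t, z). t *\<^sub>R b + z) ` ({-r..r} \<times> K B)"
    proof (intro equalityI subsetI)
      fix z assume "z \<in> K (insert b B)"
      then obtain c where "z = (\<Sum>b\<in>insert b B. c b *\<^sub>R b)" "\<forall>b\<in>insert b B. \<bar>c b\<bar> \<le> r"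
        by (auto simp: K_def)
      then show "z \<in> (\<lambda>(t, z). t *\<^sub>R b + z) ` ({-r..r} \<times> K B)"
        using insert.hyps by (auto simp: K_def abs_le_iff intro!: image_eqI[of _ _ "(c b, \<Sum>b\<in>B. c b *\<^sub>R b)"])
    next
      fix z assume "z \<in> (\<lambda>(t, z). t *\<^sub>R b + z) ` ({-r..r} \<times> K B)"
      then obtain t c where z: "z = t *\<^sub>R b + (\<Sum>b\<in>B. c b *\<^sub>R b)" "\<bar>t\<bar> \<le> r" "\<forall>b\<in>B. \<bar>c b\<bar> \<le> r"
        by (auto simp: K_def abs_le_iff)
      moreover have "(\<Sum>a\<in>B. c a *\<^sub>R a) = (\<Sum>a\<in>B. (c(b := t)) a *\<^sub>R a)"
        using insert.hyps by (intro sum.cong) auto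
      ultimately have "z = (\<Sum>a\<in>insert b B. (c(b := t)) a *\<^sub>R a)" using insert.hyps by simp
      moreover have "\<forall>a\<in>insert b B. \<bar>(c(b := t)) a\<bar> \<le> r" using z insert.hyps by auto
      ultimately show "z \<in> K (insert b B)" unfolding K_def by blast
    qed
    moreover have "compact ((\<lambda>(t, z). t *\<^sub>R b + z) ` ({-r..r} \<times> K B))"
      unfolding case_prod_beta
      by (intro compact_continuous_image compact_Times insert.IH compact_Icc continuous_intros)
    ultimately show ?case by simp
  qed
  then have "compact (K onb)" using finite_onb[OF assms] .
  then have "compact ((+) y ` K onb)" by (rule compact_translation)
  moreover have "cball y r \<subseteq> (+) y ` K onb"
  proof
    fix z assume z: "z \<in> cball y r"
    have "\<bar>(z - y) \<bullet> b\<bar> \<le> r" if "b \<in> onb" for b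
    proof -
      have "norm b = 1" using inner_onb[OF assms that that] by (simp add: norm_eq_sqrt_inner)
      then show ?thesis
        using Cauchy_Schwarz_ineq2[of "z - y" b] z by (simp add: dist_norm norm_minus_commute)
    qed
    moreover have "z - y = (\<Sum>b\<in>onb. ((z - y) \<bullet> b) *\<^sub>R b)" by (simp add: onb_expand[OF assms])
    ultimately have "z - y \<in> K onb" unfolding K_def by blast
    then show "z \<in> (+) y ` K onb" by (auto intro!: image_eqI[of _ _ "z - y"])
  qed
  ultimately show ?thesis
    by (metis closed_Int_compact closed_cball inf.absorb_iff1)
qed

section \<open>Smooth functions and vector fields on manifolds\<close>

locale smooth_mfd =
  fixes \<A> :: "('m::{t2_space, second_countable_topology}, 'b::real_inner) chart set"
  assumes mfd: "smooth_manifold \<A>"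
begin

lemma model: "euclidean_model TYPE('b)"
  using mfd by (simp add: smooth_manifold_def)

lemma chart_at:
  obtains \<kappa> where "\<kappa> \<in> \<A>" "x \<in> fst \<kappa>"
proof -
  have "x \<in> (\<Union>\<kappa>\<in>\<A>. fst \<kappa>)" using mfd unfolding smooth_manifold_def by blast
  then show ?thesis using that by blast
qed

lemma
  assumes "\<kappa> \<in> \<A>"
  shows chart_open: "open (fst \<kappa>)"
    and chart_homeo: "homeomorphism (fst \<kappa>) (snd \<kappa> ` fst \<kappa>) (snd \<kappa>) (chart_inv \<kappa>)"
    and chart_image_open': "open (snd \<kappa> ` fst \<kappa>)"
  using mfd assms by (auto simp: smooth_manifold_def)

lemma chart_inv_left [simp]: "\<kappa> \<in> \<A> \<Longrightarrow> x \<in> fst \<kappa> \<Longrightarrow> chart_inv \<kappa> (snd \<kappa> x) = x"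
  using homeomorphism_apply1[OF chart_homeo] by blast

lemma chart_image_open:
  assumes "\<kappa> \<in> \<A>" "open W"
  shows "open (snd \<kappa> ` (fst \<kappa> \<inter> W))"
proof -
  have "openin (top_of_set (snd \<kappa> ` fst \<kappa>)) (snd \<kappa> ` (fst \<kappa> \<inter> W))"
    by (rule homeomorphism_imp_open_map[OF chart_homeo[OF assms(1)]]) (use assms in auto)
  then show ?thesis using chart_image_open'[OF assms(1)] openin_open_trans by blast
qed

section \<open>Smooth maps on open subsets of a manifold\<close>

lemma smooth_map_on_cong:
  assumes "open W" "smooth_map_on \<A> W f" "\<And>x. x \<in> W \<Longrightarrow> f x = g x"
  shows "smooth_map_on \<A> W g"
  unfolding smooth_map_on_def smooth_on_def
proof (intro ballI allI)
  fix \<kappa> k assume \<kappa>: "\<kappa> \<in> \<A>"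
  show "Ck_on k (snd \<kappa> ` (fst \<kappa> \<inter> W)) (g \<circ> chart_inv \<kappa>)"
    by (rule Ck_on_cong[OF chart_image_open[OF \<kappa> assms(1)], of _ "f \<circ> chart_inv \<kappa>"])
      (use assms \<kappa> in \<open>auto simp: smooth_map_on_def smooth_on_def\<close>)
qed

lemma smooth_map_on_subset: "smooth_map_on \<A> W f \<Longrightarrow> W' \<subseteq> W \<Longrightarrow> smooth_map_on \<A> W' f"
  unfolding smooth_map_on_def smooth_on_def
  by (intro ballI allI, rule Ck_on_subset) blast+

lemma smooth_map_on_local:
  assumes "\<And>x. x \<in> W \<Longrightarrow> \<exists>W'. open W' \<and> x \<in> W' \<and> smooth_map_on \<A> W' f"
  shows "smooth_map_on \<A> W f"
  unfolding smooth_map_on_def smooth_on_def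
proof (intro ballI allI Ck_on_local)
  fix \<kappa> k y assume \<kappa>: "\<kappa> \<in> \<A>" and "y \<in> snd \<kappa> ` (fst \<kappa> \<inter> W)"
  then obtain x where x: "x \<in> fst \<kappa>" "x \<in> W" "y = snd \<kappa> x" by auto
  then obtain W' where W': "open W'" "x \<in> W'" "smooth_map_on \<A> W' f" using assms by blast
  show "\<exists>T. open T \<and> y \<in> T \<and> Ck_on k T (f \<circ> chart_inv \<kappa>)"
    using chart_image_open[OF \<kappa> W'(1)] x W' \<kappa>
    by (intro exI[of _ "snd \<kappa> ` (fst \<kappa> \<inter> W')"]) (auto simp: smooth_map_on_def smooth_on_def)
qed

lemma smooth_map_on_const [simp]: "smooth_map_on \<A> W (\<lambda>x. c)"
  by (simp add: smooth_map_on_def smooth_on_def o_def)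

lemma smooth_map_on_bounded_linear:
  assumes "bounded_linear L" "open W" "smooth_map_on \<A> W f"
  shows "smooth_map_on \<A> W (\<lambda>x. L (f x))"
  using assms(3) Ck_on_bounded_linear[OF assms(1) chart_image_open[OF _ assms(2)]]
  by (simp add: smooth_map_on_def smooth_on_def o_def)

lemma smooth_map_on_bilinear:
  assumes "bounded_bilinear h" "open W" "smooth_map_on \<A> W f" "smooth_map_on \<A> W g"
  shows "smooth_map_on \<A> W (\<lambda>x. h (f x) (g x))"
  using assms(3,4) Ck_on_bilinear[OF assms(1) chart_image_open[OF _ assms(2)]]
  by (simp add: smooth_map_on_def smooth_on_def o_def)

lemma smooth_map_on_add:
  assumes "open W" "smooth_map_on \<A> W f" "smooth_map_on \<A> W g"
  shows "smooth_map_on \<A> W (\<lambda>x. f x + g x)"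
  unfolding smooth_map_on_def smooth_on_def o_def
proof (intro ballI allI)
  fix \<kappa> k assume \<kappa>: "\<kappa> \<in> \<A>"
  show "Ck_on k (snd \<kappa> ` (fst \<kappa> \<inter> W)) (\<lambda>y. f (chart_inv \<kappa> y) + g (chart_inv \<kappa> y))"
    by (rule Ck_on_add[OF chart_image_open[OF \<kappa> assms(1)]])
      (use assms(2,3) \<kappa> in \<open>simp_all add: smooth_map_on_def smooth_on_def o_def\<close>)
qed

lemma smooth_map_on_sum:
  assumes "open W" "\<And>i. i \<in> I \<Longrightarrow> smooth_map_on \<A> W (f i)"
  shows "smooth_map_on \<A> W (\<lambda>x. \<Sum>i\<in>I. f i x)"
  using assms(2)
  by (induction I rule: infinite_finite_induct) (auto intro: smooth_map_on_add[OF assms(1)])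

lemmas smooth_map_on_mult = smooth_map_on_bilinear[OF bounded_bilinear_mult]
lemmas smooth_map_on_scaleR = smooth_map_on_bilinear[OF bounded_bilinear_scaleR]
lemmas smooth_map_on_inner = smooth_map_on_bilinear[OF bounded_bilinear_inner]

lemma smooth_map_on_prod:
  fixes f :: "'i \<Rightarrow> 'm \<Rightarrow> real"
  assumes "open W" "\<And>i. i \<in> I \<Longrightarrow> smooth_map_on \<A> W (f i)"
  shows "smooth_map_on \<A> W (\<lambda>x. \<Prod>i\<in>I. f i x)"
  using assms(2)
  by (induction I rule: infinite_finite_induct) (auto intro: smooth_map_on_mult[OF assms(1)])

lemma smooth_map_on_components:
  fixes f :: "'m \<Rightarrow> 'v::real_inner"
  assumes "euclidean_model TYPE('v)" "open W" "\<And>b. b \<in> onb \<Longrightarrow> smooth_map_on \<A> W (\<lambda>x. f x \<bullet> b)"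
  shows "smooth_map_on \<A> W f"
proof (rule smooth_map_on_cong[OF assms(2)])
  show "smooth_map_on \<A> W (\<lambda>x. \<Sum>b\<in>onb. (f x \<bullet> b) *\<^sub>R b)"
    by (intro smooth_map_on_sum smooth_map_on_scaleR assms) simp_all
qed (rule onb_expand[OF assms(1)])

lemma smooth_map_on_inner_const:
  "open W \<Longrightarrow> smooth_map_on \<A> W f \<Longrightarrow> smooth_map_on \<A> W (\<lambda>x. f x \<bullet> w)"
  by (rule smooth_map_on_inner) simp_all

lemma smooth_map_on_diff:
  assumes "open W" "smooth_map_on \<A> W f" "smooth_map_on \<A> W g"
  shows "smooth_map_on \<A> W (\<lambda>x. f x - g x)"
  using smooth_map_on_add[OF assms(1,2)
      smooth_map_on_bounded_linear[OF bounded_linear_minus[OF bounded_linear_ident] assms(1,3)]]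
  by simp

lemma smooth_map_on_chart:
  assumes "\<kappa> \<in> \<A>" "smooth_on UNIV \<phi>"
  shows "smooth_map_on \<A> (fst \<kappa>) (\<lambda>x. \<phi> (snd \<kappa> x))"
  unfolding smooth_map_on_def
proof
  fix \<kappa>' assume \<kappa>': "\<kappa>' \<in> \<A>"
  have "smooth_on (snd \<kappa>' ` (fst \<kappa>' \<inter> fst \<kappa>)) (\<lambda>y. \<phi> ((snd \<kappa> \<circ> chart_inv \<kappa>') y))"
  proof (rule smooth_on_compose[OF model chart_image_open[OF \<kappa>' chart_open[OF assms(1)]] open_UNIV])
    show "smooth_on (snd \<kappa>' ` (fst \<kappa>' \<inter> fst \<kappa>)) (snd \<kappa> \<circ> chart_inv \<kappa>')"
      using mfd assms(1) \<kappa>' unfolding smooth_manifold_def by blast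
  qed (use assms(2) in auto)
  then show "smooth_on (snd \<kappa>' ` (fst \<kappa>' \<inter> fst \<kappa>)) ((\<lambda>x. \<phi> (snd \<kappa> x)) \<circ> chart_inv \<kappa>')"
    by (simp add: o_def)
qed

text \<open>A plateau in a chart is extended by 0 to the whole manifold. The set C is the image of a
  closed ball, hence compact, hence closed because the manifold is Hausdorff. Therefore the chart
  domain and the complement of C are two open sets covering the manifold, and the extension is
  smooth on each. C is returned to the caller so that other objects can be extended by 0 in the same
  way.\<close>

lemma plateau_function:
  assumes "open W" "x \<in> W"
  obtains \<psi> C W0 where "smooth_map_on \<A> UNIV \<psi>" "open W0" "x \<in> W0" "W0 \<subseteq> W" "closed C" "C \<subseteq> W"
    "\<And>z. z \<in> W0 \<Longrightarrow> \<psi> z = (1::real)" "\<And>z. z \<notin> C \<Longrightarrow> \<psi> z = 0"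
proof -
  obtain \<kappa> where \<kappa>: "\<kappa> \<in> \<A>" "x \<in> fst \<kappa>" by (rule chart_at)
  have "snd \<kappa> x \<in> snd \<kappa> ` (fst \<kappa> \<inter> W)" using \<kappa> assms by auto
  then obtain r where r: "r > 0" "cball (snd \<kappa> x) r \<subseteq> snd \<kappa> ` (fst \<kappa> \<inter> W)"
    using chart_image_open[OF \<kappa>(1) assms(1)] open_contains_cball by blast
  obtain \<phi> :: "'b \<Rightarrow> real" and \<delta> where \<phi>: "smooth_on UNIV \<phi>" "\<delta> > 0" "\<delta> \<le> r"
    "\<And>z. dist (snd \<kappa> x) z < \<delta> \<Longrightarrow> \<phi> z = 1" "\<And>z. dist (snd \<kappa> x) z \<ge> r \<Longrightarrow> \<phi> z = 0"
    using smooth_plateau[OF r(1), where y = "snd \<kappa> x"] by blast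
  define \<psi> where "\<psi> z = (if z \<in> fst \<kappa> then \<phi> (snd \<kappa> z) else 0)" for z
  define C where "C = chart_inv \<kappa> ` cball (snd \<kappa> x) r"
  define W0 where "W0 = (fst \<kappa> \<inter> W) \<inter> snd \<kappa> -` ball (snd \<kappa> x) \<delta>"
  have "continuous_on (cball (snd \<kappa> x) r) (chart_inv \<kappa>)"
    using chart_homeo[OF \<kappa>(1)] r(2) by (auto simp: homeomorphism_def intro: continuous_on_subset)
  then have "compact C"
    unfolding C_def using compact_cball_euclidean_model[OF model] by (rule compact_continuous_image)
  then have "closed C" by (rule compact_imp_closed)
  have CW: "C \<subseteq> fst \<kappa> \<inter> W"
  proof
    fix z assume "z \<in> C"
    then obtain w where w: "w \<in> cball (snd \<kappa> x) r" "z = chart_inv \<kappa> w" by (auto simp: C_def)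
    then obtain u where "u \<in> fst \<kappa> \<inter> W" "w = snd \<kappa> u" using r(2) by blast
    then show "z \<in> fst \<kappa> \<inter> W" using w \<kappa>(1) by simp
  qed
  have "open W0"
    unfolding W0_def using chart_homeo[OF \<kappa>(1)] chart_open[OF \<kappa>(1)] assms(1)
    by (intro continuous_open_preimage) (auto simp: homeomorphism_def intro: continuous_on_subset)
  have \<psi>0: "\<psi> z = 0" if "z \<notin> C" for z
  proof (cases "z \<in> fst \<kappa>")
    case True
    then have "chart_inv \<kappa> (snd \<kappa> z) \<notin> C" using that \<kappa>(1) by simp
    then have "dist (snd \<kappa> x) (snd \<kappa> z) \<ge> r" by (auto simp: C_def)
    then show ?thesis by (simp add: \<psi>_def \<phi>(5))
  qed (simp add: \<psi>_def)
  have "smooth_map_on \<A> UNIV \<psi>"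
  proof (rule smooth_map_on_local)
    fix z
    have "smooth_map_on \<A> (fst \<kappa>) \<psi>"
      by (rule smooth_map_on_cong[OF chart_open[OF \<kappa>(1)] smooth_map_on_chart[OF \<kappa>(1) \<phi>(1)]])
        (simp add: \<psi>_def)
    moreover have "smooth_map_on \<A> (- C) \<psi>"
      by (rule smooth_map_on_cong[of _ "\<lambda>_. 0"]) (use \<open>closed C\<close> \<psi>0 in auto)
    ultimately show "\<exists>W'. open W' \<and> z \<in> W' \<and> smooth_map_on \<A> W' \<psi>"
      using chart_open[OF \<kappa>(1)] \<open>closed C\<close> CW by (cases "z \<in> C") (auto simp: open_Compl)
  qed
  moreover have "\<psi> z = 1" if "z \<in> W0" for z
    using that by (simp add: \<psi>_def W0_def \<phi>(4))
  ultimately show ?thesis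
    using that[of \<psi> W0 C] \<open>open W0\<close> \<open>closed C\<close> CW \<psi>0 \<phi>(2) \<kappa>(2) assms(2) by (auto simp: W0_def)
qed

section \<open>Differentials and the action of vector fields on functions\<close>

lemma smooth_function_has_derivative:
  assumes "smooth_map_on \<A> UNIV f" "\<kappa> \<in> \<A>" "x \<in> fst \<kappa>"
  shows "((f \<circ> chart_inv \<kappa>) has_derivative frechet_derivative (f \<circ> chart_inv \<kappa>) (at (snd \<kappa> x)))
    (at (snd \<kappa> x))"
proof (rule Ck_on_Suc_has_derivative)
  show "Ck_on (Suc 0) (snd \<kappa> ` fst \<kappa>) (f \<circ> chart_inv \<kappa>)"
    using assms(1,2) unfolding smooth_map_on_def smooth_on_def by (metis Int_UNIV_right)
qed (use assms in auto)

text \<open>The definite description in \<open>differential\<close> asks for one number that is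
  right in all charts around x. It exists by the chain rule, since the components of a tangent
  vector transform by the derivatives of the coordinate changes.\<close>

lemma differential_eq:
  assumes f: "smooth_map_on \<A> UNIV f" and v: "v \<in> tangent_space \<A> x" and \<kappa>: "\<kappa> \<in> \<A>" "x \<in> fst \<kappa>"
  shows "differential \<A> f (x, v) = frechet_derivative (f \<circ> chart_inv \<kappa>) (at (snd \<kappa> x)) (v \<kappa>)"
proof -
  have "frechet_derivative (f \<circ> chart_inv \<kappa>) (at (snd \<kappa> x)) (v \<kappa>)
      = frechet_derivative (f \<circ> chart_inv \<kappa>') (at (snd \<kappa>' x)) (v \<kappa>')"
    if \<kappa>': "\<kappa>' \<in> \<A>" "x \<in> fst \<kappa>'" for \<kappa>'
  proof -
    let ?S = "snd \<kappa> ` (fst \<kappa> \<inter> fst \<kappa>')" and ?t = "snd \<kappa>' \<circ> chart_inv \<kappa>"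
    have "Ck_on (Suc 0) ?S ?t"
      using mfd \<kappa> \<kappa>' unfolding smooth_manifold_def smooth_on_def by blast
    then have t: "(?t has_derivative frechet_derivative ?t (at (snd \<kappa> x))) (at (snd \<kappa> x))"
      by (rule Ck_on_Suc_has_derivative) (use \<kappa> \<kappa>' in auto)
    have "((f \<circ> chart_inv \<kappa>') \<circ> ?t has_derivative
        frechet_derivative (f \<circ> chart_inv \<kappa>') (at (snd \<kappa>' x)) \<circ> frechet_derivative ?t (at (snd \<kappa> x)))
        (at (snd \<kappa> x))"
      by (rule diff_chain_at[OF t]) (use smooth_function_has_derivative[OF f \<kappa>'] \<kappa> in simp)
    moreover have "frechet_derivative (f \<circ> chart_inv \<kappa>) (at (snd \<kappa> x))
        = frechet_derivative ((f \<circ> chart_inv \<kappa>') \<circ> ?t) (at (snd \<kappa> x))"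
      by (rule frechet_derivative_cong_open[OF chart_image_open[OF \<kappa>(1) chart_open[OF \<kappa>'(1)]]])
        (use \<kappa> \<kappa>' in auto)
    moreover have "v \<kappa>' = frechet_derivative ?t (at (snd \<kappa> x)) (v \<kappa>)"
      using v \<kappa> \<kappa>' unfolding tangent_space_def by blast
    ultimately show ?thesis by (simp add: has_derivative_frechet)
  qed
  note indep = this
  show ?thesis
    unfolding differential_def prod.case
  proof (rule the_equality)
    show "\<forall>\<kappa>'\<in>\<A>. x \<in> fst \<kappa>' \<longrightarrow> frechet_derivative (f \<circ> chart_inv \<kappa>) (at (snd \<kappa> x)) (v \<kappa>)
        = frechet_derivative (f \<circ> chart_inv \<kappa>') (at (snd \<kappa>' x)) (v \<kappa>')"
      using indep by blast
  qed (use \<kappa> in blast)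
qed

text \<open>Both sides unfold to definite descriptions with the same defining condition, so they
  agree whether or not f and g are smooth. This allows a function to be replaced by a local formula
  before anything is known about its smoothness.\<close>

lemma lie_deriv_fun_cong_open:
  assumes "open W" "x \<in> W" "\<And>y. y \<in> W \<Longrightarrow> f y = g y" and Y: "fst (Y x) = x"
  shows "lie_deriv_fun \<A> Y f x = lie_deriv_fun \<A> Y g x"
proof -
  have "frechet_derivative (f \<circ> chart_inv \<kappa>) (at (snd \<kappa> x))
      = frechet_derivative (g \<circ> chart_inv \<kappa>) (at (snd \<kappa> x))" if \<kappa>: "\<kappa> \<in> \<A>" "x \<in> fst \<kappa>" for \<kappa>
    by (rule frechet_derivative_cong_open[OF chart_image_open[OF \<kappa>(1) assms(1)]])
      (use \<kappa> assms in auto)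
  then have "(\<forall>\<kappa>\<in>\<A>. x \<in> fst \<kappa> \<longrightarrow> d = frechet_derivative (f \<circ> chart_inv \<kappa>) (at (snd \<kappa> x)) (v \<kappa>))
      \<longleftrightarrow> (\<forall>\<kappa>\<in>\<A>. x \<in> fst \<kappa> \<longrightarrow> d = frechet_derivative (g \<circ> chart_inv \<kappa>) (at (snd \<kappa> x)) (v \<kappa>))"
    for d v by simp
  moreover obtain v where "Y x = (x, v)" using Y by (cases "Y x") simp
  ultimately show ?thesis by (simp add: lie_deriv_fun_def differential_def)
qed

lemma vector_field:
  assumes "Y \<in> smooth_sections \<A> (tangent_bundle \<A>)"
  shows "fst (Y x) = x" "snd (Y x) \<in> tangent_space \<A> x"
    and "\<kappa> \<in> \<A> \<Longrightarrow> smooth_map_on \<A> (fst \<kappa>) (\<lambda>x. snd (Y x) \<kappa>)"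
proof -
  have "Y x \<in> fibre (tangent_bundle \<A>) x" for x
    using assms by (simp add: smooth_sections_def)
  from this[of x] show "fst (Y x) = x" "snd (Y x) \<in> tangent_space \<A> x"
    by (auto simp: fibre_def tangent_bundle_def case_prod_beta)
  show "smooth_map_on \<A> (fst \<kappa>) (\<lambda>x. snd (Y x) \<kappa>)" if "\<kappa> \<in> \<A>"
  proof -
    have "(fst \<kappa>, \<lambda>(x, v). v \<kappa>) \<in> trivs (tangent_bundle \<A>)"
      using that by (simp add: tangent_bundle_def)
    then show ?thesis using assms by (fastforce simp: smooth_sections_def case_prod_beta)
  qed
qed

lemma lie_deriv_fun_eq:
  assumes "Y \<in> smooth_sections \<A> (tangent_bundle \<A>)" "smooth_map_on \<A> UNIV f" "\<kappa> \<in> \<A>" "x \<in> fst \<kappa>"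
  shows "lie_deriv_fun \<A> Y f x
    = frechet_derivative (f \<circ> chart_inv \<kappa>) (at (snd \<kappa> x)) (snd (Y x) \<kappa>)"
  using differential_eq[OF assms(2) vector_field(2)[OF assms(1)] assms(3,4)]
    vector_field(1)[OF assms(1), of x]
  by (cases "Y x") (simp add: lie_deriv_fun_def)

lemma lie_deriv_fun_smooth:
  assumes Y: "Y \<in> smooth_sections \<A> (tangent_bundle \<A>)" and f: "smooth_map_on \<A> UNIV f"
  shows "smooth_map_on \<A> UNIV (lie_deriv_fun \<A> Y f)"
  unfolding smooth_map_on_def smooth_on_def
proof (intro ballI allI)
  fix \<kappa> k assume \<kappa>: "\<kappa> \<in> \<A>"
  let ?S = "snd \<kappa> ` (fst \<kappa> \<inter> UNIV)"
  let ?D = "\<lambda>y. frechet_derivative (f \<circ> chart_inv \<kappa>) (at y)"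
  have S: "open ?S" by (rule chart_image_open[OF \<kappa> open_UNIV])
  \<comment> \<open>In coordinates Y f is the sum of the components of Y times the partial
    derivatives of f; these are derivatives in fixed directions, and f being of class C^(k+1) makes
    them C^k.\<close>
  have "Ck_on k ?S (\<lambda>y. \<Sum>b\<in>onb. (snd (Y (chart_inv \<kappa> y)) \<kappa> \<bullet> b) * ?D y b)"
  proof (intro Ck_on_sum[OF S] Ck_on_bilinear[OF bounded_bilinear_mult S]
      Ck_on_bounded_linear[OF bounded_linear_inner_left S])
    show "Ck_on k ?S (\<lambda>y. snd (Y (chart_inv \<kappa> y)) \<kappa>)"
      using vector_field(3)[OF Y \<kappa>] \<kappa> by (fastforce simp: smooth_map_on_def smooth_on_def o_def)
    have "Ck_on (Suc k) ?S (f \<circ> chart_inv \<kappa>)"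
      using f \<kappa> unfolding smooth_map_on_def smooth_on_def by blast
    then show "Ck_on k ?S (\<lambda>y. ?D y b)" for b by simp
  qed
  then show "Ck_on k ?S (lie_deriv_fun \<A> Y f \<circ> chart_inv \<kappa>)"
  proof (rule Ck_on_cong[OF S])
    fix y assume "y \<in> ?S"
    then obtain x where x: "x \<in> fst \<kappa>" "y = snd \<kappa> x" by auto
    have lin: "linear (?D y)"
      using has_derivative_linear[OF smooth_function_has_derivative[OF f \<kappa> x(1)]] x by simp
    have "?D y (snd (Y x) \<kappa>) = ?D y (\<Sum>b\<in>onb. (snd (Y x) \<kappa> \<bullet> b) *\<^sub>R b)"
      by (simp only: onb_expand[OF model])
    also have "\<dots> = (\<Sum>b\<in>onb. (snd (Y x) \<kappa> \<bullet> b) * ?D y b)"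
      by (simp add: linear_sum[OF lin] linear_scale[OF lin])
    finally show "(\<Sum>b\<in>onb. (snd (Y (chart_inv \<kappa> y)) \<kappa> \<bullet> b) * ?D y b)
        = (lie_deriv_fun \<A> Y f \<circ> chart_inv \<kappa>) y"
      using x \<kappa> lie_deriv_fun_eq[OF Y f \<kappa> x(1)] by simp
  qed
qed

lemma
  assumes Y: "Y \<in> smooth_sections \<A> (tangent_bundle \<A>)"
  shows lie_deriv_fun_add: "smooth_map_on \<A> UNIV f \<Longrightarrow> smooth_map_on \<A> UNIV g \<Longrightarrow>
      lie_deriv_fun \<A> Y (\<lambda>x. f x + g x) x = lie_deriv_fun \<A> Y f x + lie_deriv_fun \<A> Y g x"
    and lie_deriv_fun_mult: "smooth_map_on \<A> UNIV f \<Longrightarrow> smooth_map_on \<A> UNIV g \<Longrightarrow>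
      lie_deriv_fun \<A> Y (\<lambda>x. f x * g x) x
        = f x * lie_deriv_fun \<A> Y g x + lie_deriv_fun \<A> Y f x * g x"
    and lie_deriv_fun_const: "lie_deriv_fun \<A> Y (\<lambda>x. c) x = 0"
proof -
  obtain \<kappa> where \<kappa>: "\<kappa> \<in> \<A>" "x \<in> fst \<kappa>" by (rule chart_at)
  note eq = lie_deriv_fun_eq[OF Y _ \<kappa>] and der = smooth_function_has_derivative[OF _ \<kappa>]
  show "lie_deriv_fun \<A> Y (\<lambda>x. f x + g x) x = lie_deriv_fun \<A> Y f x + lie_deriv_fun \<A> Y g x"
    if "smooth_map_on \<A> UNIV f" "smooth_map_on \<A> UNIV g"
    using has_derivative_frechet[OF has_derivative_add[OF der[OF that(1)] der[OF that(2)]]]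
    by (simp add: eq that smooth_map_on_add o_def)
  show "lie_deriv_fun \<A> Y (\<lambda>x. f x * g x) x
      = f x * lie_deriv_fun \<A> Y g x + lie_deriv_fun \<A> Y f x * g x"
    if "smooth_map_on \<A> UNIV f" "smooth_map_on \<A> UNIV g"
    using has_derivative_frechet[OF has_derivative_mult[OF der[OF that(1)] der[OF that(2)]]] \<kappa>
    by (simp add: eq that smooth_map_on_mult o_def)
  show "lie_deriv_fun \<A> Y (\<lambda>x. c) x = 0"
    using has_derivative_frechet[OF has_derivative_const[of c "at (snd \<kappa> x)"]]
    by (simp add: eq o_def)
qed

end

section \<open>Alternating forms on a fibre\<close>

text \<open>The Leibniz formula for the determinant of the p x p matrix with entries
  \<open>a i j\<close>; indexing by natural numbers keeps the size p an ordinary variable.\<close>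

definition pdet :: "nat \<Rightarrow> (nat \<Rightarrow> nat \<Rightarrow> real) \<Rightarrow> real" where
  "pdet p a = (\<Sum>\<sigma> | \<sigma> permutes {..<p}. of_int (sign \<sigma>) * (\<Prod>i<p. a i (\<sigma> i)))"

lemma pdet_cong:
  assumes "\<And>i j. i < p \<Longrightarrow> j < p \<Longrightarrow> a i j = b i j"
  shows "pdet p a = pdet p b"
proof -
  have "(\<Prod>i<p. a i (\<sigma> i)) = (\<Prod>i<p. b i (\<sigma> i))" if "\<sigma> permutes {..<p}" for \<sigma>
    using assms permutes_in_image[OF that] by (intro prod.cong) auto
  then show ?thesis unfolding pdet_def by (intro sum.cong) auto
qed

text \<open>Summing over inverses of permutations leaves the sum and the signs unchanged, and
  reindexing the product by \<sigma> exchanges the two indices.\<close>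

lemma pdet_transpose: "pdet p (\<lambda>i j. a j i) = pdet p a"
proof -
  have "pdet p a = (\<Sum>\<sigma> | \<sigma> permutes {..<p}. of_int (sign (inv \<sigma>)) * (\<Prod>i<p. a i (inv \<sigma> i)))"
    unfolding pdet_def by (rule sum_permutations_inverse)
  also have "\<dots> = pdet p (\<lambda>i j. a j i)"
    unfolding pdet_def
  proof (intro sum.cong refl)
    fix \<sigma> assume "\<sigma> \<in> {\<sigma>. \<sigma> permutes {..<p}}"
    then have \<sigma>: "\<sigma> permutes {..<p}" by simp
    have "(\<Prod>i<p. a i (inv \<sigma> i)) = (\<Prod>i<p. a (\<sigma> i) (inv \<sigma> (\<sigma> i)))"
      using prod.permute[OF \<sigma>, of "\<lambda>i. a i (inv \<sigma> i)"] by (simp add: o_def)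
    then show "of_int (sign (inv \<sigma>)) * (\<Prod>i<p. a i (inv \<sigma> i))
        = of_int (sign \<sigma>) * (\<Prod>i<p. a (\<sigma> i) i)"
      using permutes_inverses(2)[OF \<sigma>] sign_inverse[OF permutes_imp_permutation[OF _ \<sigma>]] by simp
  qed
  finally show ?thesis ..
qed

text \<open>Composing every permutation with the transposition flips its sign, while reindexing the
  product by the same transposition restores the original product.\<close>

lemma pdet_swap_rows:
  assumes "i < p" "j < p" "i \<noteq> j"
  shows "pdet p (\<lambda>k. a (Transposition.transpose i j k)) = - pdet p a"
proof -
  have t: "Transposition.transpose i j permutes {..<p}" using assms by (simp add: permutes_swap_id)
  have "pdet p (\<lambda>k. a (Transposition.transpose i j k))
      = (\<Sum>\<sigma> | \<sigma> permutes {..<p}. of_int (sign (\<sigma> \<circ> Transposition.transpose i j))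
          * (\<Prod>k<p. a (Transposition.transpose i j k) ((\<sigma> \<circ> Transposition.transpose i j) k)))"
    unfolding pdet_def by (rule sum_permutations_compose_right[OF t])
  also have "\<dots> = (\<Sum>\<sigma> | \<sigma> permutes {..<p}. - (of_int (sign \<sigma>) * (\<Prod>k<p. a k (\<sigma> k))))"
  proof (intro sum.cong refl)
    fix \<sigma> assume "\<sigma> \<in> {\<sigma>. \<sigma> permutes {..<p}}"
    then have "permutation \<sigma>" by (auto simp: permutation_permutes)
    then have "sign (\<sigma> \<circ> Transposition.transpose i j) = - sign \<sigma>"
      using assms(3) by (simp add: sign_compose permutation_swap_id sign_swap_id)
    moreover have "(\<Prod>k<p. a (Transposition.transpose i j k) ((\<sigma> \<circ> Transposition.transpose i j) k)) = (\<Prod>k<p. a k (\<sigma> k))"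
      using prod.permute[OF t, of "\<lambda>k. a k (\<sigma> k)"] by (simp add: o_def)
    ultimately show "of_int (sign (\<sigma> \<circ> Transposition.transpose i j))
          * (\<Prod>k<p. a (Transposition.transpose i j k) ((\<sigma> \<circ> Transposition.transpose i j) k))
        = - (of_int (sign \<sigma>) * (\<Prod>k<p. a k (\<sigma> k)))" by simp
  qed
  finally show ?thesis by (simp add: pdet_def sum_negf)
qed

lemma
  assumes "k < p"
  shows pdet_row_add: "pdet p (a(k := \<lambda>j. u j + v j)) = pdet p (a(k := u)) + pdet p (a(k := v))"
    and pdet_row_scale: "pdet p (a(k := \<lambda>j. r * u j)) = r * pdet p (a(k := u))"
proof -
  have *: "(\<Prod>i<p. (a(k := u)) i (\<sigma> i)) = u (\<sigma> k) * (\<Prod>i\<in>{..<p} - {k}. a i (\<sigma> i))" for u \<sigma>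
    using assms by (subst prod.remove[of _ k]) (auto intro!: prod.cong)
  show "pdet p (a(k := \<lambda>j. u j + v j)) = pdet p (a(k := u)) + pdet p (a(k := v))"
    unfolding pdet_def * by (simp add: algebra_simps sum.distrib)
  show "pdet p (a(k := \<lambda>j. r * u j)) = r * pdet p (a(k := u))"
    unfolding pdet_def * by (simp add: sum_distrib_left mult_ac)
qed

lemma det_pairing_pdet: "det_pairing \<xi>s vs = pdet (length vs) (\<lambda>i j. snd (\<xi>s ! i) (vs ! j))"
  by (simp add: det_pairing_def pdet_def)

section \<open>Alternating forms: closure properties and behaviour under permutations\<close>

lemma
  assumes "\<alpha> \<in> alt_forms E x p"
  shows alt_forms_outside: "\<not> (length es = p \<and> set es \<subseteq> fibre E x) \<Longrightarrow> \<alpha> es = 0"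
    and alt_forms_add: "length es = p \<Longrightarrow> set es \<subseteq> fibre E x \<Longrightarrow> i < p \<Longrightarrow> e \<in> fibre E x \<Longrightarrow>
      e' \<in> fibre E x \<Longrightarrow> \<alpha> (es[i := vadd E e e']) = \<alpha> (es[i := e]) + \<alpha> (es[i := e'])"
    and alt_forms_scale: "length es = p \<Longrightarrow> set es \<subseteq> fibre E x \<Longrightarrow> i < p \<Longrightarrow> e \<in> fibre E x \<Longrightarrow>
      \<alpha> (es[i := vscale E a e]) = a * \<alpha> (es[i := e])"
    and alt_forms_swap: "length es = p \<Longrightarrow> set es \<subseteq> fibre E x \<Longrightarrow> i < p \<Longrightarrow> j < p \<Longrightarrow> i \<noteq> j \<Longrightarrow>
      \<alpha> (es[i := es ! j, j := es ! i]) = - \<alpha> es"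
  using assms unfolding alt_forms_def by blast+

lemma alt_formsI:
  assumes "\<And>es. \<not> (length es = p \<and> set es \<subseteq> fibre E x) \<Longrightarrow> \<alpha> es = 0"
    and "\<And>es i e e'. length es = p \<Longrightarrow> set es \<subseteq> fibre E x \<Longrightarrow> i < p \<Longrightarrow> e \<in> fibre E x \<Longrightarrow>
      e' \<in> fibre E x \<Longrightarrow> \<alpha> (es[i := vadd E e e']) = \<alpha> (es[i := e]) + \<alpha> (es[i := e'])"
    and "\<And>es i e a. length es = p \<Longrightarrow> set es \<subseteq> fibre E x \<Longrightarrow> i < p \<Longrightarrow> e \<in> fibre E x \<Longrightarrow>
      \<alpha> (es[i := vscale E a e]) = a * \<alpha> (es[i := e])"
    and "\<And>es i j. length es = p \<Longrightarrow> set es \<subseteq> fibre E x \<Longrightarrow> i < p \<Longrightarrow> j < p \<Longrightarrow> i \<noteq> j \<Longrightarrow>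
      \<alpha> (es[i := es ! j, j := es ! i]) = - \<alpha> es"
  shows "\<alpha> \<in> alt_forms E x p"
  unfolding alt_forms_def using assms by blast

lemma alt_forms_zero: "(\<lambda>_. 0) \<in> alt_forms E x p"
  by (simp add: alt_forms_def)

lemma alt_forms_lincomb:
  assumes "\<alpha> \<in> alt_forms E x p" "\<beta> \<in> alt_forms E x p"
  shows "(\<lambda>es. a * \<alpha> es + b * \<beta> es) \<in> alt_forms E x p"
  by (rule alt_formsI)
    (simp_all add: alt_forms_outside[OF assms(1)] alt_forms_outside[OF assms(2)]
      alt_forms_add[OF assms(1)] alt_forms_add[OF assms(2)]
      alt_forms_scale[OF assms(1)] alt_forms_scale[OF assms(2)]
      alt_forms_swap[OF assms(1)] alt_forms_swap[OF assms(2)] algebra_simps)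

lemma alt_forms_sum:
  assumes "\<And>i. i \<in> I \<Longrightarrow> f i \<in> alt_forms E x p"
  shows "(\<lambda>es. \<Sum>i\<in>I. a i * f i es) \<in> alt_forms E x p"
  using assms
proof (induction I rule: infinite_finite_induct)
  case (insert i I)
  have "(\<lambda>es. a i * f i es + 1 * (\<Sum>i\<in>I. a i * f i es)) \<in> alt_forms E x p"
    by (rule alt_forms_lincomb) (use insert in auto)
  then show ?case using insert.hyps by simp
qed (simp_all add: alt_forms_zero)

text \<open>\<open>alt_forms\<close> only prescribes the behaviour under transpositions, so \<sigma>
  is built up from them. The list stays universally quantified in the induction, because the step
  uses the hypothesis for the list with two entries exchanged.\<close>

lemma alt_forms_permute:
  assumes "\<alpha> \<in> alt_forms E x p" "\<sigma> permutes {..<p}" "length es = p" "set es \<subseteq> fibre E x"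
  shows "\<alpha> (map (\<lambda>i. es ! \<sigma> i) [0..<p]) = of_int (sign \<sigma>) * \<alpha> es"
proof -
  have "finite {..<p}" by simp
  from assms(2) this have "\<forall>es. length es = p \<and> set es \<subseteq> fibre E x \<longrightarrow>
      \<alpha> (map (\<lambda>i. es ! \<sigma> i) [0..<p]) = of_int (sign \<sigma>) * \<alpha> es"
  proof (induction rule: permutes_induct)
    case id
    show ?case
    proof (intro allI impI)
      fix es assume "length es = p \<and> set es \<subseteq> fibre E x"
      then have "map (\<lambda>i. es ! id i) [0..<p] = es" using map_nth[of es] by simp
      then show "\<alpha> (map (\<lambda>i. es ! id i) [0..<p]) = of_int (sign (id :: nat \<Rightarrow> nat)) * \<alpha> es" by simp
    qed
  next
    case (swap i j \<sigma>)
    show ?case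
    proof (intro allI impI)
      fix es assume es: "length es = p \<and> set es \<subseteq> fibre E x"
      define es' where "es' = es[i := es ! j, j := es ! i]"
      have es': "length es' = p" "set es' \<subseteq> fibre E x"
        using es swap.hyps(1,2) by (auto simp: es'_def set_swap)
      have "es ! (Transposition.transpose i j \<circ> \<sigma>) k = es' ! \<sigma> k" if "k < p" for k
        using swap.hyps(1,2) es by (auto simp: es'_def Transposition.transpose_def nth_list_update)
      then have "map (\<lambda>k. es ! (Transposition.transpose i j \<circ> \<sigma>) k) [0..<p] = map (\<lambda>k. es' ! \<sigma> k) [0..<p]"
        by simp
      moreover have "\<alpha> (map (\<lambda>k. es' ! \<sigma> k) [0..<p]) = of_int (sign \<sigma>) * \<alpha> es'"
        using swap.IH es' by simp
      moreover have "\<alpha> es' = - \<alpha> es"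
        unfolding es'_def by (rule alt_forms_swap[OF assms(1)]) (use es swap.hyps in auto)
      moreover have "sign (Transposition.transpose i j \<circ> \<sigma>) = - sign \<sigma>"
        using swap.hyps permutes_imp_permutation[of "{..<p}" \<sigma>]
        by (simp add: sign_compose permutation_swap_id sign_swap_id)
      ultimately show "\<alpha> (map (\<lambda>k. es ! (Transposition.transpose i j \<circ> \<sigma>) k) [0..<p])
          = of_int (sign (Transposition.transpose i j \<circ> \<sigma>)) * \<alpha> es" by (simp del: map_eq_conv)
    qed
  qed
  then show ?thesis using assms by blast
qed

text \<open>\<open>A e\<close> is the row that the vector e contributes. Linearity of rows and the
  sign under a row exchange are the clauses of \<open>alt_forms\<close>; leaving A abstract covers
  wedge products of vectors and of covectors alike.\<close>

lemma pdet_alt_form: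
  assumes "\<And>e e' j. e \<in> fibre E x \<Longrightarrow> e' \<in> fibre E x \<Longrightarrow> A (vadd E e e') j = A e j + A e' j"
    and "\<And>e a j. e \<in> fibre E x \<Longrightarrow> A (vscale E a e) j = a * A e j"
    and vadd: "\<And>e e'. e \<in> fibre E x \<Longrightarrow> e' \<in> fibre E x \<Longrightarrow> vadd E e e' \<in> fibre E x"
    and vscale: "\<And>e a. e \<in> fibre E x \<Longrightarrow> vscale E a e \<in> fibre E x"
  shows "(\<lambda>es. if length es = p \<and> set es \<subseteq> fibre E x then pdet p (\<lambda>i. A (es ! i)) else 0)
      \<in> alt_forms E x p"
proof -
  let ?d = "\<lambda>es. pdet p (\<lambda>i. A (es ! i))"
  have upd: "?d (es[i := e]) = pdet p ((\<lambda>k. A (es ! k))(i := A e))" if "i < p" "length es = p" for es i e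
    by (rule pdet_cong) (use that in \<open>auto simp: nth_list_update\<close>)
  have sub: "set (es[i := e]) \<subseteq> fibre E x" if "set es \<subseteq> fibre E x" "e \<in> fibre E x" for es i e
    using that set_update_subset_insert[of es i e] by auto
  have "?d (es[i := es ! j, j := es ! i]) = - ?d es"
    if "i < p" "j < p" "i \<noteq> j" "length es = p" for es i j
  proof -
    have "?d (es[i := es ! j, j := es ! i]) = pdet p (\<lambda>k. A (es ! Transposition.transpose i j k))"
      by (rule pdet_cong) (use that in \<open>auto simp: nth_list_update Transposition.transpose_def\<close>)
    then show ?thesis using pdet_swap_rows[OF that(1-3), of "\<lambda>k. A (es ! k)"] by simp
  qed
  note swap = this
  show ?thesis
  proof (rule alt_formsI)
    fix es i e e'
    assume es: "length es = p" "set es \<subseteq> fibre E x" "i < p" and e: "e \<in> fibre E x"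
    have "A (vadd E e e') = (\<lambda>j. A e j + A e' j)" if "e' \<in> fibre E x"
      using assms(1)[OF e that] by blast
    then show "(if length (es[i := vadd E e e']) = p \<and> set (es[i := vadd E e e']) \<subseteq> fibre E x
          then ?d (es[i := vadd E e e']) else 0)
        = (if length (es[i := e]) = p \<and> set (es[i := e]) \<subseteq> fibre E x then ?d (es[i := e]) else 0)
        + (if length (es[i := e']) = p \<and> set (es[i := e']) \<subseteq> fibre E x then ?d (es[i := e']) else 0)"
      if e': "e' \<in> fibre E x"
      using es e e' by (simp add: upd sub vadd pdet_row_add del: fun_upd_apply)
    have "A (vscale E a e) = (\<lambda>j. a * A e j)" for a
      using assms(2)[OF e] by blast
    then show "(if length (es[i := vscale E a e]) = p \<and> set (es[i := vscale E a e]) \<subseteq> fibre E x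
          then ?d (es[i := vscale E a e]) else 0)
        = a * (if length (es[i := e]) = p \<and> set (es[i := e]) \<subseteq> fibre E x then ?d (es[i := e]) else 0)"
      for a
      using es e by (simp add: upd sub vscale pdet_row_scale del: fun_upd_apply)
  next
    fix es i j
    assume es: "length es = p" "set es \<subseteq> fibre E x" "i < p" "j < p" "i \<noteq> j"
    then show "(if length (es[i := es ! j, j := es ! i]) = p \<and> set (es[i := es ! j, j := es ! i]) \<subseteq> fibre E x
          then ?d (es[i := es ! j, j := es ! i]) else 0)
        = - (if length es = p \<and> set es \<subseteq> fibre E x then ?d es else 0)"
      by (simp add: swap set_swap)
  qed auto
qed

text \<open>This is the map that \<open>dual_bundle\<close> attaches to the trivialisation c: the
  Riesz representative of a covector read through c.\<close>

definition dual_coord :: "('m, 'e, 'f::real_inner) vbundle \<Rightarrow> ('e \<Rightarrow> 'f) \<Rightarrow> ('m, 'e) covector \<Rightarrow> 'f" where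
  "dual_coord E c = (\<lambda>(x, \<xi>). THE w. \<forall>e\<in>fibre E x. \<xi> e = w \<bullet> c e)"

lemma fibre_dual: "\<xi> \<in> fibre (dual_bundle E) x \<longleftrightarrow> fst \<xi> = x \<and> snd \<xi> \<in> dual_space E x"
  by (auto simp: fibre_def dual_bundle_def case_prod_beta)

lemma dual_bundle_ops:
  "vzero (dual_bundle E) x = (x, \<lambda>_. 0)"
  "vadd (dual_bundle E) \<xi> \<zeta> = (fst \<xi>, \<lambda>e. snd \<xi> e + snd \<zeta> e)"
  "vscale (dual_bundle E) a \<xi> = (fst \<xi>, \<lambda>e. a * snd \<xi> e)"
  by (simp_all add: dual_bundle_def case_prod_beta)

text \<open>Multi-indices are all p-tuples from the orthonormal basis, with repetitions and in every
  order. Expansions need no ordering of the basis, at the price of a factor p! in each sum of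
  decomposables.\<close>

definition idx :: "nat \<Rightarrow> 'f::real_inner list set" where
  "idx p = {I. set I \<subseteq> onb \<and> length I = p}"

lemma idx_0: "idx 0 = {[]}"
  by (auto simp: idx_def)

lemma idx_Suc: "idx (Suc n) = (\<lambda>(I, b). I @ [b]) ` (idx n \<times> onb)"
proof (intro equalityI subsetI)
  fix I :: "'a list" assume "I \<in> idx (Suc n)"
  then show "I \<in> (\<lambda>(I, b). I @ [b]) ` (idx n \<times> onb)"
    by (cases I rule: rev_cases) (auto simp: idx_def)
qed (auto simp: idx_def)

text \<open>Linear algebra on a single fibre with one linear coordinate, separated from smoothness
  so that it can be interpreted for the dual fibre as well.\<close>

locale fibre_chart =
  fixes E :: "('m, 'e, 'f::real_inner) vbundle" and x :: 'm and c :: "'e \<Rightarrow> 'f"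
  assumes fmodel: "euclidean_model TYPE('f)"
    and bij: "bij_betw c (fibre E x) UNIV"
    and vzero_in: "vzero E x \<in> fibre E x"
    and vadd_in: "e \<in> fibre E x \<Longrightarrow> e' \<in> fibre E x \<Longrightarrow> vadd E e e' \<in> fibre E x"
    and vscale_in: "e \<in> fibre E x \<Longrightarrow> vscale E a e \<in> fibre E x"
    and coord_zero: "c (vzero E x) = 0"
    and coord_add: "e \<in> fibre E x \<Longrightarrow> e' \<in> fibre E x \<Longrightarrow> c (vadd E e e') = c e + c e'"
    and coord_scale: "e \<in> fibre E x \<Longrightarrow> c (vscale E a e) = a *\<^sub>R c e"
begin

abbreviation F :: "'f \<Rightarrow> 'e" where
  "F \<equiv> inv_into (fibre E x) c"

lemma frame_in [simp]: "F w \<in> fibre E x"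
  using bij by (metis UNIV_I bij_betw_imp_surj_on inv_into_into)

lemma coord_frame [simp]: "c (F w) = w"
  using bij by (simp add: bij_betw_inv_into_right)

lemma frame_coord: "e \<in> fibre E x \<Longrightarrow> F (c e) = e"
  using bij by (simp add: bij_betw_inv_into_left)

lemma coord_inj: "e \<in> fibre E x \<Longrightarrow> e' \<in> fibre E x \<Longrightarrow> c e = c e' \<Longrightarrow> e = e'"
  by (metis frame_coord)

lemma frame_add: "F (w + w') = vadd E (F w) (F w')"
  by (rule coord_inj) (simp_all add: vadd_in coord_add)

lemma frame_scale: "F (a *\<^sub>R w) = vscale E a (F w)"
  by (rule coord_inj) (simp_all add: vscale_in coord_scale)

lemma frame_zero: "F 0 = vzero E x"
  by (rule coord_inj) (simp_all add: vzero_in coord_zero)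

lemma linear_frame_expand_scaleR:
  fixes g :: "'e \<Rightarrow> 'v::real_vector"
  assumes "\<And>e e'. e \<in> fibre E x \<Longrightarrow> e' \<in> fibre E x \<Longrightarrow> g (vadd E e e') = g e + g e'"
    and "\<And>e a. e \<in> fibre E x \<Longrightarrow> g (vscale E a e) = a *\<^sub>R g e"
    and e: "e \<in> fibre E x"
  shows "g e = (\<Sum>b\<in>onb. (c e \<bullet> b) *\<^sub>R g (F b))"
proof -
  have lin: "linear (\<lambda>w. g (F w))"
    by (rule linearI) (simp_all add: frame_add frame_scale assms)
  have "g e = g (F (\<Sum>b\<in>onb. (c e \<bullet> b) *\<^sub>R b))"
    by (simp only: onb_expand[OF fmodel] frame_coord[OF e])
  also have "\<dots> = (\<Sum>b\<in>onb. g (F ((c e \<bullet> b) *\<^sub>R b)))" by (rule linear_sum[OF lin])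
  finally show ?thesis by (simp add: frame_scale assms)
qed

lemma linear_frame_expand:
  fixes g :: "'e \<Rightarrow> real"
  assumes "\<And>e e'. e \<in> fibre E x \<Longrightarrow> e' \<in> fibre E x \<Longrightarrow> g (vadd E e e') = g e + g e'"
    and "\<And>e a. e \<in> fibre E x \<Longrightarrow> g (vscale E a e) = a * g e"
    and e: "e \<in> fibre E x"
  shows "g e = (\<Sum>b\<in>onb. (c e \<bullet> b) * g (F b))"
  using linear_frame_expand_scaleR[of g e] assms by simp

lemma alt_forms_expand_slot:
  assumes "\<alpha> \<in> alt_forms E x p" "length es = p" "set es \<subseteq> fibre E x" "i < p" "e \<in> fibre E x"
  shows "\<alpha> (es[i := e]) = (\<Sum>b\<in>onb. (c e \<bullet> b) * \<alpha> (es[i := F b]))"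
  by (rule linear_frame_expand[where g = "\<lambda>e. \<alpha> (es[i := e])"])
    (use assms alt_forms_add[OF assms(1)] alt_forms_scale[OF assms(1)] in auto)

lemma sum_idx_Suc: "(\<Sum>I\<in>idx (Suc n). f I) = (\<Sum>I\<in>idx n. \<Sum>b\<in>onb. f (I @ [b :: 'f]))"
proof -
  have "inj_on (\<lambda>(I, b). I @ [b]) (idx n \<times> onb :: ('f list \<times> 'f) set)" by (auto simp: inj_on_def)
  then show ?thesis
    unfolding idx_Suc sum.reindex[OF \<open>inj_on _ _\<close>] sum.cartesian_product by (simp add: case_prod_beta)
qed

text \<open>Slots are expanded from left to right: after n steps the first n arguments are frame
  vectors and the remaining ones are still the tail of es.\<close>

lemma alt_forms_expand:
  assumes \<alpha>: "\<alpha> \<in> alt_forms E x p" and es: "length es = p" "set es \<subseteq> fibre E x"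
  shows "\<alpha> es = (\<Sum>I\<in>idx p. (\<Prod>k<p. c (es ! k) \<bullet> I ! k) * \<alpha> (map F I))"
proof -
  have "\<alpha> es = (\<Sum>I\<in>idx n. (\<Prod>k<n. c (es ! k) \<bullet> I ! k) * \<alpha> (map F I @ drop n es))" if "n \<le> p" for n
    using that
  proof (induction n)
    case 0
    show ?case by (simp add: idx_0)
  next
    case (Suc n)
    have "\<alpha> (map F I @ drop n es) = (\<Sum>b\<in>onb. (c (es ! n) \<bullet> b) * \<alpha> (map F (I @ [b]) @ drop (Suc n) es))"
      if I: "I \<in> idx n" for I
    proof -
      let ?L = "map F I @ drop n es"
      have len: "length I = n" using I by (simp add: idx_def)
      have "?L ! n = es ! n" using len es Suc.prems by (simp add: nth_append)
      then have "?L = ?L[n := es ! n]" by (metis list_update_id)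
      also have "\<alpha> (?L[n := es ! n]) = (\<Sum>b\<in>onb. (c (es ! n) \<bullet> b) * \<alpha> (?L[n := F b]))"
        by (rule alt_forms_expand_slot[OF \<alpha>])
          (use len es Suc.prems in \<open>auto dest: in_set_dropD\<close>)
      finally have exp: "\<alpha> ?L = (\<Sum>b\<in>onb. (c (es ! n) \<bullet> b) * \<alpha> (?L[n := F b]))" .
      have "?L[n := F b] = map F (I @ [b]) @ drop (Suc n) es" for b
        using len es Suc.prems Cons_nth_drop_Suc[of n es, symmetric]
        by (simp add: list_update_append)
      then show ?thesis using exp by (simp only:)
    qed
    then have "\<alpha> es = (\<Sum>I\<in>idx n. \<Sum>b\<in>onb. (\<Prod>k<n. c (es ! k) \<bullet> I ! k) *
        ((c (es ! n) \<bullet> b) * \<alpha> (map F (I @ [b]) @ drop (Suc n) es)))"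
      using Suc by (simp add: sum_distrib_left)
    also have "\<dots> = (\<Sum>I\<in>idx n. \<Sum>b\<in>onb. (\<Prod>k<Suc n. c (es ! k) \<bullet> (I @ [b]) ! k) *
        \<alpha> (map F (I @ [b]) @ drop (Suc n) es))"
    proof (intro sum.cong refl)
      fix I :: "'f list" and b assume "I \<in> idx n"
      then have "(\<Prod>k<n. c (es ! k) \<bullet> (I @ [b]) ! k) = (\<Prod>k<n. c (es ! k) \<bullet> I ! k)"
        by (intro prod.cong) (auto simp: idx_def nth_append)
      then show "(\<Prod>k<n. c (es ! k) \<bullet> I ! k) * ((c (es ! n) \<bullet> b) * \<alpha> (map F (I @ [b]) @ drop (Suc n) es))
          = (\<Prod>k<Suc n. c (es ! k) \<bullet> (I @ [b]) ! k) * \<alpha> (map F (I @ [b]) @ drop (Suc n) es)"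
        using \<open>I \<in> idx n\<close> nth_append_length[of I b "[]"] by (simp add: idx_def mult_ac)
    qed
    also have "\<dots> = (\<Sum>I\<in>idx (Suc n). (\<Prod>k<Suc n. c (es ! k) \<bullet> I ! k) * \<alpha> (map F I @ drop (Suc n) es))"
      by (simp only: sum_idx_Suc)
    finally show ?case .
  qed
  from this[of p] show ?thesis using es by simp
qed

text \<open>After exchanging the sums, each permutation \<sigma> contributes its sign times the
  frame expansion of \<alpha> on the permuted arguments, that is, its sign squared times \<alpha> on
  es. There are p! permutations.\<close>

lemma alt_forms_sum_det:
  assumes \<alpha>: "\<alpha> \<in> alt_forms E x p" and es: "length es = p" "set es \<subseteq> fibre E x"
  shows "(\<Sum>I\<in>idx p. \<alpha> (map F I) * pdet p (\<lambda>i j. c (es ! j) \<bullet> I ! i)) = fact p * \<alpha> es"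
proof -
  have "(\<Sum>I\<in>idx p. \<alpha> (map F I) * pdet p (\<lambda>i j. c (es ! j) \<bullet> I ! i))
      = (\<Sum>I\<in>idx p. \<Sum>\<sigma> | \<sigma> permutes {..<p}.
          of_int (sign \<sigma>) * ((\<Prod>i<p. c (es ! \<sigma> i) \<bullet> I ! i) * \<alpha> (map F I)))"
    by (simp add: pdet_def sum_distrib_left mult_ac)
  also have "\<dots> = (\<Sum>\<sigma> | \<sigma> permutes {..<p}. of_int (sign \<sigma>) *
      (\<Sum>I\<in>idx p. (\<Prod>i<p. c (es ! \<sigma> i) \<bullet> I ! i) * \<alpha> (map F I)))"
    by (subst sum.swap) (simp add: sum_distrib_left)
  also have "\<dots> = (\<Sum>\<sigma> | \<sigma> permutes {..<p}. \<alpha> es)"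
  proof (intro sum.cong refl)
    fix \<sigma> assume "\<sigma> \<in> {\<sigma>. \<sigma> permutes {..<p}}"
    then have \<sigma>: "\<sigma> permutes {..<p}" by simp
    let ?es = "map (\<lambda>i. es ! \<sigma> i) [0..<p]"
    have "set ?es \<subseteq> fibre E x"
      using es permutes_in_image[OF \<sigma>] nth_mem by fastforce
    then have "\<alpha> ?es = (\<Sum>I\<in>idx p. (\<Prod>i<p. c (?es ! i) \<bullet> I ! i) * \<alpha> (map F I))"
      by (intro alt_forms_expand[OF \<alpha>]) simp_all
    also have "\<dots> = (\<Sum>I\<in>idx p. (\<Prod>i<p. c (es ! \<sigma> i) \<bullet> I ! i) * \<alpha> (map F I))"
      by simp
    finally show "of_int (sign \<sigma>) * (\<Sum>I\<in>idx p. (\<Prod>i<p. c (es ! \<sigma> i) \<bullet> I ! i) * \<alpha> (map F I)) = \<alpha> es"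
      using alt_forms_permute[OF \<alpha> \<sigma> es] by (auto simp: sign_def)
  qed
  also have "\<dots> = fact p * \<alpha> es" by (simp add: card_permutations)
  finally show ?thesis .
qed

end

section \<open>The pairing on a fibre\<close>

lemma is_pairing_sum_left:
  assumes B: "is_pairing E x p B" and P: "P \<in> alt_forms (dual_bundle E) x p"
    and f: "\<And>i. i \<in> I \<Longrightarrow> f i \<in> alt_forms E x p"
  shows "B (\<lambda>es. \<Sum>i\<in>I. a i * f i es) P = (\<Sum>i\<in>I. a i * B (f i) P)"
proof -
  have lin: "B (\<lambda>es. r * \<eta> es + r' * \<eta>' es) P = r * B \<eta> P + r' * B \<eta>' P"
    if "\<eta> \<in> alt_forms E x p" "\<eta>' \<in> alt_forms E x p" for \<eta> \<eta>' r r'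
    using B P that unfolding is_pairing_def by blast
  have zero: "B (\<lambda>_. 0) P = 0"
    using lin[OF alt_forms_zero alt_forms_zero, of 0 0] by simp
  show ?thesis
    using f
  proof (induction I rule: infinite_finite_induct)
    case (insert i I)
    have "B (\<lambda>es. a i * f i es + 1 * (\<Sum>i\<in>I. a i * f i es)) P
        = a i * B (f i) P + 1 * B (\<lambda>es. \<Sum>i\<in>I. a i * f i es) P"
      by (intro lin alt_forms_sum) (use insert.prems in auto)
    then show ?case using insert by simp
  qed (simp_all add: zero)
qed

lemma is_pairing_sum_right:
  assumes B: "is_pairing E x p B" and \<eta>: "\<eta> \<in> alt_forms E x p"
    and f: "\<And>i. i \<in> I \<Longrightarrow> f i \<in> alt_forms (dual_bundle E) x p"
  shows "B \<eta> (\<lambda>\<xi>s. \<Sum>i\<in>I. a i * f i \<xi>s) = (\<Sum>i\<in>I. a i * B \<eta> (f i))"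
proof -
  have lin: "B \<eta> (\<lambda>\<xi>s. r * P \<xi>s + r' * P' \<xi>s) = r * B \<eta> P + r' * B \<eta> P'"
    if "P \<in> alt_forms (dual_bundle E) x p" "P' \<in> alt_forms (dual_bundle E) x p" for P P' r r'
    using B \<eta> that unfolding is_pairing_def by blast
  have zero: "B \<eta> (\<lambda>_. 0) = 0"
    using lin[OF alt_forms_zero alt_forms_zero, of 0 0] by simp
  show ?thesis
    using f
  proof (induction I rule: infinite_finite_induct)
    case (insert i I)
    have "B \<eta> (\<lambda>\<xi>s. a i * f i \<xi>s + 1 * (\<Sum>i\<in>I. a i * f i \<xi>s))
        = a i * B \<eta> (f i) + 1 * B \<eta> (\<lambda>\<xi>s. \<Sum>i\<in>I. a i * f i \<xi>s)"
      by (intro lin alt_forms_sum) (use insert.prems in auto)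
    then show ?case using insert by simp
  qed (simp_all add: zero)
qed

section \<open>The dual fibre, its coframe and its coordinates\<close>

context fibre_chart
begin

text \<open>The inverse of \<open>dual_coord E c\<close>; on \<open>onb\<close> it yields the basis
  dual to the frame vectors \<open>F b\<close>.\<close>

definition coframe :: "'f \<Rightarrow> ('m, 'e) covector" where
  "coframe w = (x, \<lambda>e. if e \<in> fibre E x then w \<bullet> c e else 0)"

lemma coframe_in: "coframe w \<in> fibre (dual_bundle E) x"
  by (auto simp: fibre_dual coframe_def dual_space_def vadd_in vscale_in coord_add coord_scale
      inner_add_right)

lemma coframe_apply: "e \<in> fibre E x \<Longrightarrow> snd (coframe w) e = w \<bullet> c e"
  by (simp add: coframe_def)

lemma dual_add: "\<xi> \<in> fibre (dual_bundle E) x \<Longrightarrow> e \<in> fibre E x \<Longrightarrow> e' \<in> fibre E x \<Longrightarrow>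
    snd \<xi> (vadd E e e') = snd \<xi> e + snd \<xi> e'"
  by (simp add: fibre_dual dual_space_def)

lemma dual_scale: "\<xi> \<in> fibre (dual_bundle E) x \<Longrightarrow> e \<in> fibre E x \<Longrightarrow> snd \<xi> (vscale E a e) = a * snd \<xi> e"
  by (simp add: fibre_dual dual_space_def)

lemma dual_eqI:
  assumes "\<xi> \<in> fibre (dual_bundle E) x" "\<zeta> \<in> fibre (dual_bundle E) x"
    and "\<And>e. e \<in> fibre E x \<Longrightarrow> snd \<xi> e = snd \<zeta> e"
  shows "\<xi> = \<zeta>"
proof (rule prod_eqI)
  show "snd \<xi> = snd \<zeta>"
  proof
    fix e show "snd \<xi> e = snd \<zeta> e"
      using assms by (cases "e \<in> fibre E x") (simp_all add: fibre_dual dual_space_def)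
  qed
qed (use assms in \<open>simp add: fibre_dual\<close>)

text \<open>The vector with coefficients \<xi>(F b) represents \<xi>. Another representative has the
  same inner product with the difference of the two, so that difference is orthogonal to itself;
  hence the definite description in \<open>dual_coord\<close> is meaningful.\<close>

lemma dual_coord_inner:
  assumes "\<xi> \<in> fibre (dual_bundle E) x"
  shows "dual_coord E c \<xi> \<bullet> w = snd \<xi> (F w)"
proof -
  define w0 where "w0 = (\<Sum>b\<in>onb. snd \<xi> (F b) *\<^sub>R b)"
  have w0: "snd \<xi> e = w0 \<bullet> c e" if e: "e \<in> fibre E x" for e
  proof -
    have "snd \<xi> e = (\<Sum>b\<in>onb. (c e \<bullet> b) * snd \<xi> (F b))"
      by (rule linear_frame_expand) (use e dual_add[OF assms] dual_scale[OF assms] in auto)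
    then show ?thesis by (simp add: w0_def inner_sum_left inner_commute[of "c e"] mult.commute)
  qed
  have "w' = w0" if w': "\<forall>e\<in>fibre E x. snd \<xi> e = w' \<bullet> c e" for w'
  proof -
    have "w0 \<bullet> (w' - w0) = w' \<bullet> (w' - w0)"
      using w' w0[of "F (w' - w0)"] by simp
    then have "(w' - w0) \<bullet> (w' - w0) = 0" by (simp add: inner_diff_left)
    then show ?thesis by simp
  qed
  moreover have "fst \<xi> = x" using assms by (simp add: fibre_dual)
  ultimately have "dual_coord E c \<xi> = w0"
    using w0 unfolding dual_coord_def case_prod_beta by (intro the_equality) auto
  then show ?thesis using w0[of "F w"] by simp
qed

lemma dual_coord_coframe: "dual_coord E c (coframe w) = w"
proof -
  have "dual_coord E c (coframe w) \<bullet> v = w \<bullet> v" for v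
    by (simp add: dual_coord_inner[OF coframe_in] coframe_apply)
  then have "(dual_coord E c (coframe w) - w) \<bullet> (dual_coord E c (coframe w) - w) = 0"
    by (simp add: inner_diff_left)
  then show ?thesis by simp
qed

lemma coframe_dual_coord:
  assumes "\<xi> \<in> fibre (dual_bundle E) x"
  shows "coframe (dual_coord E c \<xi>) = \<xi>"
  by (rule dual_eqI[OF coframe_in assms])
    (simp add: coframe_apply dual_coord_inner[OF assms] frame_coord)

text \<open>This allows every fact about \<open>fibre_chart\<close> to be reused for covectors, with
  \<open>coframe\<close> as the frame of the dual fibre.\<close>

lemma dual_chart: "fibre_chart (dual_bundle E) x (dual_coord E c)"
proof
  show "bij_betw (dual_coord E c) (fibre (dual_bundle E) x) UNIV"
    by (rule bij_betw_byWitness[where f' = coframe])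
      (use coframe_in coframe_dual_coord dual_coord_coframe in auto)
  show zero: "vzero (dual_bundle E) x \<in> fibre (dual_bundle E) x"
    by (simp add: fibre_dual dual_bundle_ops dual_space_def)
  have eqI: "w = w'" if "\<And>v. w \<bullet> v = w' \<bullet> v" for w w' :: 'f
    using that[of "w - w'"] by (metis inner_diff_left inner_eq_zero_iff right_minus_eq)
  show "dual_coord E c (vzero (dual_bundle E) x) = 0"
    by (rule eqI) (simp add: dual_coord_inner[OF zero], simp add: dual_bundle_ops)
  show add: "vadd (dual_bundle E) \<xi> \<zeta> \<in> fibre (dual_bundle E) x"
    if "\<xi> \<in> fibre (dual_bundle E) x" "\<zeta> \<in> fibre (dual_bundle E) x" for \<xi> \<zeta>
    using that by (simp add: fibre_dual dual_bundle_ops dual_space_def algebra_simps)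
  show scale: "vscale (dual_bundle E) a \<xi> \<in> fibre (dual_bundle E) x"
    if "\<xi> \<in> fibre (dual_bundle E) x" for \<xi> a
    using that by (simp add: fibre_dual dual_bundle_ops dual_space_def algebra_simps)
  show "dual_coord E c (vadd (dual_bundle E) \<xi> \<zeta>) = dual_coord E c \<xi> + dual_coord E c \<zeta>"
    if "\<xi> \<in> fibre (dual_bundle E) x" "\<zeta> \<in> fibre (dual_bundle E) x" for \<xi> \<zeta>
    by (rule eqI) (simp add: dual_coord_inner[OF add[OF that]] dual_coord_inner[OF that(1)]
        dual_coord_inner[OF that(2)] inner_add_left, simp add: dual_bundle_ops)
  show "dual_coord E c (vscale (dual_bundle E) a \<xi>) = a *\<^sub>R dual_coord E c \<xi>"
    if "\<xi> \<in> fibre (dual_bundle E) x" for \<xi> a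
    by (rule eqI) (simp add: dual_coord_inner[OF scale[OF that]] dual_coord_inner[OF that],
        simp add: dual_bundle_ops)
qed (rule fmodel)

lemma inv_dual_coord: "inv_into (fibre (dual_bundle E) x) (dual_coord E c) = coframe"
proof
  interpret dual: fibre_chart "dual_bundle E" x "dual_coord E c" by (rule dual_chart)
  show "dual.F w = coframe w" for w
    by (rule dual.coord_inj) (simp_all add: coframe_in dual_coord_coframe)
qed

lemma wedge_covectors_pdet:
  assumes "length \<xi>s = p" "length es = p" "set es \<subseteq> fibre E x"
  shows "wedge_covectors E x \<xi>s es = pdet p (\<lambda>i j. snd (\<xi>s ! i) (es ! j))"
  using assms by (simp add: wedge_covectors_def det_pairing_pdet)

lemma wedge_vectors_pdet:
  assumes "length es = p" "length \<xi>s = p" "set \<xi>s \<subseteq> fibre (dual_bundle E) x"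
  shows "wedge_vectors E x es \<xi>s = pdet p (\<lambda>i j. snd (\<xi>s ! i) (es ! j))"
  using assms by (simp add: wedge_vectors_def det_pairing_pdet)

lemma wedge_covectors_alt:
  assumes "length \<xi>s = p" "set \<xi>s \<subseteq> fibre (dual_bundle E) x"
  shows "wedge_covectors E x \<xi>s \<in> alt_forms E x p"
proof -
  \<comment> \<open>\<open>det_pairing\<close> has the vectors as columns, so A is the transposed
    arrangement and \<open>pdet_transpose\<close> is applied below. The value 0 for j \<ge> p keeps
    A linear in e for every j, also where the list lookup is meaningless.\<close>
  define A where "A e j = (if j < p then snd (\<xi>s ! j) e else 0)" for e j
  have \<xi>: "\<xi>s ! j \<in> fibre (dual_bundle E) x" if "j < p" for j
    using assms that nth_mem by blast
  have "(\<lambda>es. if length es = p \<and> set es \<subseteq> fibre E x then pdet p (\<lambda>i. A (es ! i)) else 0)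
      \<in> alt_forms E x p"
    by (rule pdet_alt_form) (auto simp: A_def dual_add[OF \<xi>] dual_scale[OF \<xi>] vadd_in vscale_in)
  moreover have "wedge_covectors E x \<xi>s es
      = (if length es = p \<and> set es \<subseteq> fibre E x then pdet p (\<lambda>i. A (es ! i)) else 0)" for es
  proof (cases "length es = p \<and> set es \<subseteq> fibre E x")
    case True
    have "pdet p (\<lambda>i. A (es ! i)) = pdet p (\<lambda>i j. snd (\<xi>s ! j) (es ! i))"
      by (rule pdet_cong) (simp add: A_def)
    then show ?thesis
      using True wedge_covectors_pdet[OF assms(1)] pdet_transpose[of p "\<lambda>i j. snd (\<xi>s ! i) (es ! j)"]
      by simp
  qed (use assms in \<open>auto simp: wedge_covectors_def\<close>)
  ultimately show ?thesis by presburger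
qed

lemma wedge_vectors_alt:
  assumes "length es = p" "set es \<subseteq> fibre E x"
  shows "wedge_vectors E x es \<in> alt_forms (dual_bundle E) x p"
proof -
  interpret dual: fibre_chart "dual_bundle E" x "dual_coord E c" by (rule dual_chart)
  define A where "A = (\<lambda>(\<xi> :: ('m, 'e) covector) j. snd \<xi> (es ! j))"
  have "(\<lambda>\<xi>s. if length \<xi>s = p \<and> set \<xi>s \<subseteq> fibre (dual_bundle E) x then pdet p (\<lambda>i. A (\<xi>s ! i)) else 0)
      \<in> alt_forms (dual_bundle E) x p"
    by (rule pdet_alt_form)
      (simp_all add: A_def dual_bundle_ops(2,3) dual.vadd_in[unfolded dual_bundle_ops]
        dual.vscale_in[unfolded dual_bundle_ops])
  moreover have "wedge_vectors E x es
      = (\<lambda>\<xi>s. if length \<xi>s = p \<and> set \<xi>s \<subseteq> fibre (dual_bundle E) x then pdet p (\<lambda>i. A (\<xi>s ! i)) else 0)"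
    using assms by (auto simp: wedge_vectors_def det_pairing_pdet A_def fun_eq_iff)
  ultimately show ?thesis by simp
qed

section \<open>Expansion into decomposable elements and the pairing in a frame\<close>

lemma idx_frame: "I \<in> idx p \<Longrightarrow> length (map F I) = p \<and> set (map F I) \<subseteq> fibre E x"
  by (auto simp: idx_def)

lemma idx_coframe: "I \<in> idx p \<Longrightarrow> length (map coframe I) = p \<and> set (map coframe I) \<subseteq> fibre (dual_bundle E) x"
  by (auto simp: idx_def coframe_in)

text \<open>This is \<open>alt_forms_sum_det\<close> read as the expansion of p! \<eta> into wedge
  products of coframe elements, evaluated on es.\<close>

lemma alt_forms_sum_wedge:
  assumes \<eta>: "\<eta> \<in> alt_forms E x p" and es: "length es = p" "set es \<subseteq> fibre E x"
  shows "(\<Sum>I\<in>idx p. \<eta> (map F I) * pdet p (\<lambda>i j. snd (coframe (I ! i)) (es ! j))) = fact p * \<eta> es"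
proof -
  have "pdet p (\<lambda>i j. snd (coframe (I ! i)) (es ! j)) = pdet p (\<lambda>i j. c (es ! j) \<bullet> I ! i)" for I
    by (rule pdet_cong) (use es nth_mem in \<open>auto simp: coframe_apply inner_commute subset_iff\<close>)
  then show ?thesis using alt_forms_sum_det[OF assms] by simp
qed

lemma alt_forms_sum_wedge_dual:
  assumes P: "P \<in> alt_forms (dual_bundle E) x p"
    and \<xi>s: "length \<xi>s = p" "set \<xi>s \<subseteq> fibre (dual_bundle E) x"
  shows "(\<Sum>I\<in>idx p. P (map coframe I) * pdet p (\<lambda>i j. snd (\<xi>s ! i) (F (I ! j)))) = fact p * P \<xi>s"
proof -
  interpret dual: fibre_chart "dual_bundle E" x "dual_coord E c" by (rule dual_chart)
  have "pdet p (\<lambda>i j. snd (\<xi>s ! i) (F (I ! j))) = pdet p (\<lambda>i j. dual_coord E c (\<xi>s ! j) \<bullet> I ! i)" for I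
  proof -
    have "pdet p (\<lambda>i j. snd (\<xi>s ! i) (F (I ! j))) = pdet p (\<lambda>i j. dual_coord E c (\<xi>s ! i) \<bullet> I ! j)"
    proof (rule pdet_cong)
      fix i j assume "i < p"
      then have "\<xi>s ! i \<in> fibre (dual_bundle E) x" using \<xi>s nth_mem by blast
      then show "snd (\<xi>s ! i) (F (I ! j)) = dual_coord E c (\<xi>s ! i) \<bullet> I ! j"
        by (simp add: dual_coord_inner)
    qed
    then show ?thesis
      using pdet_transpose[of p "\<lambda>i j. dual_coord E c (\<xi>s ! i) \<bullet> I ! j"] by simp
  qed
  then show ?thesis using dual.alt_forms_sum_det[OF assms] by (simp add: inv_dual_coord)
qed

text \<open>The usual sum of products of components over increasing multi-indices, written over all
  p-tuples and therefore divided by p!.\<close>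

definition frame_pairing ::
  "nat \<Rightarrow> ('e list \<Rightarrow> real) \<Rightarrow> (('m, 'e) covector list \<Rightarrow> real) \<Rightarrow> real" where
  "frame_pairing p \<eta> P = (\<Sum>I\<in>idx p. \<eta> (map F I) * P (map coframe I)) / fact p"

lemma frame_pairing_wedge_vectors:
  assumes \<eta>: "\<eta> \<in> alt_forms E x p" and es: "length es = p" "set es \<subseteq> fibre E x"
  shows "frame_pairing p \<eta> (wedge_vectors E x es) = \<eta> es"
proof -
  have "wedge_vectors E x es (map coframe I) = pdet p (\<lambda>i j. snd (coframe (I ! i)) (es ! j))"
    if "I \<in> idx p" for I
  proof -
    have "wedge_vectors E x es (map coframe I) = pdet p (\<lambda>i j. snd (map coframe I ! i) (es ! j))"
      by (rule wedge_vectors_pdet) (use es idx_coframe[OF that] in auto)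
    also have "\<dots> = pdet p (\<lambda>i j. snd (coframe (I ! i)) (es ! j))"
      by (rule pdet_cong) (use that in \<open>simp add: idx_def\<close>)
    finally show ?thesis .
  qed
  then show ?thesis using alt_forms_sum_wedge[OF assms] by (simp add: frame_pairing_def)
qed

text \<open>The components of the wedge product on the frame are determinants, and summing them
  against the components of P is the expansion of p! P at the given covectors. Thus P is recovered
  from its pairings with decomposable forms.\<close>

lemma frame_pairing_wedge_covectors:
  assumes P: "P \<in> alt_forms (dual_bundle E) x p"
    and \<xi>s: "length \<xi>s = p" "set \<xi>s \<subseteq> fibre (dual_bundle E) x"
  shows "frame_pairing p (wedge_covectors E x \<xi>s) P = P \<xi>s"
proof -
  have "wedge_covectors E x \<xi>s (map F I) = pdet p (\<lambda>i j. snd (\<xi>s ! i) (F (I ! j)))"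
    if "I \<in> idx p" for I
  proof -
    have "wedge_covectors E x \<xi>s (map F I) = pdet p (\<lambda>i j. snd (\<xi>s ! i) (map F I ! j))"
      by (rule wedge_covectors_pdet) (use \<xi>s idx_frame[OF that] in auto)
    also have "\<dots> = pdet p (\<lambda>i j. snd (\<xi>s ! i) (F (I ! j)))"
      by (rule pdet_cong) (use that in \<open>simp add: idx_def\<close>)
    finally show ?thesis .
  qed
  then show ?thesis
    using alt_forms_sum_wedge_dual[OF assms] by (simp add: frame_pairing_def mult.commute)
qed

lemma is_pairing_frame_pairing: "is_pairing E x p (frame_pairing p)"
proof -
  have "frame_pairing p (wedge_covectors E x \<xi>s) (wedge_vectors E x es) = det_pairing \<xi>s es"
    if "length \<xi>s = p" "length es = p" "set \<xi>s \<subseteq> fibre (dual_bundle E) x" "set es \<subseteq> fibre E x" for \<xi>s es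
    using frame_pairing_wedge_vectors[OF wedge_covectors_alt[OF that(1,3)] that(2,4)] that
    by (simp add: wedge_covectors_def)
  then show ?thesis
    unfolding is_pairing_def frame_pairing_def
    by (auto simp: algebra_simps sum.distrib sum_distrib_left add_divide_distrib sum_divide_distrib)
qed

text \<open>Both arguments are expanded into decomposable elements, on which B is prescribed. As B
  no longer occurs on the right, any two maps with \<open>is_pairing\<close> agree on alternating
  forms.\<close>

lemma is_pairing_expand:
  assumes B: "is_pairing E x p B" and \<eta>: "\<eta> \<in> alt_forms E x p"
    and P: "P \<in> alt_forms (dual_bundle E) x p"
  shows "B \<eta> P = (\<Sum>I\<in>idx p. \<eta> (map F I) / fact p * (\<Sum>J\<in>idx p. P (map coframe J) / fact p *
    det_pairing (map coframe I) (map F J)))"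
proof -
  \<comment> \<open>B takes whole functions on lists as arguments, so the expansion is needed as an
    equality of functions; on lists outside the fibre or of wrong length both sides are 0.\<close>
  have "\<eta> = (\<lambda>es. \<Sum>I\<in>idx p. \<eta> (map F I) / fact p * wedge_covectors E x (map coframe I) es)"
  proof
    fix es
    show "\<eta> es = (\<Sum>I\<in>idx p. \<eta> (map F I) / fact p * wedge_covectors E x (map coframe I) es)"
    proof (cases "length es = p \<and> set es \<subseteq> fibre E x")
      case True
      have "wedge_covectors E x (map coframe I) es = pdet p (\<lambda>i j. snd (coframe (I ! i)) (es ! j))"
        if "I \<in> idx p" for I
      proof -
        have "wedge_covectors E x (map coframe I) es = pdet p (\<lambda>i j. snd (map coframe I ! i) (es ! j))"
          by (rule wedge_covectors_pdet) (use True idx_coframe[OF that] in auto)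
        also have "\<dots> = pdet p (\<lambda>i j. snd (coframe (I ! i)) (es ! j))"
          by (rule pdet_cong) (use that in \<open>simp add: idx_def\<close>)
        finally show ?thesis .
      qed
      then have "(\<Sum>I\<in>idx p. \<eta> (map F I) / fact p * wedge_covectors E x (map coframe I) es)
          = (\<Sum>I\<in>idx p. \<eta> (map F I) * pdet p (\<lambda>i j. snd (coframe (I ! i)) (es ! j))) / fact p"
        by (simp add: sum_divide_distrib)
      then show ?thesis using alt_forms_sum_wedge[OF \<eta>] True by simp
    next
      case False
      then show ?thesis
        using alt_forms_outside[OF \<eta>]
        by (subst sum.neutral) (auto simp: wedge_covectors_def idx_def)
    qed
  qed
  moreover have "P = (\<lambda>\<xi>s. \<Sum>J\<in>idx p. P (map coframe J) / fact p * wedge_vectors E x (map F J) \<xi>s)"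
  proof
    fix \<xi>s
    show "P \<xi>s = (\<Sum>J\<in>idx p. P (map coframe J) / fact p * wedge_vectors E x (map F J) \<xi>s)"
    proof (cases "length \<xi>s = p \<and> set \<xi>s \<subseteq> fibre (dual_bundle E) x")
      case True
      have "wedge_vectors E x (map F J) \<xi>s = pdet p (\<lambda>i j. snd (\<xi>s ! i) (F (J ! j)))"
        if "J \<in> idx p" for J
      proof -
        have "wedge_vectors E x (map F J) \<xi>s = pdet p (\<lambda>i j. snd (\<xi>s ! i) (map F J ! j))"
          by (rule wedge_vectors_pdet) (use True idx_frame[OF that] in auto)
        also have "\<dots> = pdet p (\<lambda>i j. snd (\<xi>s ! i) (F (J ! j)))"
          by (rule pdet_cong) (use that in \<open>simp add: idx_def\<close>)
        finally show ?thesis .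
      qed
      then have "(\<Sum>J\<in>idx p. P (map coframe J) / fact p * wedge_vectors E x (map F J) \<xi>s)
          = (\<Sum>J\<in>idx p. P (map coframe J) * pdet p (\<lambda>i j. snd (\<xi>s ! i) (F (J ! j)))) / fact p"
        by (simp add: sum_divide_distrib)
      then show ?thesis using alt_forms_sum_wedge_dual[OF P] True by simp
    next
      case False
      then show ?thesis
        using alt_forms_outside[OF P]
        by (subst sum.neutral) (auto simp: wedge_vectors_def idx_def)
    qed
  qed
  ultimately have "B \<eta> P = B (\<lambda>es. \<Sum>I\<in>idx p. \<eta> (map F I) / fact p * wedge_covectors E x (map coframe I) es)
      (\<lambda>\<xi>s. \<Sum>J\<in>idx p. P (map coframe J) / fact p * wedge_vectors E x (map F J) \<xi>s)"
    by (rule arg_cong2[of _ _ _ _ B])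
  also have "\<dots> = (\<Sum>I\<in>idx p. \<eta> (map F I) / fact p * (\<Sum>J\<in>idx p. P (map coframe J) / fact p *
      B (wedge_covectors E x (map coframe I)) (wedge_vectors E x (map F J))))"
  proof -
    have w: "wedge_covectors E x (map coframe I) \<in> alt_forms E x p" if "I \<in> idx p" for I
      using idx_coframe[OF that] wedge_covectors_alt by blast
    have v: "wedge_vectors E x (map F J) \<in> alt_forms (dual_bundle E) x p" if "J \<in> idx p" for J
      using idx_frame[OF that] wedge_vectors_alt by blast
    show ?thesis
    proof (subst is_pairing_sum_left[OF B alt_forms_sum[OF v] w])
      show "(\<Sum>I\<in>idx p. \<eta> (map F I) / fact p * B (wedge_covectors E x (map coframe I))
            (\<lambda>\<xi>s. \<Sum>J\<in>idx p. P (map coframe J) / fact p * wedge_vectors E x (map F J) \<xi>s))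
          = (\<Sum>I\<in>idx p. \<eta> (map F I) / fact p * (\<Sum>J\<in>idx p. P (map coframe J) / fact p *
            B (wedge_covectors E x (map coframe I)) (wedge_vectors E x (map F J))))"
        by (intro sum.cong refl arg_cong2[of _ _ _ _ "(*)"] is_pairing_sum_right[OF B w v])
    qed
  qed
  also have "\<dots> = (\<Sum>I\<in>idx p. \<eta> (map F I) / fact p * (\<Sum>J\<in>idx p. P (map coframe J) / fact p *
      det_pairing (map coframe I) (map F J)))"
  proof (intro sum.cong refl arg_cong2[of _ _ _ _ "(*)"])
    fix I J :: "'f list" assume "I \<in> idx p" "J \<in> idx p"
    then show "B (wedge_covectors E x (map coframe I)) (wedge_vectors E x (map F J))
        = det_pairing (map coframe I) (map F J)"
      using B idx_frame[of J p] idx_coframe[of I p] unfolding is_pairing_def by blast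
  qed
  finally show ?thesis .
qed

text \<open>The arbitrary choice inside \<open>pairing\<close> and the explicit map of the current
  chart both satisfy \<open>is_pairing\<close>, hence have the same expansion. Any trivialisation
  around x may be used to compute the pairing there.\<close>

lemma pairing_frame:
  assumes "\<eta> x \<in> alt_forms E x p" "P x \<in> alt_forms (dual_bundle E) x p"
  shows "pairing E p \<eta> P x = frame_pairing p (\<eta> x) (P x)"
proof -
  have "is_pairing E x p (SOME B. is_pairing E x p B)"
    by (rule someI[of _ "frame_pairing p"]) (rule is_pairing_frame_pairing)
  from is_pairing_expand[OF this assms] show ?thesis
    unfolding pairing_def is_pairing_expand[OF is_pairing_frame_pairing assms] .
qed

end

section \<open>Sections, dual bundles and forms\<close>

locale smooth_bundle = smooth_mfd \<A>
  for \<A> :: "('m::{t2_space, second_countable_topology}, 'b::real_inner) chart set" +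
  fixes E :: "('m, 'e, 'f::real_inner) vbundle"
  assumes vbundle: "vector_bundle \<A> E"
begin

lemma fmodel: "euclidean_model TYPE('f)"
  using vbundle unfolding vector_bundle_def by (elim conjE)

lemma
  shows vzero_in_fibre: "vzero E x \<in> fibre E x"
    and vadd_in_fibre: "e \<in> fibre E x \<Longrightarrow> e' \<in> fibre E x \<Longrightarrow> vadd E e e' \<in> fibre E x"
    and vscale_in_fibre: "e \<in> fibre E x \<Longrightarrow> vscale E a e \<in> fibre E x"
proof -
  have *: "\<forall>x. vzero E x \<in> fibre E x \<and>
      (\<forall>e\<in>fibre E x. \<forall>e'\<in>fibre E x. vadd E e e' \<in> fibre E x) \<and>
      (\<forall>a. \<forall>e\<in>fibre E x. vscale E a e \<in> fibre E x)"
    using vbundle unfolding vector_bundle_def by (elim conjE)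
  show "vzero E x \<in> fibre E x" using * by blast
  show "vadd E e e' \<in> fibre E x" if "e \<in> fibre E x" "e' \<in> fibre E x" using * that by blast
  show "vscale E a e \<in> fibre E x" if "e \<in> fibre E x" using * that by blast
qed

lemma triv_at:
  obtains U c where "(U, c) \<in> trivs E" "x \<in> U"
proof -
  have "(\<Union>t\<in>trivs E. fst t) = UNIV" using vbundle unfolding vector_bundle_def by (elim conjE)
  then obtain t where "t \<in> trivs E" "x \<in> fst t" by blast
  then show ?thesis using that[of "fst t" "snd t"] by simp
qed

lemma triv_all:
  "\<forall>(U, c)\<in>trivs E. open U \<and>
        (\<forall>x\<in>U. bij_betw c (fibre E x) UNIV \<and>
               c (vzero E x) = 0 \<and>
               (\<forall>e\<in>fibre E x. \<forall>e'\<in>fibre E x. c (vadd E e e') = c e + c e') \<and>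
               (\<forall>a. \<forall>e\<in>fibre E x. c (vscale E a e) = a *\<^sub>R c e))"
  using vbundle unfolding vector_bundle_def by (elim conjE)

lemma triv_open: "(U, c) \<in> trivs E \<Longrightarrow> open U"
  using triv_all by blast

lemma triv_chart:
  assumes "(U, c) \<in> trivs E" "x \<in> U"
  shows "fibre_chart E x c"
proof -
  have "bij_betw c (fibre E x) UNIV \<and> c (vzero E x) = 0 \<and>
      (\<forall>e\<in>fibre E x. \<forall>e'\<in>fibre E x. c (vadd E e e') = c e + c e') \<and>
      (\<forall>a. \<forall>e\<in>fibre E x. c (vscale E a e) = a *\<^sub>R c e)"
    using triv_all assms by blast
  then show ?thesis
    using fmodel vzero_in_fibre vadd_in_fibre vscale_in_fibre by unfold_locales blast+
qed

lemma transition_smooth: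
  "(U, c) \<in> trivs E \<Longrightarrow> (U', c') \<in> trivs E \<Longrightarrow>
     smooth_map_on \<A> (U \<inter> U') (\<lambda>x. c' (inv_into (fibre E x) c w))"
proof -
  have "\<forall>(U, c)\<in>trivs E. \<forall>(U', c')\<in>trivs E. \<forall>w.
      smooth_map_on \<A> (U \<inter> U') (\<lambda>x. c' (inv_into (fibre E x) c w))"
    using vbundle unfolding vector_bundle_def by (elim conjE)
  then show "(U, c) \<in> trivs E \<Longrightarrow> (U', c') \<in> trivs E \<Longrightarrow> ?thesis" by blast
qed

section \<open>Smooth sections: smoothness tests and extension by cutoff\<close>

abbreviation "\<Gamma> \<equiv> smooth_sections \<A> E"

lemma section_in: "s \<in> \<Gamma> \<Longrightarrow> s x \<in> fibre E x"
  by (simp add: smooth_sections_def)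

lemma section_smooth: "s \<in> \<Gamma> \<Longrightarrow> (U, c) \<in> trivs E \<Longrightarrow> smooth_map_on \<A> U (\<lambda>x. c (s x))"
  by (auto simp: smooth_sections_def)

text \<open>In another trivialisation the section is its frame expansion, whose coefficients are
  smooth by assumption and whose frame vectors have smooth coordinates by
  \<open>transition_smooth\<close>. One trivialisation near each point therefore suffices.\<close>

lemma sectionI:
  assumes s: "\<And>x. s x \<in> fibre E x"
    and loc: "\<And>x. \<exists>U c W. (U, c) \<in> trivs E \<and> open W \<and> x \<in> W \<and> W \<subseteq> U \<and>
      smooth_map_on \<A> W (\<lambda>y. c (s y))"
  shows "s \<in> \<Gamma>"
proof -
  have "smooth_map_on \<A> U' (\<lambda>x. c' (s x))" if c': "(U', c') \<in> trivs E" for U' c'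
  proof (rule smooth_map_on_local)
    fix x assume x: "x \<in> U'"
    obtain U c W where c: "(U, c) \<in> trivs E" "open W" "x \<in> W" "W \<subseteq> U"
      "smooth_map_on \<A> W (\<lambda>y. c (s y))" using loc by blast
    have W: "open (W \<inter> U')" using c(2) triv_open[OF c'] by blast
    have "smooth_map_on \<A> (W \<inter> U') (\<lambda>y. c' (s y))"
    proof (rule smooth_map_on_cong[OF W])
      show "smooth_map_on \<A> (W \<inter> U') (\<lambda>y. \<Sum>b\<in>onb. (c (s y) \<bullet> b) *\<^sub>R c' (inv_into (fibre E y) c b))"
        by (intro smooth_map_on_sum smooth_map_on_scaleR smooth_map_on_inner_const W
            smooth_map_on_subset[OF c(5)] smooth_map_on_subset[OF transition_smooth[OF c(1) c']])
          (use c(4) in auto)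
      fix y assume y: "y \<in> W \<inter> U'"
      interpret c: fibre_chart E y c by (rule triv_chart[OF c(1)]) (use y c(4) in auto)
      interpret c': fibre_chart E y c' by (rule triv_chart[OF c']) (use y in auto)
      show "(\<Sum>b\<in>onb. (c (s y) \<bullet> b) *\<^sub>R c' (inv_into (fibre E y) c b)) = c' (s y)"
        by (rule c.linear_frame_expand_scaleR[symmetric]) (simp_all add: s c'.coord_add c'.coord_scale)
    qed
    then show "\<exists>W'. open W' \<and> x \<in> W' \<and> smooth_map_on \<A> W' (\<lambda>x. c' (s x))"
      using W c(3) x by blast
  qed
  then show ?thesis using s by (auto simp: smooth_sections_def)
qed

lemma sectionI':
  assumes "\<And>x. s x \<in> fibre E x" "\<And>U c. (U, c) \<in> trivs E \<Longrightarrow> smooth_map_on \<A> U (\<lambda>y. c (s y))"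
  shows "s \<in> \<Gamma>"
  using assms by (auto simp: smooth_sections_def)

lemma vzero_section: "vzero E \<in> \<Gamma>"
proof (rule sectionI')
  show "vzero E x \<in> fibre E x" for x by (rule vzero_in_fibre)
  fix U c assume c: "(U, c) \<in> trivs E"
  show "smooth_map_on \<A> U (\<lambda>y. c (vzero E y))"
    by (rule smooth_map_on_cong[OF triv_open[OF c] smooth_map_on_const[of _ 0]])
      (simp add: fibre_chart.coord_zero[OF triv_chart[OF c]])
qed

lemma sec_add_section:
  assumes "s \<in> \<Gamma>" "t \<in> \<Gamma>"
  shows "sec_add E s t \<in> \<Gamma>"
proof (rule sectionI')
  show "sec_add E s t x \<in> fibre E x" for x
    using assms section_in vadd_in_fibre by (simp add: sec_add_def)
  fix U c assume c: "(U, c) \<in> trivs E"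
  note U = triv_open[OF c]
  show "smooth_map_on \<A> U (\<lambda>y. c (sec_add E s t y))"
    by (rule smooth_map_on_cong[OF U smooth_map_on_add[OF U section_smooth[OF assms(1) c]
            section_smooth[OF assms(2) c]]])
      (simp add: sec_add_def fibre_chart.coord_add[OF triv_chart[OF c]] section_in assms)
qed

lemma sec_scale_section:
  assumes "smooth_map_on \<A> UNIV f" "s \<in> \<Gamma>"
  shows "sec_scale E f s \<in> \<Gamma>"
proof (rule sectionI')
  show "sec_scale E f s x \<in> fibre E x" for x
    using assms section_in vscale_in_fibre by (simp add: sec_scale_def)
  fix U c assume c: "(U, c) \<in> trivs E"
  note U = triv_open[OF c]
  show "smooth_map_on \<A> U (\<lambda>y. c (sec_scale E f s y))"
    by (rule smooth_map_on_cong[OF U smooth_map_on_scaleR[OF U smooth_map_on_subset[OF assms(1)]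
            section_smooth[OF assms(2) c]]])
      (simp_all add: sec_scale_def fibre_chart.coord_scale[OF triv_chart[OF c]] section_in assms)
qed

text \<open>Inside U the coordinates are \<psi> w. A point outside U has the complement of C as a
  neighbourhood on which the section is the zero section, because the frame at the coordinate vector
  0 is \<open>vzero\<close>; closedness of C is what makes this neighbourhood open.\<close>

lemma cutoff_section:
  assumes c: "(U, c) \<in> trivs E" and \<psi>: "smooth_map_on \<A> UNIV \<psi>"
    and C: "closed C" "C \<subseteq> U" "\<And>y. y \<notin> C \<Longrightarrow> \<psi> y = (0::real)"
  shows "(\<lambda>y. if y \<in> U then inv_into (fibre E y) c (\<psi> y *\<^sub>R w) else vzero E y) \<in> \<Gamma>" (is "?s \<in> \<Gamma>")
proof (rule sectionI)
  fix x
  show "?s x \<in> fibre E x"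
    using fibre_chart.frame_in[OF triv_chart[OF c]] section_in[OF vzero_section] by auto
  show "\<exists>U c W. (U, c) \<in> trivs E \<and> open W \<and> x \<in> W \<and> W \<subseteq> U \<and> smooth_map_on \<A> W (\<lambda>y. c (?s y))"
  proof (cases "x \<in> U")
    case True
    have "smooth_map_on \<A> U (\<lambda>y. c (?s y))"
    proof (rule smooth_map_on_cong[OF triv_open[OF c]])
      show "smooth_map_on \<A> U (\<lambda>y. \<psi> y *\<^sub>R w)"
        by (intro smooth_map_on_scaleR triv_open[OF c] smooth_map_on_subset[OF \<psi>]) simp_all
    qed (simp add: fibre_chart.coord_frame[OF triv_chart[OF c]])
    then show ?thesis using c True triv_open[OF c] by blast
  next
    case False
    obtain U' c' where c': "(U', c') \<in> trivs E" "x \<in> U'" by (rule triv_at)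
    have W: "open (U' - C)" using triv_open[OF c'(1)] C(1) by blast
    have "?s y = vzero E y" if "y \<notin> C" for y
    proof (cases "y \<in> U")
      case True
      interpret fibre_chart E y c by (rule triv_chart[OF c True])
      show ?thesis using True C(3)[OF that] by (simp add: frame_zero)
    qed simp
    then have "smooth_map_on \<A> (U' - C) (\<lambda>y. c' (?s y))"
      by (intro smooth_map_on_cong[OF W smooth_map_on_subset[OF section_smooth[OF vzero_section c'(1)]]])
        auto
    then show ?thesis using c' W False C(2) by (intro exI[of _ U'] exI[of _ c'] exI[of _ "U' - C"]) auto
  qed
qed

lemma cutoff_function:
  assumes "open U" "smooth_map_on \<A> UNIV \<psi>" "closed C" "C \<subseteq> U" "\<And>y. y \<notin> C \<Longrightarrow> \<psi> y = (0::real)"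
    and f: "smooth_map_on \<A> U f"
  shows "smooth_map_on \<A> UNIV (\<lambda>y. if y \<in> U then \<psi> y * f y else 0)"
proof (rule smooth_map_on_local)
  fix x
  let ?g = "\<lambda>y. if y \<in> U then \<psi> y * f y else 0"
  have "smooth_map_on \<A> U ?g"
    by (rule smooth_map_on_cong[OF assms(1) smooth_map_on_mult[OF assms(1) smooth_map_on_subset[OF assms(2)] f]])
      simp_all
  moreover have "smooth_map_on \<A> (- C) ?g"
    by (rule smooth_map_on_cong[of _ "\<lambda>_. 0"]) (use assms in auto)
  ultimately show "\<exists>W'. open W' \<and> x \<in> W' \<and> smooth_map_on \<A> W' ?g"
    using assms(1,3,4) by (cases "x \<in> C") (auto simp: open_Compl)
qed

text \<open>Operators such as the bracket only accept global sections. These sections coincide with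
  the local frame near x, so that computations in a frame become possible.\<close>

lemma frame_extension:
  assumes c: "(U, c) \<in> trivs E" and x: "x \<in> U"
  obtains W S where "open W" "x \<in> W" "W \<subseteq> U" "\<And>w. S w \<in> \<Gamma>"
    "\<And>w y. y \<in> W \<Longrightarrow> S w y = inv_into (fibre E y) c w"
proof -
  obtain \<psi> C W0 where \<psi>: "smooth_map_on \<A> UNIV \<psi>" "open W0" "x \<in> W0" "W0 \<subseteq> U" "closed C" "C \<subseteq> U"
    "\<And>z. z \<in> W0 \<Longrightarrow> \<psi> z = (1::real)" "\<And>z. z \<notin> C \<Longrightarrow> \<psi> z = 0"
    by (rule plateau_function[OF triv_open[OF c] x]) (rule that)
  show ?thesis
    by (rule that[OF \<psi>(2,3,4) cutoff_section[OF c \<psi>(1,5,6,8)]]) (use \<psi>(4,7) in auto)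
qed

lemma section_through:
  assumes "e \<in> fibre E x"
  obtains s where "s \<in> \<Gamma>" "s x = e"
proof -
  obtain U c where c: "(U, c) \<in> trivs E" "x \<in> U" by (rule triv_at)
  obtain W S where "x \<in> W" "\<And>w. S w \<in> \<Gamma>" "\<And>w y. y \<in> W \<Longrightarrow> S w y = inv_into (fibre E y) c w"
    by (rule frame_extension[OF c]) (rule that)
  then show ?thesis
    using that[of "S (c e)"] fibre_chart.frame_coord[OF triv_chart[OF c] assms] by simp
qed

section \<open>Operators on sections that are linear over the smooth functions\<close>

definition tensorial :: "(('m \<Rightarrow> 'e) \<Rightarrow> 'm \<Rightarrow> real) \<Rightarrow> bool" where
  "tensorial \<tau> \<longleftrightarrow>
     (\<forall>s\<in>\<Gamma>. \<forall>t\<in>\<Gamma>. \<forall>x. \<tau> (sec_add E s t) x = \<tau> s x + \<tau> t x) \<and>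
     (\<forall>f. smooth_map_on \<A> UNIV f \<longrightarrow> (\<forall>s\<in>\<Gamma>. \<forall>x. \<tau> (sec_scale E f s) x = f x * \<tau> s x))"

text \<open>Sections carry no type-class addition, so the finite linear combination is built by
  induction and described by its coordinates in every trivialisation.\<close>

lemma section_combination:
  assumes \<tau>: "tensorial \<tau>" and "finite B"
    and "\<And>b. b \<in> B \<Longrightarrow> S b \<in> \<Gamma>" "\<And>b. b \<in> B \<Longrightarrow> smooth_map_on \<A> UNIV (f b)"
  shows "\<exists>T\<in>\<Gamma>. (\<forall>U c x. (U, c) \<in> trivs E \<longrightarrow> x \<in> U \<longrightarrow> c (T x) = (\<Sum>b\<in>B. f b x *\<^sub>R c (S b x))) \<and>
    (\<forall>x. \<tau> T x = (\<Sum>b\<in>B. f b x * \<tau> (S b) x))"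
  using assms(2-)
proof (induction B)
  case empty
  have "sec_scale E (\<lambda>_. 0) (vzero E) = vzero E"
  proof
    fix x
    obtain U c where c: "(U, c) \<in> trivs E" "x \<in> U" by (rule triv_at)
    interpret fibre_chart E x c by (rule triv_chart[OF c])
    show "sec_scale E (\<lambda>_. 0) (vzero E) x = vzero E x"
      by (rule coord_inj) (simp_all add: sec_scale_def vscale_in vzero_in coord_scale coord_zero)
  qed
  moreover have "\<tau> (sec_scale E (\<lambda>_. 0) (vzero E)) x = 0 * \<tau> (vzero E) x" for x
    using \<tau> vzero_section smooth_map_on_const unfolding tensorial_def by blast
  ultimately have "\<tau> (vzero E) x = 0" for x by simp
  then show ?case
    using vzero_section fibre_chart.coord_zero[OF triv_chart]
    by (intro bexI[of _ "vzero E"]) auto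
next
  case (insert b B)
  then obtain T where T: "T \<in> \<Gamma>"
    "\<And>U c x. (U, c) \<in> trivs E \<Longrightarrow> x \<in> U \<Longrightarrow> c (T x) = (\<Sum>b\<in>B. f b x *\<^sub>R c (S b x))"
    "\<And>x. \<tau> T x = (\<Sum>b\<in>B. f b x * \<tau> (S b) x)" by auto
  let ?s = "sec_scale E (f b) (S b)" and ?T = "sec_add E (sec_scale E (f b) (S b)) T"
  have s: "?s \<in> \<Gamma>" using insert.prems by (intro sec_scale_section) auto
  have "\<tau> ?T x = f b x * \<tau> (S b) x + \<tau> T x" for x
  proof -
    have "\<tau> ?T x = \<tau> ?s x + \<tau> T x" using \<tau> s T(1) unfolding tensorial_def by blast
    moreover have "\<tau> ?s x = f b x * \<tau> (S b) x" using \<tau> insert.prems unfolding tensorial_def by blast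
    ultimately show ?thesis by simp
  qed
  moreover have "c (?T x) = f b x *\<^sub>R c (S b x) + c (T x)" if c: "(U, c) \<in> trivs E" "x \<in> U" for U c x
  proof -
    interpret fibre_chart E x c by (rule triv_chart[OF c])
    have "S b x \<in> fibre E x" "T x \<in> fibre E x" using section_in T(1) insert.prems by auto
    then show ?thesis by (simp add: sec_add_def sec_scale_def coord_add coord_scale vscale_in)
  qed
  ultimately show ?case
    using insert.hyps T sec_add_section[OF s T(1)] by (intro bexI[of _ ?T]) auto
qed

lemma section_eqI:
  assumes "s \<in> \<Gamma>" "t \<in> \<Gamma>" "(U, c) \<in> trivs E" "x \<in> U" "c (s x) = c (t x)"
  shows "s x = t x"
  using fibre_chart.coord_inj[OF triv_chart[OF assms(3,4)]] section_in assms by blast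

text \<open>If \<open>s\<close> vanishes at \<open>x\<close> and \<open>\<psi>\<close> is a cutoff function with \<open>\<psi> x = 1\<close>, then \<open>\<psi>\<^sup>2 s\<close> is a combination
  of global sections whose coefficients are global functions vanishing at \<open>x\<close>.\<close>

lemma tensorial_zero:
  assumes \<tau>: "tensorial \<tau>" and s: "s \<in> \<Gamma>" "s x = vzero E x"
  shows "\<tau> s x = 0"
proof -
  obtain U c where c: "(U, c) \<in> trivs E" "x \<in> U" by (rule triv_at)
  note U = triv_open[OF c(1)]
  obtain \<psi> C W0 where \<psi>: "smooth_map_on \<A> UNIV \<psi>" "open W0" "x \<in> W0" "W0 \<subseteq> U" "closed C" "C \<subseteq> U"
    "\<And>z. z \<in> W0 \<Longrightarrow> \<psi> z = (1::real)" "\<And>z. z \<notin> C \<Longrightarrow> \<psi> z = 0"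
    by (rule plateau_function[OF U c(2)]) (rule that)
  \<comment> \<open>One factor \<psi> makes the frame global and a second one makes the coefficients
    of s global; this is the origin of the square.\<close>
  define S where "S w = (\<lambda>y. if y \<in> U then inv_into (fibre E y) c (\<psi> y *\<^sub>R w) else vzero E y)" for w
  define f where "f b = (\<lambda>y. if y \<in> U then \<psi> y * (c (s y) \<bullet> b) else 0)" for b
  have S: "S w \<in> \<Gamma>" for w
    unfolding S_def by (rule cutoff_section[OF c(1) \<psi>(1,5,6,8)])
  have f: "smooth_map_on \<A> UNIV (f b)" for b
    unfolding f_def
    by (rule cutoff_function[OF U \<psi>(1,5,6,8) smooth_map_on_inner_const[OF U section_smooth[OF s(1) c(1)]]])
  obtain T where T: "T \<in> \<Gamma>"
    "\<And>U c x. (U, c) \<in> trivs E \<Longrightarrow> x \<in> U \<Longrightarrow> c (T x) = (\<Sum>b\<in>onb. f b x *\<^sub>R c (S b x))"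
    "\<And>x. \<tau> T x = (\<Sum>b\<in>onb. f b x * \<tau> (S b) x)"
    using section_combination[OF \<tau> finite_onb[OF fmodel], of S f] S f by blast
  have \<psi>2: "smooth_map_on \<A> UNIV (\<lambda>y. \<psi> y * \<psi> y)"
    by (intro smooth_map_on_mult \<psi>(1)) simp
  let ?s = "sec_scale E (\<lambda>y. \<psi> y * \<psi> y) s"
  have s': "?s \<in> \<Gamma>" by (rule sec_scale_section[OF \<psi>2 s(1)])
  have "T = ?s"
  proof
    fix y
    show "T y = ?s y"
    proof (cases "y \<in> U")
      case True
      interpret fibre_chart E y c by (rule triv_chart[OF c(1) True])
      have "c (T y) = (\<Sum>b\<in>onb. (\<psi> y * \<psi> y) *\<^sub>R ((c (s y) \<bullet> b) *\<^sub>R b))"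
        using True by (simp add: T(2)[OF c(1) True] f_def S_def mult_ac)
      also have "\<dots> = (\<psi> y * \<psi> y) *\<^sub>R c (s y)"
        by (simp only: onb_expand[OF fmodel] flip: scaleR_sum_right)
      also have "\<dots> = c (?s y)"
        using section_in[OF s(1), of y] by (simp add: sec_scale_def coord_scale)
      finally show ?thesis by (rule section_eqI[OF T(1) s' c(1) True])
    next
      case False
      obtain U' c' where c': "(U', c') \<in> trivs E" "y \<in> U'" by (rule triv_at)
      interpret fibre_chart E y c' by (rule triv_chart[OF c'])
      have "\<psi> y = 0" using False \<psi>(6,8) by blast
      then have "c' (T y) = c' (?s y)"
        using False section_in[OF s(1), of y] by (simp add: T(2)[OF c'] f_def sec_scale_def coord_scale)
      then show ?thesis by (rule section_eqI[OF T(1) s' c'])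
    qed
  qed
  moreover have "\<tau> ?s x = (\<psi> x * \<psi> x) * \<tau> s x"
    using \<tau> \<psi>2 s(1) unfolding tensorial_def by blast
  moreover have "\<tau> T x = 0"
    using c s fibre_chart.coord_zero[OF triv_chart[OF c]] by (simp add: T(3) f_def)
  ultimately show ?thesis using \<psi>(3,7) by simp
qed

text \<open>The section s - t vanishes at x, and \<open>tensorial_zero\<close> applies to it. This
  turns an operator on sections into an object on the single fibre over x.\<close>

lemma tensorial_pointwise:
  assumes \<tau>: "tensorial \<tau>" and s: "s \<in> \<Gamma>" "t \<in> \<Gamma>" "s x = t x"
  shows "\<tau> s x = \<tau> t x"
proof -
  let ?u = "sec_scale E (\<lambda>_. -1) t"
  have u: "?u \<in> \<Gamma>" by (rule sec_scale_section[OF smooth_map_on_const s(2)])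
  obtain U c where c: "(U, c) \<in> trivs E" "x \<in> U" by (rule triv_at)
  interpret fibre_chart E x c by (rule triv_chart[OF c])
  have tx: "t x \<in> fibre E x" by (rule section_in[OF s(2)])
  have "sec_add E s ?u x = vzero E x"
    by (rule coord_inj)
      (simp_all add: sec_add_def sec_scale_def s(3) tx vadd_in vscale_in vzero_in coord_add coord_scale coord_zero)
  then have "\<tau> (sec_add E s ?u) x = 0"
    by (rule tensorial_zero[OF \<tau> sec_add_section[OF s(1) u]])
  moreover have "\<tau> (sec_add E s ?u) x = \<tau> s x + \<tau> ?u x"
    using \<tau> s(1) u unfolding tensorial_def by blast
  moreover have "\<tau> ?u x = -1 * \<tau> t x"
    using \<tau> s(2) smooth_map_on_const unfolding tensorial_def by blast
  ultimately show ?thesis by simp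
qed

section \<open>The dual bundle and its sections\<close>

lemma trivs_dual: "trivs (dual_bundle E) = (\<lambda>(U, c). (U, dual_coord E c)) ` trivs E"
  by (simp add: dual_bundle_def dual_coord_def)

lemma dual_vector_bundle: "vector_bundle \<A> (dual_bundle E)"
proof -
  have dual: "fibre_chart (dual_bundle E) x (dual_coord E c)" if "(U, c) \<in> trivs E" "x \<in> U" for U c x
    using fibre_chart.dual_chart[OF triv_chart[OF that]] .
  have ops: "vzero (dual_bundle E) x \<in> fibre (dual_bundle E) x \<and>
      (\<forall>\<xi>\<in>fibre (dual_bundle E) x. \<forall>\<zeta>\<in>fibre (dual_bundle E) x.
        vadd (dual_bundle E) \<xi> \<zeta> \<in> fibre (dual_bundle E) x) \<and>
      (\<forall>a. \<forall>\<xi>\<in>fibre (dual_bundle E) x. vscale (dual_bundle E) a \<xi> \<in> fibre (dual_bundle E) x)" for x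
  proof -
    obtain U c where "(U, c) \<in> trivs E" "x \<in> U" by (rule triv_at)
    then interpret dual: fibre_chart "dual_bundle E" x "dual_coord E c" by (rule dual)
    show ?thesis using dual.vzero_in dual.vadd_in dual.vscale_in by blast
  qed
  have triv: "open U \<and> (\<forall>x\<in>U. bij_betw (dual_coord E c) (fibre (dual_bundle E) x) UNIV \<and>
      dual_coord E c (vzero (dual_bundle E) x) = 0 \<and>
      (\<forall>\<xi>\<in>fibre (dual_bundle E) x. \<forall>\<zeta>\<in>fibre (dual_bundle E) x.
        dual_coord E c (vadd (dual_bundle E) \<xi> \<zeta>) = dual_coord E c \<xi> + dual_coord E c \<zeta>) \<and>
      (\<forall>a. \<forall>\<xi>\<in>fibre (dual_bundle E) x.
        dual_coord E c (vscale (dual_bundle E) a \<xi>) = a *\<^sub>R dual_coord E c \<xi>))"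
    if c: "(U, c) \<in> trivs E" for U c
  proof (intro conjI ballI allI)
    fix x assume "x \<in> U"
    then interpret dual: fibre_chart "dual_bundle E" x "dual_coord E c" by (rule dual[OF c])
    show "bij_betw (dual_coord E c) (fibre (dual_bundle E) x) UNIV" by (rule dual.bij)
    show "dual_coord E c (vzero (dual_bundle E) x) = 0" by (rule dual.coord_zero)
    show "dual_coord E c (vadd (dual_bundle E) \<xi> \<zeta>) = dual_coord E c \<xi> + dual_coord E c \<zeta>"
      if "\<xi> \<in> fibre (dual_bundle E) x" "\<zeta> \<in> fibre (dual_bundle E) x" for \<xi> \<zeta>
      using that by (rule dual.coord_add)
    show "dual_coord E c (vscale (dual_bundle E) a \<xi>) = a *\<^sub>R dual_coord E c \<xi>"
      if "\<xi> \<in> fibre (dual_bundle E) x" for \<xi> a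
      using that by (rule dual.coord_scale)
  qed (rule triv_open[OF c])
  have trans: "smooth_map_on \<A> (U \<inter> U')
      (\<lambda>x. dual_coord E c' (inv_into (fibre (dual_bundle E) x) (dual_coord E c) w))"
    if c: "(U, c) \<in> trivs E" and c': "(U', c') \<in> trivs E" for U c U' c' w
  proof (rule smooth_map_on_components[OF fmodel])
    show W: "open (U \<inter> U')" using triv_open c c' by blast
    fix b :: 'f
    \<comment> \<open>In inner product coordinates the transition of the dual bundle from c to c' is
      the transpose of the transition of E from c' to c, so its component along b is read off from
      the latter.\<close>
    have "smooth_map_on \<A> (U \<inter> U') (\<lambda>x. c (inv_into (fibre E x) c' b) \<bullet> w)"
      using smooth_map_on_inner_const[OF _ transition_smooth[OF c' c]] W by (simp add: Int_commute)
    then show "smooth_map_on \<A> (U \<inter> U')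
      (\<lambda>x. dual_coord E c' (inv_into (fibre (dual_bundle E) x) (dual_coord E c) w) \<bullet> b)"
    proof (rule smooth_map_on_cong[OF W])
      fix x assume x: "x \<in> U \<inter> U'"
      interpret c: fibre_chart E x c by (rule triv_chart[OF c]) (use x in auto)
      interpret c': fibre_chart E x c' by (rule triv_chart[OF c']) (use x in auto)
      show "c (inv_into (fibre E x) c' b) \<bullet> w
          = dual_coord E c' (inv_into (fibre (dual_bundle E) x) (dual_coord E c) w) \<bullet> b"
        by (simp add: c.inv_dual_coord c'.dual_coord_inner c.coframe_in c.coframe_apply)
          (rule inner_commute)
    qed
  qed
  have cover: "(\<Union>t\<in>trivs (dual_bundle E). fst t) = UNIV"
  proof -
    have "(\<Union>t\<in>trivs E. fst t) = UNIV" using vbundle unfolding vector_bundle_def by (elim conjE)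
    then show ?thesis by (simp add: trivs_dual case_prod_beta)
  qed
  have dual_triv: "\<exists>U c. t = (U, dual_coord E c) \<and> (U, c) \<in> trivs E" if "t \<in> trivs (dual_bundle E)" for t
    using that by (auto simp: trivs_dual)
  show ?thesis
    unfolding vector_bundle_def
  proof (intro conjI)
    show "\<forall>(U, d)\<in>trivs (dual_bundle E). open U \<and> (\<forall>x\<in>U. bij_betw d (fibre (dual_bundle E) x) UNIV \<and>
        d (vzero (dual_bundle E) x) = 0 \<and>
        (\<forall>\<xi>\<in>fibre (dual_bundle E) x. \<forall>\<zeta>\<in>fibre (dual_bundle E) x.
          d (vadd (dual_bundle E) \<xi> \<zeta>) = d \<xi> + d \<zeta>) \<and>
        (\<forall>a. \<forall>\<xi>\<in>fibre (dual_bundle E) x. d (vscale (dual_bundle E) a \<xi>) = a *\<^sub>R d \<xi>))"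
      by (rule ballI, drule dual_triv, elim exE conjE, hypsubst, unfold prod.case, erule triv)
    show "\<forall>(U, d)\<in>trivs (dual_bundle E). \<forall>(U', d')\<in>trivs (dual_bundle E). \<forall>w.
        smooth_map_on \<A> (U \<inter> U') (\<lambda>x. d' (inv_into (fibre (dual_bundle E) x) d w))"
      by (rule ballI, drule dual_triv, elim exE conjE, hypsubst, unfold prod.case,
          rule ballI, drule dual_triv, elim exE conjE, hypsubst, unfold prod.case,
          rule allI, rule trans)
  qed (rule fmodel, rule allI, rule ops, rule cover)
qed

lemma dual_bundle: "smooth_bundle \<A> (dual_bundle E)"
  by unfold_locales (rule dual_vector_bundle)

abbreviation "\<Gamma>' \<equiv> smooth_sections \<A> (dual_bundle E)"

lemma dual_section_in: "\<alpha> \<in> \<Gamma>' \<Longrightarrow> \<alpha> x \<in> fibre (dual_bundle E) x"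
  by (simp add: smooth_sections_def)

lemma dual_section_frame_smooth:
  assumes "\<alpha> \<in> \<Gamma>'" "(U, c) \<in> trivs E"
  shows "smooth_map_on \<A> U (\<lambda>x. snd (\<alpha> x) (inv_into (fibre E x) c w))"
proof (rule smooth_map_on_cong[OF triv_open[OF assms(2)]])
  have "(U, dual_coord E c) \<in> trivs (dual_bundle E)" using assms(2) by (auto simp: trivs_dual)
  then have "smooth_map_on \<A> U (\<lambda>x. dual_coord E c (\<alpha> x))"
    using assms(1) by (auto simp: smooth_sections_def)
  then show "smooth_map_on \<A> U (\<lambda>x. dual_coord E c (\<alpha> x) \<bullet> w)"
    by (rule smooth_map_on_inner_const[OF triv_open[OF assms(2)]])
  show "dual_coord E c (\<alpha> x) \<bullet> w = snd (\<alpha> x) (inv_into (fibre E x) c w)" if "x \<in> U" for x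
    using fibre_chart.dual_coord_inner[OF triv_chart[OF assms(2) that] dual_section_in[OF assms(1)]] .
qed

lemma dual_section_apply_smooth:
  assumes "\<alpha> \<in> \<Gamma>'" "s \<in> \<Gamma>"
  shows "smooth_map_on \<A> UNIV (\<lambda>x. snd (\<alpha> x) (s x))"
proof (rule smooth_map_on_local)
  fix x
  obtain U c where c: "(U, c) \<in> trivs E" "x \<in> U" by (rule triv_at)
  note U = triv_open[OF c(1)]
  have "smooth_map_on \<A> U (\<lambda>x. snd (\<alpha> x) (s x))"
  proof (rule smooth_map_on_cong[OF U])
    show "smooth_map_on \<A> U (\<lambda>x. \<Sum>b\<in>onb. (c (s x) \<bullet> b) * snd (\<alpha> x) (inv_into (fibre E x) c b))"
      by (intro smooth_map_on_sum smooth_map_on_mult smooth_map_on_inner_const U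
          section_smooth[OF assms(2) c(1)] dual_section_frame_smooth[OF assms(1) c(1)])
    fix y assume "y \<in> U"
    then interpret fibre_chart E y c by (rule triv_chart[OF c(1)])
    show "(\<Sum>b\<in>onb. (c (s y) \<bullet> b) * snd (\<alpha> y) (inv_into (fibre E y) c b)) = snd (\<alpha> y) (s y)"
      by (rule linear_frame_expand[symmetric])
        (use dual_add dual_scale dual_section_in[OF assms(1)] section_in[OF assms(2)] in auto)
  qed
  then show "\<exists>W'. open W' \<and> x \<in> W' \<and> smooth_map_on \<A> W' (\<lambda>x. snd (\<alpha> x) (s x))"
    using U c(2) by blast
qed

text \<open>Near each point the coordinates of \<alpha> are its values on frame vectors, and these
  are the values of global sections from \<open>frame_extension\<close>. Smoothness can thus be
  tested on global sections.\<close>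

lemma dual_sectionI:
  assumes \<alpha>: "\<And>x. \<alpha> x \<in> fibre (dual_bundle E) x"
    and sm: "\<And>s. s \<in> \<Gamma> \<Longrightarrow> smooth_map_on \<A> UNIV (\<lambda>x. snd (\<alpha> x) (s x))"
  shows "\<alpha> \<in> \<Gamma>'"
proof (rule smooth_bundle.sectionI[OF dual_bundle \<alpha>])
  fix x
  obtain U c where c: "(U, c) \<in> trivs E" "x \<in> U" by (rule triv_at)
  obtain W S where W: "open W" "x \<in> W" "W \<subseteq> U" and S: "\<And>w. S w \<in> \<Gamma>"
    "\<And>w y. y \<in> W \<Longrightarrow> S w y = inv_into (fibre E y) c w"
    by (rule frame_extension[OF c]) (rule that)
  have "smooth_map_on \<A> W (\<lambda>y. dual_coord E c (\<alpha> y))"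
  proof (rule smooth_map_on_components[OF fmodel W(1)])
    fix b :: 'f
    show "smooth_map_on \<A> W (\<lambda>y. dual_coord E c (\<alpha> y) \<bullet> b)"
    proof (rule smooth_map_on_cong[OF W(1) smooth_map_on_subset[OF sm[OF S(1)[of b]]]])
      fix y assume y: "y \<in> W"
      then show "snd (\<alpha> y) (S b y) = dual_coord E c (\<alpha> y) \<bullet> b"
        using fibre_chart.dual_coord_inner[OF triv_chart[OF c(1)] \<alpha>] W(3) S(2) by auto
    qed simp
  qed
  moreover have "(U, dual_coord E c) \<in> trivs (dual_bundle E)" using c(1) by (auto simp: trivs_dual)
  ultimately show "\<exists>U c W. (U, c) \<in> trivs (dual_bundle E) \<and> open W \<and> x \<in> W \<and> W \<subseteq> U \<and>
      smooth_map_on \<A> W (\<lambda>y. c (\<alpha> y))"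
    using W by blast
qed

lemma dual_section_eqI:
  assumes "\<alpha> \<in> \<Gamma>'" "\<beta> \<in> \<Gamma>'" "\<And>s x. s \<in> \<Gamma> \<Longrightarrow> snd (\<alpha> x) (s x) = snd (\<beta> x) (s x)"
  shows "\<alpha> = \<beta>"
proof
  fix x
  obtain U c where c: "(U, c) \<in> trivs E" "x \<in> U" by (rule triv_at)
  interpret fibre_chart E x c by (rule triv_chart[OF c])
  show "\<alpha> x = \<beta> x"
    by (rule dual_eqI) (use assms dual_section_in section_through in metis)+
qed

section \<open>Smooth forms and their evaluation on global sections\<close>

lemma forms_alt: "\<eta> \<in> forms \<A> E p \<Longrightarrow> \<eta> x \<in> alt_forms E x p"
  by (simp add: forms_def)

lemma map_section_in:
  "set Vs \<subseteq> \<Gamma> \<Longrightarrow> length Vs = p \<Longrightarrow>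
     length (map (\<lambda>V. V x) Vs) = p \<and> set (map (\<lambda>V. V x) Vs) \<subseteq> fibre E x"
  using section_in by auto

lemma form_apply_smooth:
  assumes \<eta>: "\<eta> \<in> forms \<A> E p" and Vs: "length Vs = p" "set Vs \<subseteq> \<Gamma>"
  shows "smooth_map_on \<A> UNIV (form_apply \<eta> Vs)"
proof (rule smooth_map_on_local)
  fix x
  obtain U c where c: "(U, c) \<in> trivs E" "x \<in> U" by (rule triv_at)
  note U = triv_open[OF c(1)]
  have "smooth_map_on \<A> U (form_apply \<eta> Vs)"
  proof (rule smooth_map_on_cong[OF U])
    show "smooth_map_on \<A> U (\<lambda>x. \<Sum>I\<in>idx p. (\<Prod>k<p. c ((Vs ! k) x) \<bullet> I ! k) *
        \<eta> x (map (inv_into (fibre E x) c) I))"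
    proof (intro smooth_map_on_sum smooth_map_on_mult smooth_map_on_prod smooth_map_on_inner_const U)
      show "smooth_map_on \<A> U (\<lambda>x. c ((Vs ! k) x))" if "k \<in> {..<p}" for k
        using that Vs section_smooth[OF _ c(1)] nth_mem by (metis lessThan_iff subsetD)
      show "smooth_map_on \<A> U (\<lambda>x. \<eta> x (map (inv_into (fibre E x) c) I))" if "I \<in> idx p" for I
        using \<eta> c(1) that by (auto simp: forms_def idx_def)
    qed
    fix y assume "y \<in> U"
    then interpret fibre_chart E y c by (rule triv_chart[OF c(1)])
    show "(\<Sum>I\<in>idx p. (\<Prod>k<p. c ((Vs ! k) y) \<bullet> I ! k) * \<eta> y (map F I)) = form_apply \<eta> Vs y"
      using alt_forms_expand[OF forms_alt[OF \<eta>], of "map (\<lambda>V. V y) Vs"]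
        map_section_in[OF Vs(2,1)] Vs(1) by (simp add: form_apply_def)
  qed
  then show "\<exists>W'. open W' \<and> x \<in> W' \<and> smooth_map_on \<A> W' (form_apply \<eta> Vs)"
    using U c(2) by blast
qed

text \<open>Near each point the coefficients in a trivialisation are values on global extensions of
  the frame. Together with \<open>form_apply_smooth\<close> this makes smoothness of a form
  equivalent to smoothness of its values on global sections.\<close>

lemma formsI:
  assumes \<eta>: "\<And>x. \<eta> x \<in> alt_forms E x p"
    and sm: "\<And>Vs. length Vs = p \<Longrightarrow> set Vs \<subseteq> \<Gamma> \<Longrightarrow> smooth_map_on \<A> UNIV (form_apply \<eta> Vs)"
  shows "\<eta> \<in> forms \<A> E p"
proof -
  have "smooth_map_on \<A> U (\<lambda>x. \<eta> x (map (inv_into (fibre E x) c) ws))"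
    if c: "(U, c) \<in> trivs E" and ws: "length ws = p" for U c ws
  proof (rule smooth_map_on_local)
    fix x assume x: "x \<in> U"
    obtain W S where W: "open W" "x \<in> W" "W \<subseteq> U" and S: "\<And>w. S w \<in> \<Gamma>"
      "\<And>w y. y \<in> W \<Longrightarrow> S w y = inv_into (fibre E y) c w"
      by (rule frame_extension[OF c x]) (rule that)
    have "smooth_map_on \<A> W (\<lambda>x. \<eta> x (map (inv_into (fibre E x) c) ws))"
    proof (rule smooth_map_on_cong[OF W(1) smooth_map_on_subset[OF sm[of "map S ws"]]])
      fix y assume y: "y \<in> W"
      have "map (\<lambda>V. V y) (map S ws) = map (inv_into (fibre E y) c) ws"
        using S(2)[OF y] by simp
      then show "form_apply \<eta> (map S ws) y = \<eta> y (map (inv_into (fibre E y) c) ws)"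
        by (simp only: form_apply_def)
    qed (use S(1) ws in auto)
    then show "\<exists>W'. open W' \<and> x \<in> W' \<and> smooth_map_on \<A> W' (\<lambda>x. \<eta> x (map (inv_into (fibre E x) c) ws))"
      using W by blast
  qed
  then show ?thesis using \<eta> by (auto simp: forms_def)
qed

lemma sections_through:
  assumes "set es \<subseteq> fibre E x"
  obtains Vs where "length Vs = length es" "set Vs \<subseteq> \<Gamma>" "map (\<lambda>V. V x) Vs = es"
proof -
  have "\<forall>e\<in>set es. \<exists>s. s \<in> \<Gamma> \<and> s x = e"
    using assms section_through by (metis subsetD)
  then obtain S where "\<And>e. e \<in> set es \<Longrightarrow> S e \<in> \<Gamma> \<and> S e x = e" by metis
  then show ?thesis using that[of "map S es"] by (auto simp: map_idI)
qed

text \<open>Every list of vectors in a fibre is the value of a list of global sections. This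
  uniqueness makes the definite description in \<open>lie_deriv_form\<close> meaningful.\<close>

lemma forms_eqI:
  assumes "\<eta> \<in> forms \<A> E p" "\<theta> \<in> forms \<A> E p"
    and "\<And>Vs x. length Vs = p \<Longrightarrow> set Vs \<subseteq> \<Gamma> \<Longrightarrow> form_apply \<eta> Vs x = form_apply \<theta> Vs x"
  shows "\<eta> = \<theta>"
proof (intro ext)
  fix x es
  show "\<eta> x es = \<theta> x es"
  proof (cases "length es = p \<and> set es \<subseteq> fibre E x")
    case True
    then obtain Vs where "length Vs = length es" "set Vs \<subseteq> \<Gamma>" "map (\<lambda>V. V x) Vs = es"
      using sections_through by blast
    then show ?thesis using assms(3)[of Vs x] True by (simp add: form_apply_def)
  qed (simp add: alt_forms_outside[OF forms_alt[OF assms(1)]] alt_forms_outside[OF forms_alt[OF assms(2)]])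
qed

lemma wedge_form:
  assumes \<alpha>s: "length \<alpha>s = p" "set \<alpha>s \<subseteq> \<Gamma>'"
  shows "(\<lambda>x. wedge_covectors E x (map (\<lambda>\<alpha>. \<alpha> x) \<alpha>s)) \<in> forms \<A> E p"
proof (rule formsI)
  fix x
  obtain U c where c: "(U, c) \<in> trivs E" "x \<in> U" by (rule triv_at)
  interpret fibre_chart E x c by (rule triv_chart[OF c])
  show "wedge_covectors E x (map (\<lambda>\<alpha>. \<alpha> x) \<alpha>s) \<in> alt_forms E x p"
    by (rule wedge_covectors_alt) (use \<alpha>s dual_section_in in auto)
next
  fix Vs assume Vs: "length Vs = p" "set Vs \<subseteq> \<Gamma>"
  have "smooth_map_on \<A> UNIV (\<lambda>x. pdet p (\<lambda>i j. snd ((\<alpha>s ! i) x) ((Vs ! j) x)))"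
    unfolding pdet_def
  proof (intro smooth_map_on_sum smooth_map_on_mult smooth_map_on_prod smooth_map_on_const
      dual_section_apply_smooth open_UNIV)
    fix \<sigma> i assume \<sigma>: "\<sigma> \<in> {\<sigma>. \<sigma> permutes {..<p}}" "i \<in> {..<p}"
    then have "\<sigma> i < p" using permutes_in_image[of \<sigma> "{..<p}" i] by simp
    then show "\<alpha>s ! i \<in> \<Gamma>'" "Vs ! \<sigma> i \<in> \<Gamma>" using \<sigma>(2) \<alpha>s Vs nth_mem by auto
  qed
  moreover have "form_apply (\<lambda>x. wedge_covectors E x (map (\<lambda>\<alpha>. \<alpha> x) \<alpha>s)) Vs x
      = pdet p (\<lambda>i j. snd ((\<alpha>s ! i) x) ((Vs ! j) x))" for x
  proof -
    have "pdet p (\<lambda>i j. snd ((\<alpha>s ! i) x) ((Vs ! j) x))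
        = pdet p (\<lambda>i j. snd (map (\<lambda>\<alpha>. \<alpha> x) \<alpha>s ! i) (map (\<lambda>V. V x) Vs ! j))"
      by (rule pdet_cong) (use \<alpha>s Vs in simp)
    then show ?thesis
      using map_section_in[OF Vs(2,1), of x] \<alpha>s Vs
      by (simp add: form_apply_def wedge_covectors_def det_pairing_pdet)
  qed
  ultimately show "smooth_map_on \<A> UNIV (form_apply (\<lambda>x. wedge_covectors E x (map (\<lambda>\<alpha>. \<alpha> x) \<alpha>s)) Vs)"
    by (rule smooth_map_on_cong[OF open_UNIV _ sym])
qed

end

section \<open>Derivations of vector bundles\<close>

text \<open>\<open>X_local\<close> is imposed for arbitrary functions, because it is applied to
  \<open>pairing E p \<eta> P\<close> to replace it by its local formula before its smoothness is
  known.\<close>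

locale function_derivation = smooth_mfd \<A>
  for \<A> :: "('m::{t2_space, second_countable_topology}, 'b::real_inner) chart set" +
  fixes X :: "('m \<Rightarrow> real) \<Rightarrow> 'm \<Rightarrow> real"
  assumes X_smooth: "smooth_map_on \<A> UNIV f \<Longrightarrow> smooth_map_on \<A> UNIV (X f)"
    and X_add: "smooth_map_on \<A> UNIV f \<Longrightarrow> smooth_map_on \<A> UNIV g \<Longrightarrow>
      X (\<lambda>x. f x + g x) x = X f x + X g x"
    and X_mult: "smooth_map_on \<A> UNIV f \<Longrightarrow> smooth_map_on \<A> UNIV g \<Longrightarrow>
      X (\<lambda>x. f x * g x) x = f x * X g x + X f x * g x"
    and X_const: "X (\<lambda>_. a) x = 0"
    and X_local: "open W \<Longrightarrow> x \<in> W \<Longrightarrow> (\<And>y. y \<in> W \<Longrightarrow> f y = g y) \<Longrightarrow> X f x = X g x"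
begin

lemma X_cmult: "smooth_map_on \<A> UNIV f \<Longrightarrow> X (\<lambda>x. a * f x) x = a * X f x"
  using X_mult[OF smooth_map_on_const] by (simp add: X_const)

lemma X_sum:
  assumes "\<And>i. i \<in> I \<Longrightarrow> smooth_map_on \<A> UNIV (f i)"
  shows "X (\<lambda>x. \<Sum>i\<in>I. f i x) x = (\<Sum>i\<in>I. X (f i) x)"
  using assms
  by (induction I rule: infinite_finite_induct)
    (simp_all add: X_const X_add smooth_map_on_sum)

end

context smooth_bundle
begin

lemma form_apply_add:
  assumes "\<eta> \<in> forms \<A> E p" "length Vs = p" "set Vs \<subseteq> \<Gamma>" "i < p" "s \<in> \<Gamma>" "t \<in> \<Gamma>"
  shows "form_apply \<eta> (Vs[i := sec_add E s t]) x = form_apply \<eta> (Vs[i := s]) x + form_apply \<eta> (Vs[i := t]) x"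
  unfolding form_apply_def map_update sec_add_def
  by (rule alt_forms_add[OF forms_alt[OF assms(1)]])
    (use assms map_section_in[OF assms(3,2), of x] section_in in auto)

lemma form_apply_scale:
  assumes "\<eta> \<in> forms \<A> E p" "length Vs = p" "set Vs \<subseteq> \<Gamma>" "i < p" "s \<in> \<Gamma>"
  shows "form_apply \<eta> (Vs[i := sec_scale E f s]) x = f x * form_apply \<eta> (Vs[i := s]) x"
  unfolding form_apply_def map_update sec_scale_def
  by (rule alt_forms_scale[OF forms_alt[OF assms(1)]])
    (use assms map_section_in[OF assms(3,2), of x] section_in in auto)

lemma form_apply_swap:
  assumes "\<eta> \<in> forms \<A> E p" "length Vs = p" "set Vs \<subseteq> \<Gamma>" "i < p" "j < p" "i \<noteq> j"
  shows "form_apply \<eta> (Vs[i := Vs ! j, j := Vs ! i]) x = - form_apply \<eta> Vs x"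
proof -
  have "form_apply \<eta> (Vs[i := Vs ! j, j := Vs ! i]) x
      = \<eta> x ((map (\<lambda>V. V x) Vs)[i := map (\<lambda>V. V x) Vs ! j, j := map (\<lambda>V. V x) Vs ! i])"
    using assms(2,4,5) by (simp add: form_apply_def map_update)
  also have "\<dots> = - \<eta> x (map (\<lambda>V. V x) Vs)"
    by (rule alt_forms_swap[OF forms_alt[OF assms(1)]])
      (use assms map_section_in[OF assms(3,2), of x] in auto)
  finally show ?thesis by (simp add: form_apply_def)
qed

lemma update_sections: "set Vs \<subseteq> \<Gamma> \<Longrightarrow> s \<in> \<Gamma> \<Longrightarrow> set (Vs[i := s]) \<subseteq> \<Gamma>"
  using set_update_subset_insert[of Vs i s] by auto

lemma forms_lincomb:
  assumes "\<eta> \<in> forms \<A> E p" "\<theta> \<in> forms \<A> E p"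
  shows "(\<lambda>x es. a * \<eta> x es + b * \<theta> x es) \<in> forms \<A> E p"
proof (rule formsI)
  show "(\<lambda>es. a * \<eta> x es + b * \<theta> x es) \<in> alt_forms E x p" for x
    by (intro alt_forms_lincomb forms_alt assms)
  fix Vs assume Vs: "length Vs = p" "set Vs \<subseteq> \<Gamma>"
  have "smooth_map_on \<A> UNIV (\<lambda>x. a * form_apply \<eta> Vs x + b * form_apply \<theta> Vs x)"
    by (intro smooth_map_on_add smooth_map_on_mult smooth_map_on_const form_apply_smooth[OF _ Vs] assms open_UNIV)
  then show "smooth_map_on \<A> UNIV (form_apply (\<lambda>x es. a * \<eta> x es + b * \<theta> x es) Vs)"
    by (simp add: form_apply_def[abs_def])
qed

lemma section_at:
  assumes "e \<in> fibre E x"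
  shows "(SOME s. s \<in> \<Gamma> \<and> s x = e) \<in> \<Gamma>" "(SOME s. s \<in> \<Gamma> \<and> s x = e) x = e"
proof -
  have "\<exists>s. s \<in> \<Gamma> \<and> s x = e" using section_through[OF assms] by metis
  from someI_ex[OF this] show "(SOME s. s \<in> \<Gamma> \<and> s x = e) \<in> \<Gamma>" "(SOME s. s \<in> \<Gamma> \<and> s x = e) x = e"
    by blast+
qed

text \<open>The covector at x sends e to the value of the operator on any section through e;
  \<open>tensorial_pointwise\<close> makes this independent of the chosen section, and linearity is
  inherited from sections.\<close>

lemma dual_section_of_tensorial:
  assumes \<tau>: "tensorial \<tau>" and sm: "\<And>s. s \<in> \<Gamma> \<Longrightarrow> smooth_map_on \<A> UNIV (\<tau> s)"
  shows "\<exists>\<beta>. \<beta> \<in> \<Gamma>' \<and> (\<forall>s\<in>\<Gamma>. \<forall>x. snd (\<beta> x) (s x) = \<tau> s x)"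
proof -
  define \<beta> where "\<beta> x = (x, \<lambda>e. if e \<in> fibre E x then \<tau> (SOME s. s \<in> \<Gamma> \<and> s x = e) x else 0)" for x
  have eq: "snd (\<beta> x) (s x) = \<tau> s x" if s: "s \<in> \<Gamma>" for s x
    using tensorial_pointwise[OF \<tau> section_at(1)[OF section_in[OF s]] s section_at(2)[OF section_in[OF s]]]
      section_in[OF s, of x] by (simp add: \<beta>_def)
  have add: "snd (\<beta> x) (vadd E e e') = snd (\<beta> x) e + snd (\<beta> x) e'"
    if e: "e \<in> fibre E x" "e' \<in> fibre E x" for x e e'
  proof -
    obtain s where s: "s \<in> \<Gamma>" "s x = e" by (rule section_through[OF e(1)])
    obtain t where t: "t \<in> \<Gamma>" "t x = e'" by (rule section_through[OF e(2)])
    have "\<tau> (sec_add E s t) x = \<tau> s x + \<tau> t x" using \<tau> s(1) t(1) unfolding tensorial_def by blast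
    then show ?thesis
      using eq[OF sec_add_section[OF s(1) t(1)], of x] eq[OF s(1), of x] eq[OF t(1), of x] s(2) t(2)
      by (simp add: sec_add_def)
  qed
  have scale: "snd (\<beta> x) (vscale E a e) = a * snd (\<beta> x) e" if e: "e \<in> fibre E x" for x e a
  proof -
    obtain s where s: "s \<in> \<Gamma>" "s x = e" by (rule section_through[OF e])
    have "\<tau> (sec_scale E (\<lambda>_. a) s) x = a * \<tau> s x"
      using \<tau> s(1) smooth_map_on_const unfolding tensorial_def by blast
    then show ?thesis
      using eq[OF sec_scale_section[OF smooth_map_on_const s(1)], of x a] eq[OF s(1), of x] s(2)
      by (simp add: sec_scale_def)
  qed
  have "\<beta> \<in> \<Gamma>'"
  proof (rule dual_sectionI)
    have "fst (\<beta> x) = x" "e \<notin> fibre E x \<Longrightarrow> snd (\<beta> x) e = 0" for x e by (simp_all add: \<beta>_def)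
    then show "\<beta> x \<in> fibre (dual_bundle E) x" for x
      using add scale unfolding fibre_dual dual_space_def by blast
    show "smooth_map_on \<A> UNIV (\<lambda>x. snd (\<beta> x) (s x))" if "s \<in> \<Gamma>" for s
      by (rule smooth_map_on_cong[OF open_UNIV sm[OF that]]) (simp add: eq[OF that])
  qed
  then show ?thesis using eq by blast
qed

end

locale bundle_derivation = smooth_bundle \<A> E + function_derivation \<A> X
  for \<A> :: "('m::{t2_space, second_countable_topology}, 'b::real_inner) chart set"
    and E :: "('m, 'e, 'f::real_inner) vbundle"
    and X :: "('m \<Rightarrow> real) \<Rightarrow> 'm \<Rightarrow> real" +
  fixes D :: "('m \<Rightarrow> 'e) \<Rightarrow> 'm \<Rightarrow> 'e"
  assumes D_section: "s \<in> \<Gamma> \<Longrightarrow> D s \<in> \<Gamma>"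
    and D_add: "s \<in> \<Gamma> \<Longrightarrow> t \<in> \<Gamma> \<Longrightarrow> D (sec_add E s t) = sec_add E (D s) (D t)"
    and D_scale: "smooth_map_on \<A> UNIV f \<Longrightarrow> s \<in> \<Gamma> \<Longrightarrow>
      D (sec_scale E f s) = sec_add E (sec_scale E f (D s)) (sec_scale E (X f) s)"
begin

definition lift_on :: "nat \<Rightarrow> ('m \<Rightarrow> 'e list \<Rightarrow> real) \<Rightarrow> ('m \<Rightarrow> 'e) list \<Rightarrow> 'm \<Rightarrow> real" where
  "lift_on p \<eta> Vs x = X (form_apply \<eta> Vs) x - (\<Sum>i<p. form_apply \<eta> (Vs[i := D (Vs ! i)]) x)"

lemma lift_on_smooth:
  assumes "\<eta> \<in> forms \<A> E p" "length Vs = p" "set Vs \<subseteq> \<Gamma>"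
  shows "smooth_map_on \<A> UNIV (lift_on p \<eta> Vs)"
  unfolding lift_on_def[abs_def]
proof (intro smooth_map_on_diff smooth_map_on_sum open_UNIV X_smooth form_apply_smooth[OF assms(1)] assms)
  show "length (Vs[i := D (Vs ! i)]) = p" for i using assms by simp
  show "set (Vs[i := D (Vs ! i)]) \<subseteq> \<Gamma>" if "i \<in> {..<p}" for i
    by (rule update_sections[OF assms(3) D_section]) (use assms that nth_mem in auto)
qed

text \<open>Replacing s by f s in slot i produces the extra term (X f) \<eta>(..., s, ...) twice:
  once from the product rule for X and once from D(f s). The two occur with opposite signs. This
  cancellation is why the expression is linear over the smooth functions although neither X nor D
  is.\<close>

lemma lift_on_slot_tensorial:
  assumes \<eta>: "\<eta> \<in> forms \<A> E p" and Vs: "length Vs = p" "set Vs \<subseteq> \<Gamma>" and i: "i < p"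
  shows "tensorial (\<lambda>s. lift_on p \<eta> (Vs[i := s]))"
proof -
  let ?fa = "form_apply \<eta>"
  \<comment> \<open>R collects the terms in which D acts on a slot other than i; they are linear
    over the smooth functions in slot i, so only the remaining two terms need care.\<close>
  define R where "R s x = (\<Sum>j\<in>{..<p} - {i}. ?fa (Vs[j := D (Vs ! j), i := s]) x)" for s x
  have lift: "lift_on p \<eta> (Vs[i := s]) x = X (?fa (Vs[i := s])) x - (?fa (Vs[i := D s]) x + R s x)" for s x
  proof -
    have "(\<Sum>j<p. ?fa ((Vs[i := s])[j := D (Vs[i := s] ! j)]) x)
        = ?fa ((Vs[i := s])[i := D (Vs[i := s] ! i)]) x
          + (\<Sum>j\<in>{..<p} - {i}. ?fa ((Vs[i := s])[j := D (Vs[i := s] ! j)]) x)"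
      using i by (intro sum.remove) auto
    also have "(\<Sum>j\<in>{..<p} - {i}. ?fa ((Vs[i := s])[j := D (Vs[i := s] ! j)]) x) = R s x"
      unfolding R_def by (intro sum.cong refl) (use list_update_swap[of i _ Vs] in auto)
    finally show ?thesis using i Vs by (simp add: lift_on_def)
  qed
  have Vj: "set (Vs[j := D (Vs ! j)]) \<subseteq> \<Gamma>" if "j < p" for j
    by (rule update_sections[OF Vs(2) D_section]) (use Vs that nth_mem in auto)
  have Rj: "length (Vs[j := D (Vs ! j)]) = p" for j using Vs by simp
  have R_add: "R (sec_add E s t) x = R s x + R t x" if "s \<in> \<Gamma>" "t \<in> \<Gamma>" for s t x
    unfolding R_def sum.distrib[symmetric]
    by (intro sum.cong refl form_apply_add[OF \<eta> Rj Vj i that]) auto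
  have R_scale: "R (sec_scale E f s) x = f x * R s x" if "s \<in> \<Gamma>" for f s x
    unfolding R_def sum_distrib_left
    by (intro sum.cong refl form_apply_scale[OF \<eta> Rj Vj i that]) auto
  have smooth: "smooth_map_on \<A> UNIV (?fa (Vs[i := s]))" if "s \<in> \<Gamma>" for s
    by (rule form_apply_smooth[OF \<eta>]) (use Vs update_sections[OF Vs(2) that] in auto)
  have "lift_on p \<eta> (Vs[i := sec_add E s t]) x
      = lift_on p \<eta> (Vs[i := s]) x + lift_on p \<eta> (Vs[i := t]) x"
    if st: "s \<in> \<Gamma>" "t \<in> \<Gamma>" for s t x
  proof -
    have "?fa (Vs[i := sec_add E s t]) = (\<lambda>x. ?fa (Vs[i := s]) x + ?fa (Vs[i := t]) x)"
      using form_apply_add[OF \<eta> Vs i st] by blast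
    then have "X (?fa (Vs[i := sec_add E s t])) x = X (?fa (Vs[i := s])) x + X (?fa (Vs[i := t])) x"
      using X_add[OF smooth[OF st(1)] smooth[OF st(2)]] by simp
    moreover have "?fa (Vs[i := D (sec_add E s t)]) x = ?fa (Vs[i := D s]) x + ?fa (Vs[i := D t]) x"
      using form_apply_add[OF \<eta> Vs i D_section[OF st(1)] D_section[OF st(2)]] by (simp add: D_add st)
    ultimately show ?thesis by (simp add: lift R_add[OF st])
  qed
  moreover have "lift_on p \<eta> (Vs[i := sec_scale E f s]) x = f x * lift_on p \<eta> (Vs[i := s]) x"
    if f: "smooth_map_on \<A> UNIV f" and s: "s \<in> \<Gamma>" for f s x
  proof -
    have "?fa (Vs[i := sec_scale E f s]) = (\<lambda>x. f x * ?fa (Vs[i := s]) x)"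
      using form_apply_scale[OF \<eta> Vs i s] by blast
    then have "X (?fa (Vs[i := sec_scale E f s])) x = f x * X (?fa (Vs[i := s])) x + X f x * ?fa (Vs[i := s]) x"
      using X_mult[OF f smooth[OF s]] by simp
    moreover have "?fa (Vs[i := D (sec_scale E f s)]) x
        = f x * ?fa (Vs[i := D s]) x + X f x * ?fa (Vs[i := s]) x"
      using form_apply_add[OF \<eta> Vs i sec_scale_section[OF f D_section[OF s]] sec_scale_section[OF X_smooth[OF f] s]]
        form_apply_scale[OF \<eta> Vs i D_section[OF s]] form_apply_scale[OF \<eta> Vs i s]
      by (simp add: D_scale f s)
    ultimately show ?thesis by (simp add: lift R_scale[OF s] algebra_simps)
  qed
  ultimately show ?thesis unfolding tensorial_def by blast
qed

text \<open>The sections of Vs are exchanged for those of Ws one slot at a time, each exchange by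
  tensoriality in that slot.\<close>

lemma lift_on_pointwise:
  assumes \<eta>: "\<eta> \<in> forms \<A> E p" and Vs: "length Vs = p" "set Vs \<subseteq> \<Gamma>"
    and Ws: "length Ws = p" "set Ws \<subseteq> \<Gamma>" and eq: "map (\<lambda>V. V x) Vs = map (\<lambda>V. V x) Ws"
  shows "lift_on p \<eta> Vs x = lift_on p \<eta> Ws x"
proof -
  have "lift_on p \<eta> (take n Ws @ drop n Vs) x = lift_on p \<eta> Vs x" if "n \<le> p" for n
    using that
  proof (induction n)
    case (Suc n)
    let ?L = "take n Ws @ drop n Vs"
    have n: "n < p" using Suc.prems by simp
    have L: "length ?L = p" "set ?L \<subseteq> \<Gamma>"
      using n Vs Ws by (auto dest: in_set_takeD in_set_dropD)
    have "?L ! n = Vs ! n" using n Vs Ws by (simp add: nth_append)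
    then have L1: "?L[n := Vs ! n] = ?L" by (metis list_update_id)
    have L2: "?L[n := Ws ! n] = take (Suc n) Ws @ drop (Suc n) Vs"
      using n Vs Ws by (simp add: list_update_append take_Suc_conv_app_nth flip: Cons_nth_drop_Suc)
    have "(Vs ! n) x = (Ws ! n) x"
      using arg_cong[OF eq, of "\<lambda>l. l ! n"] n Vs Ws by simp
    then have "lift_on p \<eta> (?L[n := Vs ! n]) x = lift_on p \<eta> (?L[n := Ws ! n]) x"
      by (intro tensorial_pointwise[OF lift_on_slot_tensorial[OF \<eta> L n]]) (use n Vs Ws nth_mem in auto)
    then show ?case using Suc n by (simp add: L1 L2)
  qed simp
  from this[of p] show ?thesis using Vs Ws by simp
qed

lemma lift_on_swap:
  assumes \<eta>: "\<eta> \<in> forms \<A> E p" and Vs: "length Vs = p" "set Vs \<subseteq> \<Gamma>"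
    and ij: "i < p" "j < p" "i \<noteq> j"
  shows "lift_on p \<eta> (Vs[i := Vs ! j, j := Vs ! i]) x = - lift_on p \<eta> Vs x"
proof -
  let ?fa = "form_apply \<eta>" and ?t = "Transposition.transpose i j"
  define sw where "sw L = L[i := L ! j, j := L ! i]" for L :: "('m \<Rightarrow> 'e) list"
  have fa_sw: "?fa (sw L) x = - ?fa L x" if "length L = p" "set L \<subseteq> \<Gamma>" for L x
    unfolding sw_def by (rule form_apply_swap[OF \<eta> that ij])
  have t: "?t permutes {..<p}" using ij by (simp add: permutes_swap_id)
  \<comment> \<open>Applying D in slot k after the exchange is the same as applying it in slot
    \<open>?t k\<close> before, so the exchange only permutes the summands and changes their
    signs.\<close>
  have upd: "(sw Vs)[k := D (sw Vs ! k)] = sw (Vs[?t k := D (Vs ! ?t k)])" if k: "k < p" for k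
    by (rule nth_equalityI)
      (use k ij Vs in \<open>auto simp: sw_def nth_list_update Transposition.transpose_def\<close>)
  have "?fa (sw Vs) = (\<lambda>x. -1 * ?fa Vs x)" using fa_sw[OF Vs] by auto
  then have X: "X (?fa (sw Vs)) x = - X (?fa Vs) x"
    using X_cmult[OF form_apply_smooth[OF \<eta> Vs], of "-1"] by simp
  have "(\<Sum>k<p. ?fa ((sw Vs)[k := D (sw Vs ! k)]) x) = (\<Sum>k<p. - ?fa (Vs[?t k := D (Vs ! ?t k)]) x)"
  proof (intro sum.cong refl)
    fix k assume "k \<in> {..<p}"
    then have k: "k < p" and "?t k < p" using permutes_in_image[OF t, of k] by auto
    then have "D (Vs ! ?t k) \<in> \<Gamma>" using Vs nth_mem by (intro D_section) blast
    then show "?fa ((sw Vs)[k := D (sw Vs ! k)]) x = - ?fa (Vs[?t k := D (Vs ! ?t k)]) x"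
      using fa_sw[of "Vs[?t k := D (Vs ! ?t k)]" x] upd[OF k] Vs update_sections by simp
  qed
  also have "\<dots> = - (\<Sum>k<p. ?fa (Vs[k := D (Vs ! k)]) x)"
    using sum.permute[OF t, of "\<lambda>k. ?fa (Vs[k := D (Vs ! k)]) x"] by (simp add: sum_negf o_def)
  finally show ?thesis using X by (simp add: lift_on_def sw_def)
qed

text \<open>The vectors at x are extended to arbitrarily chosen global sections; by
  \<open>lift_on_pointwise\<close> the choice does not matter. The value 0 elsewhere is the
  convention of \<open>alt_forms\<close>.\<close>

definition lift_form :: "nat \<Rightarrow> ('m \<Rightarrow> 'e list \<Rightarrow> real) \<Rightarrow> 'm \<Rightarrow> 'e list \<Rightarrow> real" where
  "lift_form p \<eta> x es =
     (if length es = p \<and> set es \<subseteq> fibre E x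
      then lift_on p \<eta> (map (\<lambda>e. SOME s. s \<in> \<Gamma> \<and> s x = e) es) x else 0)"

lemma lift_form_apply:
  assumes \<eta>: "\<eta> \<in> forms \<A> E p" and Vs: "length Vs = p" "set Vs \<subseteq> \<Gamma>"
  shows "form_apply (lift_form p \<eta>) Vs x = lift_on p \<eta> Vs x"
proof -
  let ?Ws = "map (\<lambda>e. SOME s. s \<in> \<Gamma> \<and> s x = e) (map (\<lambda>V. V x) Vs)"
  note in_fib = map_section_in[OF Vs(2,1), of x]
  have "set ?Ws \<subseteq> \<Gamma>" using section_at(1) in_fib by auto
  moreover have "map (\<lambda>V. V x) ?Ws = map (\<lambda>V. V x) Vs"
    using section_at(2) in_fib by (auto simp: subset_iff)
  ultimately have "lift_on p \<eta> ?Ws x = lift_on p \<eta> Vs x"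
    by (intro lift_on_pointwise[OF \<eta>]) (use Vs in auto)
  then show ?thesis using in_fib by (simp add: form_apply_def lift_form_def del: map_map)
qed

lemma lift_form_in:
  assumes \<eta>: "\<eta> \<in> forms \<A> E p"
  shows "lift_form p \<eta> \<in> forms \<A> E p"
proof (rule formsI)
  fix x
  have eval: "lift_form p \<eta> x (map (\<lambda>V. V x) Vs) = lift_on p \<eta> Vs x"
    if "length Vs = p" "set Vs \<subseteq> \<Gamma>" for Vs
    using lift_form_apply[OF \<eta> that, of x] by (simp add: form_apply_def)
  show "lift_form p \<eta> x \<in> alt_forms E x p"
  proof (rule alt_formsI)
    fix es i e
    assume es: "length es = p" "set es \<subseteq> fibre E x" and i: "i < p" and e: "e \<in> fibre E x"
    obtain Vs where Vs': "length Vs = length es" "set Vs \<subseteq> \<Gamma>" "map (\<lambda>V. V x) Vs = es"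
      by (rule sections_through[OF es(2)])
    then have Vs: "length Vs = p" "set Vs \<subseteq> \<Gamma>" using es by auto
    obtain s where s: "s \<in> \<Gamma>" "s x = e" by (rule section_through[OF e])
    have ev: "lift_form p \<eta> x (es[i := t x]) = lift_on p \<eta> (Vs[i := t]) x" if "t \<in> \<Gamma>" for t
      using eval[of "Vs[i := t]"] Vs update_sections[OF Vs(2) that] by (simp add: map_update Vs'(3))
    note tens = lift_on_slot_tensorial[OF \<eta> Vs i]
    show "lift_form p \<eta> x (es[i := vadd E e e']) = lift_form p \<eta> x (es[i := e]) + lift_form p \<eta> x (es[i := e'])"
      if e': "e' \<in> fibre E x" for e'
    proof -
      obtain t where t: "t \<in> \<Gamma>" "t x = e'" by (rule section_through[OF e'])
      have "lift_on p \<eta> (Vs[i := sec_add E s t]) x = lift_on p \<eta> (Vs[i := s]) x + lift_on p \<eta> (Vs[i := t]) x"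
        using tens s(1) t(1) unfolding tensorial_def by blast
      then show ?thesis
        using ev[OF sec_add_section[OF s(1) t(1)]] ev[OF s(1)] ev[OF t(1)] s(2) t(2)
        by (simp add: sec_add_def)
    qed
    show "lift_form p \<eta> x (es[i := vscale E a e]) = a * lift_form p \<eta> x (es[i := e])" for a
    proof -
      have "lift_on p \<eta> (Vs[i := sec_scale E (\<lambda>_. a) s]) x = a * lift_on p \<eta> (Vs[i := s]) x"
        using tens s(1) smooth_map_on_const unfolding tensorial_def by blast
      then show ?thesis
        using ev[OF sec_scale_section[OF smooth_map_on_const s(1)], of a] ev[OF s(1)] s(2)
        by (simp add: sec_scale_def)
    qed
  next
    fix es i j
    assume es: "length es = p" "set es \<subseteq> fibre E x" and ij: "i < p" "j < p" "i \<noteq> j"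
    obtain Vs where Vs': "length Vs = length es" "set Vs \<subseteq> \<Gamma>" "map (\<lambda>V. V x) Vs = es"
      by (rule sections_through[OF es(2)])
    then have Vs: "length Vs = p" "set Vs \<subseteq> \<Gamma>" using es by auto
    have sw: "set (Vs[i := Vs ! j, j := Vs ! i]) \<subseteq> \<Gamma>" using Vs ij by (simp add: set_swap)
    have "map (\<lambda>V. V x) (Vs[i := Vs ! j, j := Vs ! i]) = es[i := es ! j, j := es ! i]"
      using Vs ij Vs'(3) by (auto simp: map_update)
    then show "lift_form p \<eta> x (es[i := es ! j, j := es ! i]) = - lift_form p \<eta> x es"
      using eval[OF _ sw] eval[OF Vs] lift_on_swap[OF \<eta> Vs ij, of x] Vs Vs'(3) by simp
  qed (auto simp: lift_form_def)
next
  fix Vs assume Vs: "length Vs = p" "set Vs \<subseteq> \<Gamma>"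
  show "smooth_map_on \<A> UNIV (form_apply (lift_form p \<eta>) Vs)"
    by (rule smooth_map_on_cong[OF open_UNIV lift_on_smooth[OF \<eta> Vs]]) (simp add: lift_form_apply[OF \<eta> Vs])
qed

lemma lift_form_lincomb:
  assumes "\<eta> \<in> forms \<A> E p" "\<theta> \<in> forms \<A> E p"
  shows "lift_form p (\<lambda>x es. a * \<eta> x es + b * \<theta> x es)
    = (\<lambda>x es. a * lift_form p \<eta> x es + b * lift_form p \<theta> x es)"
proof (rule forms_eqI)
  let ?\<zeta> = "\<lambda>x es. a * \<eta> x es + b * \<theta> x es"
  have \<zeta>: "?\<zeta> \<in> forms \<A> E p" by (rule forms_lincomb[OF assms])
  then show "lift_form p ?\<zeta> \<in> forms \<A> E p" by (rule lift_form_in)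
  show "(\<lambda>x es. a * lift_form p \<eta> x es + b * lift_form p \<theta> x es) \<in> forms \<A> E p"
    by (intro forms_lincomb lift_form_in assms)
  fix Vs x assume Vs: "length Vs = p" "set Vs \<subseteq> \<Gamma>"
  have fa: "form_apply ?\<zeta> Ws = (\<lambda>x. a * form_apply \<eta> Ws x + b * form_apply \<theta> Ws x)" for Ws
    by (simp add: form_apply_def[abs_def])
  have cm: "smooth_map_on \<A> UNIV (\<lambda>x. r * form_apply \<omega> Vs x)" if "\<omega> \<in> forms \<A> E p" for \<omega> r
    by (intro smooth_map_on_mult smooth_map_on_const form_apply_smooth[OF _ Vs] that open_UNIV)
  have X: "X (\<lambda>x. a * form_apply \<eta> Vs x + b * form_apply \<theta> Vs x) x
      = a * X (form_apply \<eta> Vs) x + b * X (form_apply \<theta> Vs) x"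
    using X_add[OF cm[OF assms(1)] cm[OF assms(2)]] X_cmult form_apply_smooth[OF _ Vs] assms by simp
  have "form_apply (lift_form p ?\<zeta>) Vs x = a * lift_on p \<eta> Vs x + b * lift_on p \<theta> Vs x"
    unfolding lift_form_apply[OF \<zeta> Vs] lift_on_def fa X
    by (simp add: sum.distrib sum_distrib_left algebra_simps)
  also have "\<dots> = form_apply (\<lambda>x es. a * lift_form p \<eta> x es + b * lift_form p \<theta> x es) Vs x"
    using lift_form_apply[OF assms(1) Vs, of x] lift_form_apply[OF assms(2) Vs, of x]
    by (simp add: form_apply_def)
  finally show "form_apply (lift_form p ?\<zeta>) Vs x
      = form_apply (\<lambda>x es. a * lift_form p \<eta> x es + b * lift_form p \<theta> x es) Vs x" .
qed

text \<open>This is the case p = 1 of the lift, carried out for covectors because sections of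
  \<open>dual_bundle\<close> are encoded as pairs and not as forms on one-element lists. The terms
  with X f again cancel.\<close>

lemma dual_derivation_exists:
  assumes \<alpha>: "\<alpha> \<in> \<Gamma>'"
  shows "\<exists>\<beta>. \<beta> \<in> \<Gamma>' \<and> (\<forall>s\<in>\<Gamma>. \<forall>x. snd (\<beta> x) (s x) = X (\<lambda>y. snd (\<alpha> y) (s y)) x - snd (\<alpha> x) (D s x))"
proof (rule dual_section_of_tensorial)
  have \<alpha>_add: "snd (\<alpha> y) (sec_add E s t y) = snd (\<alpha> y) (s y) + snd (\<alpha> y) (t y)"
    if "s \<in> \<Gamma>" "t \<in> \<Gamma>" for s t y
    using dual_section_in[OF \<alpha>, of y] section_in that by (simp add: sec_add_def fibre_dual dual_space_def)
  have \<alpha>_scale: "snd (\<alpha> y) (sec_scale E f s y) = f y * snd (\<alpha> y) (s y)" if "s \<in> \<Gamma>" for f s y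
    using dual_section_in[OF \<alpha>, of y] section_in that by (simp add: sec_scale_def fibre_dual dual_space_def)
  note sm = dual_section_apply_smooth[OF \<alpha>]
  show "tensorial (\<lambda>s x. X (\<lambda>y. snd (\<alpha> y) (s y)) x - snd (\<alpha> x) (D s x))"
    unfolding tensorial_def
  proof (intro conjI ballI allI impI)
    fix s t x assume st: "s \<in> \<Gamma>" "t \<in> \<Gamma>"
    show "X (\<lambda>y. snd (\<alpha> y) (sec_add E s t y)) x - snd (\<alpha> x) (D (sec_add E s t) x)
        = X (\<lambda>y. snd (\<alpha> y) (s y)) x - snd (\<alpha> x) (D s x) + (X (\<lambda>y. snd (\<alpha> y) (t y)) x - snd (\<alpha> x) (D t x))"
      using st by (simp add: \<alpha>_add D_add D_section X_add sm)
  next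
    fix f :: "'m \<Rightarrow> real" and s x assume f: "smooth_map_on \<A> UNIV f" and s: "s \<in> \<Gamma>"
    show "X (\<lambda>y. snd (\<alpha> y) (sec_scale E f s y)) x - snd (\<alpha> x) (D (sec_scale E f s) x)
        = f x * (X (\<lambda>y. snd (\<alpha> y) (s y)) x - snd (\<alpha> x) (D s x))"
      using f s by (simp add: \<alpha>_add \<alpha>_scale D_scale D_section sec_scale_section X_smooth X_mult sm algebra_simps)
  qed
  show "smooth_map_on \<A> UNIV (\<lambda>x. X (\<lambda>y. snd (\<alpha> y) (s y)) x - snd (\<alpha> x) (D s x))" if "s \<in> \<Gamma>" for s
    by (intro smooth_map_on_diff open_UNIV X_smooth sm D_section that)
qed

definition dual_deriv :: "('m \<Rightarrow> ('m, 'e) covector) \<Rightarrow> 'm \<Rightarrow> ('m, 'e) covector" where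
  "dual_deriv \<alpha> = (SOME \<beta>. \<beta> \<in> \<Gamma>' \<and>
     (\<forall>s\<in>\<Gamma>. \<forall>x. snd (\<beta> x) (s x) = X (\<lambda>y. snd (\<alpha> y) (s y)) x - snd (\<alpha> x) (D s x)))"

lemma
  assumes "\<alpha> \<in> \<Gamma>'"
  shows dual_deriv_section: "dual_deriv \<alpha> \<in> \<Gamma>'"
    and dual_deriv_apply: "s \<in> \<Gamma> \<Longrightarrow>
      snd (dual_deriv \<alpha> x) (s x) = X (\<lambda>y. snd (\<alpha> y) (s y)) x - snd (\<alpha> x) (D s x)"
  using someI_ex[OF dual_derivation_exists[OF assms]] unfolding dual_deriv_def by blast+

text \<open>Sections of the dual bundle are compared on sections of E, where additivity and the
  Leibniz rule of \<open>dual_deriv\<close> follow from those of X. The whole construction of lifts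
  is thereby available for multivectors.\<close>

lemma dual_bundle_derivation: "bundle_derivation \<A> (dual_bundle E) X dual_deriv"
proof -
  interpret dual: smooth_bundle \<A> "dual_bundle E" by (rule dual_bundle)
  show ?thesis
  proof
    show "dual_deriv \<alpha> \<in> \<Gamma>'" if "\<alpha> \<in> \<Gamma>'" for \<alpha> by (rule dual_deriv_section[OF that])
    have add: "snd (sec_add (dual_bundle E) \<alpha> \<beta> x) e = snd (\<alpha> x) e + snd (\<beta> x) e" for \<alpha> \<beta> x e
      by (simp add: sec_add_def dual_bundle_ops)
    have scale: "snd (sec_scale (dual_bundle E) f \<alpha> x) e = f x * snd (\<alpha> x) e" for f \<alpha> x e
      by (simp add: sec_scale_def dual_bundle_ops)
    show "dual_deriv (sec_add (dual_bundle E) \<alpha> \<beta>) = sec_add (dual_bundle E) (dual_deriv \<alpha>) (dual_deriv \<beta>)"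
      if "\<alpha> \<in> \<Gamma>'" "\<beta> \<in> \<Gamma>'" for \<alpha> \<beta>
      by (rule dual_section_eqI)
        (simp_all add: that dual.sec_add_section dual_deriv_section dual_deriv_apply add X_add
          dual_section_apply_smooth)
    show "dual_deriv (sec_scale (dual_bundle E) f \<alpha>)
        = sec_add (dual_bundle E) (sec_scale (dual_bundle E) f (dual_deriv \<alpha>)) (sec_scale (dual_bundle E) (X f) \<alpha>)"
      if "smooth_map_on \<A> UNIV f" "\<alpha> \<in> \<Gamma>'" for f \<alpha>
      by (rule dual_section_eqI)
        (simp_all add: that dual.sec_add_section dual.sec_scale_section X_smooth dual_deriv_section
          dual_deriv_apply add scale X_mult dual_section_apply_smooth algebra_simps)
  qed
qed

end

section \<open>The Leibniz rule for the pairing\<close>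

text \<open>For each k the map sending (I, j) to (\<open>I[k := j]\<close>, \<open>I ! k\<close>) is
  an involution of \<open>idx p\<close> x \<open>onb\<close>. It moves the matrix A from the
  components of the form to those of the multivector, transposing it.\<close>

lemma sum_idx_exchange:
  fixes A :: "'f::real_inner \<Rightarrow> 'f \<Rightarrow> real"
  shows "(\<Sum>I\<in>idx p. \<Sum>k<p. \<Sum>j\<in>onb. A (I ! k) j * h (I[k := j]) * q I)
    = (\<Sum>I\<in>idx p. \<Sum>k<p. \<Sum>j\<in>onb. A j (I ! k) * h I * q (I[k := j]))"
proof -
  have "(\<Sum>I\<in>idx p. \<Sum>j\<in>onb. A (I ! k) j * h (I[k := j]) * q I)
      = (\<Sum>I\<in>idx p. \<Sum>j\<in>onb. A j (I ! k) * h I * q (I[k := j]))" if k: "k < p" for k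
  proof -
    have upd: "I[k := j] \<in> idx p" "I ! k \<in> onb" "length I = p"
      if "I \<in> idx p" "j \<in> onb" for I :: "'f list" and j
      using that k set_update_subset_insert[of I k j] by (auto simp: idx_def)
    show ?thesis
      unfolding sum.cartesian_product
      by (rule sum.reindex_bij_witness[where i = "\<lambda>(I, j). (I[k := j], I ! k)"
            and j = "\<lambda>(I, j). (I[k := j], I ! k)"])
        (use k upd in auto)
  qed
  then show ?thesis
    by (subst (1 2) sum.swap) simp
qed

context smooth_bundle
begin

lemma pairing_wedge:
  assumes "Q \<in> forms \<A> (dual_bundle E) p" "length \<alpha>s = p" "set \<alpha>s \<subseteq> \<Gamma>'"
  shows "pairing E p (\<lambda>x. wedge_covectors E x (map (\<lambda>\<alpha>. \<alpha> x) \<alpha>s)) Q x = form_apply Q \<alpha>s x"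
proof -
  obtain U c where c: "(U, c) \<in> trivs E" "x \<in> U" by (rule triv_at)
  interpret fibre_chart E x c by (rule triv_chart[OF c])
  have Q: "Q x \<in> alt_forms (dual_bundle E) x p" using assms(1) by (simp add: forms_def)
  have \<xi>s: "length (map (\<lambda>\<alpha>. \<alpha> x) \<alpha>s) = p" "set (map (\<lambda>\<alpha>. \<alpha> x) \<alpha>s) \<subseteq> fibre (dual_bundle E) x"
    using assms dual_section_in by auto
  show ?thesis
    using pairing_frame[where P = Q and \<eta> = "\<lambda>x. wedge_covectors E x (map (\<lambda>\<alpha>. \<alpha> x) \<alpha>s)",
        OF wedge_covectors_alt[OF \<xi>s] Q]
      frame_pairing_wedge_covectors[OF Q \<xi>s] by (simp add: form_apply_def)
qed

lemma pairing_nondegenerate: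
  assumes "P \<in> forms \<A> (dual_bundle E) p" "Q \<in> forms \<A> (dual_bundle E) p"
    and "\<And>\<eta> x. \<eta> \<in> forms \<A> E p \<Longrightarrow> pairing E p \<eta> P x = pairing E p \<eta> Q x"
  shows "P = Q"
proof (rule smooth_bundle.forms_eqI[OF dual_bundle assms(1,2)])
  fix \<alpha>s x assume \<alpha>s: "length \<alpha>s = p" "set \<alpha>s \<subseteq> \<Gamma>'"
  show "form_apply P \<alpha>s x = form_apply Q \<alpha>s x"
    using assms(3)[OF wedge_form[OF \<alpha>s]] pairing_wedge[OF assms(1) \<alpha>s] pairing_wedge[OF assms(2) \<alpha>s]
    by simp
qed

text \<open>The smoothness clause of \<open>bundle_map\<close> speaks of frame vectors only;
  fibrewise linearity of \<rho> and the frame expansion of V carry it over to V.\<close>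

lemma anchor_section:
  assumes \<rho>: "bundle_map \<A> E (tangent_bundle \<A>) \<rho>" and V: "V \<in> \<Gamma>"
  shows "\<rho> \<circ> V \<in> smooth_sections \<A> (tangent_bundle \<A>)"
proof -
  have lin: "\<rho> e \<in> fibre (tangent_bundle \<A>) x"
    "e' \<in> fibre E x \<Longrightarrow> \<rho> (vadd E e e') = vadd (tangent_bundle \<A>) (\<rho> e) (\<rho> e')"
    "\<rho> (vscale E a e) = vscale (tangent_bundle \<A>) a (\<rho> e)" if "e \<in> fibre E x" for x e e' a
    using \<rho> that unfolding bundle_map_def by blast+
  have sm: "smooth_map_on \<A> (U \<inter> fst \<kappa>) (\<lambda>x. snd (\<rho> (inv_into (fibre E x) c w)) \<kappa>)"
    if c: "(U, c) \<in> trivs E" and \<kappa>: "\<kappa> \<in> \<A>" for U c \<kappa> w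
  proof -
    have "(fst \<kappa>, \<lambda>(x, v). v \<kappa>) \<in> trivs (tangent_bundle \<A>)"
      using \<kappa> by (simp add: tangent_bundle_def)
    with \<rho> c have "smooth_map_on \<A> (U \<inter> fst \<kappa>) (\<lambda>x. (\<lambda>(x, v). v \<kappa>) (\<rho> (inv_into (fibre E x) c w)))"
      unfolding bundle_map_def by blast
    then show ?thesis by (simp add: case_prod_beta)
  qed
  have "smooth_map_on \<A> (fst \<kappa>) (\<lambda>x. snd (\<rho> (V x)) \<kappa>)" if \<kappa>: "\<kappa> \<in> \<A>" for \<kappa>
  proof (rule smooth_map_on_local)
    fix x assume x: "x \<in> fst \<kappa>"
    obtain U c where c: "(U, c) \<in> trivs E" "x \<in> U" by (rule triv_at)
    have W: "open (U \<inter> fst \<kappa>)" using triv_open[OF c(1)] chart_open[OF \<kappa>] by blast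
    have "smooth_map_on \<A> (U \<inter> fst \<kappa>) (\<lambda>x. snd (\<rho> (V x)) \<kappa>)"
    proof (rule smooth_map_on_cong[OF W])
      show "smooth_map_on \<A> (U \<inter> fst \<kappa>)
          (\<lambda>y. \<Sum>b\<in>onb. (c (V y) \<bullet> b) *\<^sub>R snd (\<rho> (inv_into (fibre E y) c b)) \<kappa>)"
        by (intro smooth_map_on_sum smooth_map_on_scaleR smooth_map_on_inner_const W sm c \<kappa>
            smooth_map_on_subset[OF section_smooth[OF V c(1)]]) simp
      fix y assume "y \<in> U \<inter> fst \<kappa>"
      then interpret fibre_chart E y c by (intro triv_chart[OF c(1)]) simp
      show "(\<Sum>b\<in>onb. (c (V y) \<bullet> b) *\<^sub>R snd (\<rho> (F b)) \<kappa>) = snd (\<rho> (V y)) \<kappa>"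
        by (rule linear_frame_expand_scaleR[symmetric])
          (simp_all add: lin section_in[OF V] tangent_bundle_def case_prod_beta)
    qed
    then show "\<exists>W. open W \<and> x \<in> W \<and> smooth_map_on \<A> W (\<lambda>x. snd (\<rho> (V x)) \<kappa>)"
      using W c(2) x by blast
  qed
  then have "\<forall>(U, d)\<in>trivs (tangent_bundle \<A>). smooth_map_on \<A> U (\<lambda>x. d ((\<rho> \<circ> V) x))"
    by (auto simp: tangent_bundle_def case_prod_beta)
  moreover have "(\<rho> \<circ> V) x \<in> fibre (tangent_bundle \<A>) x" for x
    using lin(1) section_in[OF V] by simp
  ultimately show ?thesis by (simp add: smooth_sections_def)
qed

end

lemma (in smooth_mfd) lie_deriv_fun_derivation:
  assumes "Y \<in> smooth_sections \<A> (tangent_bundle \<A>)"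
  shows "function_derivation \<A> (lie_deriv_fun \<A> Y)"
proof
  show "lie_deriv_fun \<A> Y f x = lie_deriv_fun \<A> Y g x"
    if "open W" "x \<in> W" "\<And>y. y \<in> W \<Longrightarrow> f y = g y" for W x f g
    using that vector_field(1)[OF assms] by (intro lie_deriv_fun_cong_open[where W = W])
qed (simp_all add: lie_deriv_fun_smooth[OF assms] lie_deriv_fun_add[OF assms]
    lie_deriv_fun_mult[OF assms] lie_deriv_fun_const[OF assms])

context bundle_derivation
begin

abbreviation dual_lift :: "nat \<Rightarrow> ('m \<Rightarrow> ('m, 'e) covector list \<Rightarrow> real) \<Rightarrow> 'm \<Rightarrow> ('m, 'e) covector list \<Rightarrow> real" where
  "dual_lift \<equiv> bundle_derivation.lift_form \<A> (dual_bundle E) X dual_deriv"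

text \<open>In a local frame and its dual coframe, the matrix of \<open>dual_deriv\<close> is minus the transpose of
  the matrix of \<open>D\<close>, so that the terms containing these matrices cancel.\<close>

lemma pairing_lift:
  assumes \<eta>: "\<eta> \<in> forms \<A> E p" and P: "P \<in> forms \<A> (dual_bundle E) p"
  shows "pairing E p \<eta> (dual_lift p P) x = X (pairing E p \<eta> P) x - pairing E p (lift_form p \<eta>) P x"
proof -
  interpret dual: bundle_derivation \<A> "dual_bundle E" X dual_deriv by (rule dual_bundle_derivation)
  obtain U c where c: "(U, c) \<in> trivs E" "x \<in> U" by (rule triv_at)
  obtain W S where W: "open W" "x \<in> W" "W \<subseteq> U" and S: "\<And>w. S w \<in> \<Gamma>"
    "\<And>w y. y \<in> W \<Longrightarrow> S w y = inv_into (fibre E y) c w"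
    by (rule frame_extension[OF c]) (rule that)
  have c': "(U, dual_coord E c) \<in> trivs (dual_bundle E)" using c(1) by (auto simp: trivs_dual)
  obtain W' S' where W': "open W'" "x \<in> W'" "W' \<subseteq> U" and S': "\<And>w. S' w \<in> \<Gamma>'"
    "\<And>w y. y \<in> W' \<Longrightarrow> S' w y = inv_into (fibre (dual_bundle E) y) (dual_coord E c) w"
    by (rule dual.frame_extension[OF c' c(2)]) (rule that)
  \<comment> \<open>The extended frame and the extended coframe are dual to each other only where
    both agree with the local ones, so all local identities are used on this intersection.\<close>
  have O: "open (W \<inter> W')" "x \<in> W \<inter> W'" using W W' by auto
  have pair: "pairing E p \<theta> Q y = (\<Sum>I\<in>idx p. form_apply \<theta> (map S I) y * form_apply Q (map S' I) y) / fact p"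
    if "\<theta> \<in> forms \<A> E p" "Q \<in> forms \<A> (dual_bundle E) p" "y \<in> W \<inter> W'" for \<theta> Q y
  proof -
    have y: "y \<in> U" using that(3) W(3) by auto
    interpret fibre_chart E y c by (rule triv_chart[OF c(1) y])
    have "map (\<lambda>V. V y) (map S I) = map F I" "map (\<lambda>V. V y) (map S' I) = map coframe I" for I
      using S(2) S'(2) that(3) by (simp_all add: inv_dual_coord)
    then show ?thesis
      using pairing_frame[where \<eta> = \<theta> and P = Q, OF forms_alt[OF that(1)] dual.forms_alt[OF that(2)]]
      by (simp only: form_apply_def frame_pairing_def)
  qed
  interpret fibre_chart E x c by (rule triv_chart[OF c])
  interpret dchart: fibre_chart "dual_bundle E" x "dual_coord E c" by (rule dual_chart)
  have Sx: "S w x = F w" for w using S(2) W(2) by simp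
  have S'x: "S' w x = coframe w" for w using S'(2) W'(2) by (simp add: inv_dual_coord)
  have len: "length (map S I) = p" "set (map S I) \<subseteq> \<Gamma>" "length (map S' I) = p" "set (map S' I) \<subseteq> \<Gamma>'"
    if "I \<in> idx p" for I
    using that S(1) S'(1) by (auto simp: idx_def)
  define A where "A b j = c (D (S b) x) \<bullet> j" for b j
  \<comment> \<open>The pairing of coframe and frame is the constant \<open>b \<bullet> j\<close>
    near x, so X annihilates it and only the term with D remains; it contributes minus the
    transposed matrix.\<close>
  have A': "dual_coord E c (dual_deriv (S' b) x) \<bullet> j = - A j b" for b j
  proof -
    have "dual_coord E c (dual_deriv (S' b) x) \<bullet> j = snd (dual_deriv (S' b) x) (S j x)"
      using dual_coord_inner[OF dual_section_in[OF dual_deriv_section[OF S'(1)]]] by (simp add: Sx)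
    also have "\<dots> = X (\<lambda>y. snd (S' b y) (S j y)) x - snd (S' b x) (D (S j) x)"
      by (rule dual_deriv_apply[OF S'(1) S(1)])
    also have "X (\<lambda>y. snd (S' b y) (S j y)) x = X (\<lambda>_. b \<bullet> j) x"
    proof (rule X_local[OF O])
      fix y assume y: "y \<in> W \<inter> W'"
      interpret y: fibre_chart E y c by (rule triv_chart[OF c(1)]) (use y W(3) in auto)
      show "snd (S' b y) (S j y) = b \<bullet> j"
        using y S(2) S'(2) by (simp add: y.inv_dual_coord y.coframe_apply)
    qed
    also have "snd (S' b x) (D (S j) x) = A j b"
      using section_in[OF D_section[OF S(1)]] by (simp add: S'x coframe_apply A_def inner_commute)
    finally show ?thesis by (simp add: X_const)
  qed
  define h where "h I = \<eta> x (map F I)" for I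
  define q where "q I = P x (map coframe I)" for I
  have fa: "form_apply \<eta> (map S I) x = h I" "form_apply P (map S' I) x = q I" for I
    by (simp_all add: form_apply_def h_def q_def Sx S'x o_def)
  have D\<eta>: "form_apply \<eta> ((map S I)[k := D (map S I ! k)]) x = (\<Sum>j\<in>onb. A (I ! k) j * h (I[k := j]))"
    if I: "I \<in> idx p" and k: "k < p" for I k
  proof -
    have "form_apply \<eta> ((map S I)[k := D (map S I ! k)]) x = \<eta> x ((map F I)[k := D (S (I ! k)) x])"
      using I k by (simp add: form_apply_def map_update Sx o_def idx_def)
    also have "\<dots> = (\<Sum>j\<in>onb. A (I ! k) j * \<eta> x ((map F I)[k := F j]))"
      unfolding A_def
      by (rule alt_forms_expand_slot[OF forms_alt[OF \<eta>]])
        (use I k section_in[OF D_section[OF S(1)]] in \<open>auto simp: idx_def\<close>)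
    finally show ?thesis by (simp add: h_def map_update)
  qed
  have DP: "form_apply P ((map S' I)[k := dual_deriv (map S' I ! k)]) x = (\<Sum>j\<in>onb. - A j (I ! k) * q (I[k := j]))"
    if I: "I \<in> idx p" and k: "k < p" for I k
  proof -
    have "form_apply P ((map S' I)[k := dual_deriv (map S' I ! k)]) x
        = P x ((map coframe I)[k := dual_deriv (S' (I ! k)) x])"
      using I k by (simp add: form_apply_def map_update S'x o_def idx_def)
    also have "\<dots> = (\<Sum>j\<in>onb. (dual_coord E c (dual_deriv (S' (I ! k)) x) \<bullet> j)
        * P x ((map coframe I)[k := dchart.F j]))"
      by (rule dchart.alt_forms_expand_slot[OF dual.forms_alt[OF P]])
        (use I k dual_section_in[OF dual_deriv_section[OF S'(1)]] coframe_in in \<open>auto simp: idx_def\<close>)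
    finally show ?thesis by (simp add: q_def map_update A' inv_dual_coord)
  qed
  let ?X\<eta> = "\<lambda>I. X (form_apply \<eta> (map S I)) x" and ?XP = "\<lambda>I. X (form_apply P (map S' I)) x"
  have L\<eta>: "form_apply (lift_form p \<eta>) (map S I) x = ?X\<eta> I - (\<Sum>k<p. \<Sum>j\<in>onb. A (I ! k) j * h (I[k := j]))"
    if I: "I \<in> idx p" for I
    unfolding lift_form_apply[OF \<eta> len(1,2)[OF I]] lift_on_def using D\<eta>[OF I] by simp
  have LP: "form_apply (dual.lift_form p P) (map S' I) x
      = ?XP I + (\<Sum>k<p. \<Sum>j\<in>onb. A j (I ! k) * q (I[k := j]))" if I: "I \<in> idx p" for I
    unfolding dual.lift_form_apply[OF P len(3,4)[OF I]] dual.lift_on_def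
    using DP[OF I] by (simp add: sum_negf)
  have sm: "smooth_map_on \<A> UNIV (form_apply \<eta> (map S I))" "smooth_map_on \<A> UNIV (form_apply P (map S' I))"
    if "I \<in> idx p" for I
    using form_apply_smooth[OF \<eta> len(1,2)[OF that]] dual.form_apply_smooth[OF P len(3,4)[OF that]] .
  \<comment> \<open>By locality the pairing may be replaced by its frame formula near x. The factors
    of that formula are values on global sections, hence globally smooth, and X can be applied term
    by term.\<close>
  have "X (pairing E p \<eta> P) x
      = X (\<lambda>y. \<Sum>I\<in>idx p. 1 / fact p * (form_apply \<eta> (map S I) y * form_apply P (map S' I) y)) x"
    by (rule X_local[OF O]) (simp add: pair[OF \<eta> P] sum_divide_distrib)
  also have "\<dots> = (\<Sum>I\<in>idx p. X (\<lambda>y. 1 / fact p * (form_apply \<eta> (map S I) y * form_apply P (map S' I) y)) x)"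
    by (intro X_sum smooth_map_on_mult sm smooth_map_on_const open_UNIV)
  also have "\<dots> = (\<Sum>I\<in>idx p. 1 / fact p * (h I * ?XP I + ?X\<eta> I * q I))"
  proof (intro sum.cong refl)
    fix I :: "'f list" assume I: "I \<in> idx p"
    show "X (\<lambda>y. 1 / fact p * (form_apply \<eta> (map S I) y * form_apply P (map S' I) y)) x
        = 1 / fact p * (h I * ?XP I + ?X\<eta> I * q I)"
      using X_cmult[OF smooth_map_on_mult[OF open_UNIV sm[OF I]], of "1 / fact p" x] X_mult[OF sm[OF I], of x]
      by (simp only: fa)
  qed
  also have "\<dots> = (\<Sum>I\<in>idx p. h I * ?XP I + ?X\<eta> I * q I) / fact p"
    by (simp add: sum_divide_distrib)
  finally have 1: "X (pairing E p \<eta> P) x = (\<Sum>I\<in>idx p. h I * ?XP I + ?X\<eta> I * q I) / fact p" .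
  have 2: "pairing E p (lift_form p \<eta>) P x
      = (\<Sum>I\<in>idx p. (?X\<eta> I - (\<Sum>k<p. \<Sum>j\<in>onb. A (I ! k) j * h (I[k := j]))) * q I) / fact p"
    using pair[OF lift_form_in[OF \<eta>] P O(2)] by (simp add: L\<eta> fa)
  have 3: "pairing E p \<eta> (dual.lift_form p P) x
      = (\<Sum>I\<in>idx p. h I * (?XP I + (\<Sum>k<p. \<Sum>j\<in>onb. A j (I ! k) * q (I[k := j])))) / fact p"
    using pair[OF \<eta> dual.lift_form_in[OF P] O(2)] by (simp add: LP fa)
  \<comment> \<open>The derivatives of the components match by the product rule; what is left are
    the two sums containing A, which the index exchange identifies.\<close>
  have "(\<Sum>I\<in>idx p. (\<Sum>k<p. \<Sum>j\<in>onb. A (I ! k) j * h (I[k := j])) * q I)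
      = (\<Sum>I\<in>idx p. h I * (\<Sum>k<p. \<Sum>j\<in>onb. A j (I ! k) * q (I[k := j])))"
    using sum_idx_exchange[of A h q p] by (simp add: sum_distrib_left sum_distrib_right mult_ac)
  then show ?thesis
    unfolding 1 2 3
    by (simp add: algebra_simps sum.distrib sum_subtractf flip: diff_divide_distrib add_divide_distrib)
qed

end

section \<open>The derivation of multivectors\<close>

context smooth_bundle
begin

lemma scalar_field_form: "smooth_map_on \<A> UNIV f \<Longrightarrow> scalar_field f \<in> forms \<A> E 0"
  by (rule formsI) (auto simp: alt_forms_def scalar_field_def form_apply_def[abs_def])

lemma form_0_scalar_field:
  assumes "\<eta> \<in> forms \<A> E 0"
  shows "\<eta> = scalar_field (\<lambda>x. \<eta> x [])" "smooth_map_on \<A> UNIV (\<lambda>x. \<eta> x [])"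
proof -
  show "\<eta> = scalar_field (\<lambda>x. \<eta> x [])"
    using alt_forms_outside[OF forms_alt[OF assms]] by (auto simp: scalar_field_def fun_eq_iff)
  show "smooth_map_on \<A> UNIV (\<lambda>x. \<eta> x [])"
    using form_apply_smooth[OF assms, of "[]"] by (simp add: form_apply_def[abs_def])
qed

end

context bundle_derivation
begin

text \<open>In degree 0 the sum over slots is empty, so the action on functions is the case p = 0 of
  the same lift and needs no separate component in the graded operator.\<close>

lemma lift_form_scalar_field: "lift_form 0 (scalar_field f) = scalar_field (X f)"
  by (auto simp: lift_form_def lift_on_def scalar_field_def form_apply_def[abs_def] fun_eq_iff)

lemma lift_form_zero: "lift_form p (\<lambda>_ _. 0) = (\<lambda>_ _. 0)"
proof -
  have "(\<lambda>_ _. 0) \<in> forms \<A> E p"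
    by (rule formsI) (simp_all add: alt_forms_zero form_apply_def[abs_def])
  from lift_form_lincomb[OF this this, of 0 0] show ?thesis by simp
qed

text \<open>The operator lifts every homogeneous component separately; it preserves finite support
  because the lift of 0 is 0. Conversely the conditions fix it on homogeneous elements, linearity
  extends this to their finite sums, and \<open>extensional\<close> fixes its values outside the
  graded space.\<close>

lemma graded_lift_unique:
  assumes "G = graded_multivectors \<A> E"
  shows "\<exists>!L. L \<in> extensional G \<and> graded_endomorphism_deg0 \<A> E L \<and>
    (\<forall>f\<in>smooth_functions \<A>. L (homog 0 (scalar_field f)) = homog 0 (scalar_field (X f))) \<and>
    (\<forall>p\<ge>1. \<forall>P\<in>multivectors \<A> E p. L (homog p P) = homog p (dual_lift p P))"
    (is "\<exists>!L. ?lift L")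
proof -
  interpret dual: bundle_derivation \<A> "dual_bundle E" X dual_deriv by (rule dual_bundle_derivation)
  note G = assms
  have mv: "multivectors \<A> E p = forms \<A> (dual_bundle E) p" for p by (simp add: multivectors_def)
  have zero: "(\<lambda>_ _. 0) \<in> forms \<A> (dual_bundle E) p" for p
    by (rule dual.formsI) (simp_all add: alt_forms_zero form_apply_def[abs_def])
  have homog_G: "homog p P \<in> G" if "P \<in> multivectors \<A> E p" for p P
  proof -
    have "{q. homog p P q \<noteq> (\<lambda>_ _. 0)} \<subseteq> {p}" by (auto simp: homog_def)
    then show ?thesis
      using that zero finite_subset[OF _ finite.emptyI[THEN finite.insertI]]
      by (auto simp: G graded_multivectors_def mv homog_def)
  qed
  define L where "L = restrict (\<lambda>P p. dual.lift_form p (P p)) G"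
  have L_homog: "L (homog p P) = homog p (dual.lift_form p P)" if "P \<in> multivectors \<A> E p" for p P
    using homog_G[OF that] by (auto simp: L_def homog_def dual.lift_form_zero)
  have lincomb_G: "(\<lambda>p x \<xi>s. a * P p x \<xi>s + b * Q p x \<xi>s) \<in> G" if "P \<in> G" "Q \<in> G" for P Q a b
  proof -
    have "{p. (\<lambda>x \<xi>s. a * P p x \<xi>s + b * Q p x \<xi>s) \<noteq> (\<lambda>_ _. 0)}
        \<subseteq> {p. P p \<noteq> (\<lambda>_ _. 0)} \<union> {p. Q p \<noteq> (\<lambda>_ _. 0)}" by auto
    then have "finite {p. (\<lambda>x \<xi>s. a * P p x \<xi>s + b * Q p x \<xi>s) \<noteq> (\<lambda>_ _. 0)}"
      by (rule finite_subset) (use that in \<open>auto simp: G graded_multivectors_def\<close>)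
    then show ?thesis
      using that dual.forms_lincomb by (simp add: G graded_multivectors_def mv)
  qed
  have "L P \<in> G" if "P \<in> G" for P
  proof -
    have "{p. L P p \<noteq> (\<lambda>_ _. 0)} \<subseteq> {p. P p \<noteq> (\<lambda>_ _. 0)}"
      using that by (auto simp: L_def dual.lift_form_zero)
    then have "finite {p. L P p \<noteq> (\<lambda>_ _. 0)}"
      by (rule finite_subset) (use that in \<open>auto simp: G graded_multivectors_def\<close>)
    then show ?thesis
      using that dual.lift_form_in by (simp add: L_def G graded_multivectors_def mv)
  qed
  moreover have L_lin: "L (\<lambda>p x \<xi>s. a * P p x \<xi>s + b * Q p x \<xi>s) = (\<lambda>p x \<xi>s. a * L P p x \<xi>s + b * L Q p x \<xi>s)"
    if "P \<in> G" "Q \<in> G" for P Q a b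
    using that lincomb_G[OF that, of a b]
    by (simp add: L_def dual.lift_form_lincomb G graded_multivectors_def mv)
  moreover have "L ` homog p ` multivectors \<A> E p \<subseteq> homog p ` multivectors \<A> E p" for p
    using L_homog dual.lift_form_in mv by auto
  ultimately have L_end: "graded_endomorphism_deg0 \<A> E L"
    unfolding graded_endomorphism_deg0_def G by blast
  have "L (homog 0 (scalar_field f)) = homog 0 (scalar_field (X f))" if "f \<in> smooth_functions \<A>" for f
    using L_homog[of "scalar_field f" 0] dual.scalar_field_form[of f] that
    by (simp add: mv smooth_functions_def dual.lift_form_scalar_field)
  then have "?lift L"
    using L_end L_homog by (simp add: L_def)
  moreover have "L' = L" if L': "?lift L'" for L'
  proof (rule extensionalityI)
    show "L' \<in> extensional G" "L \<in> extensional G" using L' by (simp_all add: L_def)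
    have end': "L' (\<lambda>p x \<xi>s. a * P p x \<xi>s + b * Q p x \<xi>s) = (\<lambda>p x \<xi>s. a * L' P p x \<xi>s + b * L' Q p x \<xi>s)"
      if "P \<in> G" "Q \<in> G" for P Q a b
      using L' that unfolding graded_endomorphism_deg0_def G by blast
    have L'_homog: "L' (homog p P) = L (homog p P)" if P: "P \<in> multivectors \<A> E p" for p P
    proof (cases "p = 0")
      case True
      then have P0: "P \<in> forms \<A> (dual_bundle E) 0" using P by (simp add: mv)
      have "(\<lambda>x. P x []) \<in> smooth_functions \<A>"
        using dual.form_0_scalar_field(2)[OF P0] by (simp add: smooth_functions_def)
      then have "L' (homog 0 (scalar_field (\<lambda>x. P x []))) = homog 0 (scalar_field (X (\<lambda>x. P x [])))"
        using L' by blast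
      also have "\<dots> = homog 0 (dual.lift_form 0 (scalar_field (\<lambda>x. P x [])))"
        by (simp add: dual.lift_form_scalar_field)
      finally show ?thesis
        using L_homog[OF P] True by (simp flip: dual.form_0_scalar_field(1)[OF P0])
    next
      case False
      then have "L' (homog p P) = homog p (dual.lift_form p P)" using L' P by simp
      then show ?thesis using L_homog[OF P] by simp
    qed
    \<comment> \<open>Induction on a finite set of degrees containing the support: setting the
      component in degree q to 0 splits off one homogeneous element and leaves an element supported
      in the smaller set.\<close>
    have "L' P = L P" if "finite N" "P \<in> G" "{p. P p \<noteq> (\<lambda>_ _. 0)} \<subseteq> N" for N P
      using that
    proof (induction N arbitrary: P)
      case empty
      \<comment> \<open>With empty support P is 0 and hence the combination of P with itself with
        coefficients 0, so linearity forces both operators to vanish on it.\<close>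
      have P0: "(\<lambda>p x \<xi>s. 0 * P p x \<xi>s + 0 * P p x \<xi>s) = P" using empty(2) by (auto simp: fun_eq_iff)
      have "L' P = (\<lambda>_ _ _. 0)" "L P = (\<lambda>_ _ _. 0)"
        using end'[OF empty(1,1), of 0 0] L_lin[OF empty(1,1), of 0 0] unfolding P0 by simp_all
      then show ?case by simp
    next
      case (insert q N)
      let ?R = "P(q := (\<lambda>_ _. 0))"
      have q: "P q \<in> multivectors \<A> E q" using insert.prems(1) by (simp add: G graded_multivectors_def)
      have "finite {p. P p \<noteq> (\<lambda>_ _. 0)}" using insert.prems(1) by (simp add: G graded_multivectors_def)
      then have "finite {p. ?R p \<noteq> (\<lambda>_ _. 0)}" by (rule rev_finite_subset) auto
      then have R: "?R \<in> G"
        using insert.prems(1) zero by (auto simp: G graded_multivectors_def mv)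
      have dec: "(\<lambda>p x \<xi>s. 1 * homog q (P q) p x \<xi>s + 1 * ?R p x \<xi>s) = P"
        by (auto simp: homog_def fun_eq_iff)
      note lin = end'[OF homog_G[OF q] R, of 1 1, unfolded dec] L_lin[OF homog_G[OF q] R, of 1 1, unfolded dec]
      have "L' ?R = L ?R"
        by (rule insert.IH[OF R]) (use insert.prems(2) in auto)
      then show ?case unfolding lin L'_homog[OF q] by simp
    qed
    then show "L' P = L P" if "P \<in> G" for P
      using that by (auto simp: G graded_multivectors_def)
  qed
  ultimately show ?thesis by (rule ex1I)
qed

text \<open>Existence is \<open>pairing_lift\<close> and uniqueness is
  \<open>pairing_nondegenerate\<close>. As an equivalence with an equation it settles both the
  unique existence of Q and the description of the operator in the theorem.\<close>

lemma dual_lift_characterisation: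
  assumes P: "P \<in> multivectors \<A> E p"
  shows "Q \<in> multivectors \<A> E p \<and>
      (\<forall>\<eta>\<in>forms \<A> E p. \<forall>x. pairing E p \<eta> Q x = X (pairing E p \<eta> P) x - pairing E p (lift_form p \<eta>) P x)
    \<longleftrightarrow> Q = dual_lift p P"
proof -
  have P': "P \<in> forms \<A> (dual_bundle E) p" using P by (simp add: multivectors_def)
  have L: "dual_lift p P \<in> forms \<A> (dual_bundle E) p"
    by (rule bundle_derivation.lift_form_in[OF dual_bundle_derivation P'])
  show ?thesis
    using pairing_nondegenerate[OF _ L] L pairing_lift[OF _ P'] unfolding multivectors_def by metis
qed

end

theorem proposition4p1p5:
  fixes \<A> :: "('m::{t2_space, second_countable_topology}, 'b::real_inner) chart set"
    and E :: "('m, 'e, 'f::real_inner) vbundle"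
    and br :: "('m \<Rightarrow> 'e) \<Rightarrow> ('m \<Rightarrow> 'e) \<Rightarrow> 'm \<Rightarrow> 'e"
    and \<rho> :: "'e \<Rightarrow> ('m, 'b) tvector"
    and V :: "'m \<Rightarrow> 'e"
  assumes "lie_algebroid \<A> E br \<rho>"
    and "V \<in> smooth_sections \<A> E"
  shows "\<exists>!L. L \<in> extensional (graded_multivectors \<A> E) \<and>
     graded_endomorphism_deg0 \<A> E L \<and>
     (\<forall>f\<in>smooth_functions \<A>.
        L (homog 0 (scalar_field f)) = homog 0 (scalar_field (\<lambda>x. differential \<A> f ((\<rho> \<circ> V) x))) \<and>
        L (homog 0 (scalar_field f)) = homog 0 (scalar_field (lie_deriv_fun \<A> (\<rho> \<circ> V) f))) \<and>
     (\<forall>p\<ge>1. \<forall>P\<in>multivectors \<A> E p.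
        (\<exists>!Q. Q \<in> multivectors \<A> E p \<and>
           (\<forall>\<eta>\<in>forms \<A> E p. \<forall>x.
              pairing E p \<eta> Q x = lie_deriv_fun \<A> (\<rho> \<circ> V) (pairing E p \<eta> P) x
                - pairing E p (lie_deriv_form \<A> E br \<rho> V p \<eta>) P x)) \<and>
        (\<exists>Q\<in>multivectors \<A> E p. L (homog p P) = homog p Q \<and>
           (\<forall>\<eta>\<in>forms \<A> E p. \<forall>x.
              pairing E p \<eta> Q x = lie_deriv_fun \<A> (\<rho> \<circ> V) (pairing E p \<eta> P) x
                - pairing E p (lie_deriv_form \<A> E br \<rho> V p \<eta>) P x)))"
proof -
  define X where "X = lie_deriv_fun \<A> (\<rho> \<circ> V)"
  note la = assms(1)[unfolded lie_algebroid_def Let_def]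
  interpret smooth_bundle \<A> E
    by unfold_locales (rule la[THEN conjunct1], rule la[THEN conjunct2, THEN conjunct1])
  have \<rho>: "bundle_map \<A> E (tangent_bundle \<A>) \<rho>"
    by (rule la[THEN conjunct2, THEN conjunct2, THEN conjunct1])
  have V: "V \<in> \<Gamma>" by (rule assms(2))
  have "function_derivation \<A> X"
    unfolding X_def by (rule lie_deriv_fun_derivation[OF anchor_section[OF \<rho> V]])
  then interpret function_derivation \<A> X .
  have "\<forall>s\<in>\<Gamma>. \<forall>t\<in>\<Gamma>. br s t \<in> \<Gamma>"
    using la by (elim conjE)
  moreover have "\<forall>s\<in>\<Gamma>. \<forall>t\<in>\<Gamma>. \<forall>u\<in>\<Gamma>.
      br (sec_add E s t) u = sec_add E (br s u) (br t u) \<and>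
      br u (sec_add E s t) = sec_add E (br u s) (br u t)"
    using la by (elim conjE)
  moreover have "\<forall>s\<in>\<Gamma>. \<forall>t\<in>\<Gamma>. \<forall>f\<in>smooth_functions \<A>.
      br s (sec_scale E f t) =
        sec_add E (sec_scale E f (br s t)) (sec_scale E (lie_deriv_fun \<A> (\<rho> \<circ> s) f) t)"
    using la by (elim conjE)
  ultimately interpret bundle_derivation \<A> E X "br V"
    using V by unfold_locales (simp_all add: X_def smooth_functions_def)
  \<comment> \<open>For p \<ge> 1 the definition of \<open>lie_deriv_form\<close> is a definite
    description whose defining condition is that of the lift for \<open>br V\<close>;
    \<open>forms_eqI\<close> supplies uniqueness.\<close>
  have form: "lie_deriv_form \<A> E br \<rho> V p \<eta> = lift_form p \<eta>" if "p \<ge> 1" and \<eta>: "\<eta> \<in> forms \<A> E p" for p \<eta>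
  proof -
    have "(THE \<theta>. \<theta> \<in> forms \<A> E p \<and> (\<forall>Vs. length Vs = p \<and> set Vs \<subseteq> \<Gamma> \<longrightarrow>
        (\<forall>x. form_apply \<theta> Vs x = lift_on p \<eta> Vs x))) = lift_form p \<eta>"
    proof (rule the_equality)
      show "lift_form p \<eta> \<in> forms \<A> E p \<and> (\<forall>Vs. length Vs = p \<and> set Vs \<subseteq> \<Gamma> \<longrightarrow>
          (\<forall>x. form_apply (lift_form p \<eta>) Vs x = lift_on p \<eta> Vs x))"
        using lift_form_in[OF \<eta>] lift_form_apply[OF \<eta>] by blast
      show "\<theta> = lift_form p \<eta>"
        if "\<theta> \<in> forms \<A> E p \<and> (\<forall>Vs. length Vs = p \<and> set Vs \<subseteq> \<Gamma> \<longrightarrow>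
          (\<forall>x. form_apply \<theta> Vs x = lift_on p \<eta> Vs x))" for \<theta>
        by (rule forms_eqI[OF _ lift_form_in[OF \<eta>]]) (use that lift_form_apply[OF \<eta>] in auto)
    qed
    then show ?thesis
      using that(1) unfolding lie_deriv_form_def lift_on_def X_def[symmetric] by simp
  qed
  have char: "Q \<in> multivectors \<A> E p \<and>
      (\<forall>\<eta>\<in>forms \<A> E p. \<forall>x.
        pairing E p \<eta> Q x = X (pairing E p \<eta> P) x - pairing E p (lie_deriv_form \<A> E br \<rho> V p \<eta>) P x)
      \<longleftrightarrow> Q = dual_lift p P" if "p \<ge> 1" "P \<in> multivectors \<A> E p" for p P Q
    using dual_lift_characterisation[OF that(2), of Q] by (simp add: form[OF that(1)])
  have "(\<lambda>x. differential \<A> f ((\<rho> \<circ> V) x)) = X f" for f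
    by (simp add: X_def lie_deriv_fun_def[abs_def])
  then have 0: "(\<forall>f\<in>smooth_functions \<A>.
        L (homog 0 (scalar_field f)) = homog 0 (scalar_field (\<lambda>x. differential \<A> f ((\<rho> \<circ> V) x))) \<and>
        L (homog 0 (scalar_field f)) = homog 0 (scalar_field (X f)))
      \<longleftrightarrow> (\<forall>f\<in>smooth_functions \<A>. L (homog 0 (scalar_field f)) = homog 0 (scalar_field (X f)))" for L
    by simp
  \<comment> \<open>By \<open>char\<close> the condition on Q is an equation, so the unique
    existence holds outright and the remaining clause only says which element the operator assigns
    to P.\<close>
  have p: "(\<forall>p\<ge>1. \<forall>P\<in>multivectors \<A> E p.
        (\<exists>!Q. Q \<in> multivectors \<A> E p \<and>
           (\<forall>\<eta>\<in>forms \<A> E p. \<forall>x. pairing E p \<eta> Q x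
              = X (pairing E p \<eta> P) x - pairing E p (lie_deriv_form \<A> E br \<rho> V p \<eta>) P x)) \<and>
        (\<exists>Q\<in>multivectors \<A> E p. L (homog p P) = homog p Q \<and>
           (\<forall>\<eta>\<in>forms \<A> E p. \<forall>x. pairing E p \<eta> Q x
              = X (pairing E p \<eta> P) x - pairing E p (lie_deriv_form \<A> E br \<rho> V p \<eta>) P x)))
      \<longleftrightarrow> (\<forall>p\<ge>1. \<forall>P\<in>multivectors \<A> E p. L (homog p P) = homog p (dual_lift p P))" for L
  proof (intro all_cong ball_cong refl)
    fix p :: nat and P assume pP: "p \<ge> 1" "P \<in> multivectors \<A> E p"
    let ?Q = "\<lambda>Q. \<forall>\<eta>\<in>forms \<A> E p. \<forall>x. pairing E p \<eta> Q x
        = X (pairing E p \<eta> P) x - pairing E p (lie_deriv_form \<A> E br \<rho> V p \<eta>) P x"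
    have eq: "Q \<in> multivectors \<A> E p \<and> ?Q Q \<longleftrightarrow> Q = dual_lift p P" for Q
      by (rule char[OF pP])
    have "(\<exists>Q\<in>multivectors \<A> E p. L (homog p P) = homog p Q \<and> ?Q Q)
        \<longleftrightarrow> L (homog p P) = homog p (dual_lift p P)"
      using eq by metis
    then show "(\<exists>!Q. Q \<in> multivectors \<A> E p \<and> ?Q Q) \<and>
        (\<exists>Q\<in>multivectors \<A> E p. L (homog p P) = homog p Q \<and> ?Q Q)
        \<longleftrightarrow> L (homog p P) = homog p (dual_lift p P)"
      by (simp only: eq) simp
  qed
  show ?thesis
    unfolding X_def[symmetric] 0 p by (rule graded_lift_unique[OF refl])
qed

end
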